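(* For each of the following items there are an integer $d\ge3$ and a closed, non-discrete, compactly generated subgroup of $\mathrm{Aut}(T_d)$ which is locally (i) intransitive and contains a quasi-central inversion; (ii) transitive and contains a non-trivial quasi-central edge-fixating element; (iii) semiprimitive and contains a non-trivial quasi-central elliptic element; (iv)(a) intransitive and contains a quasi-central hyperbolic element of length $1$; (iv)(b) quasiprimitive and contains a quasi-central hyperbolic element of length $2$.
   Context: $T_d=(V,E)$ is the $d$-regular tree (Serre's convention: $E$ consists of oriented edges with inversion $e\mapsto\overline e$; $E(x)$ is the set of edges with origin $x$). $\mathrm{Aut}(T_d)$ carries the permutation topology for its action on $V\cup E$ (basic open sets prescribe the images of finitely many points). For a topological group $H$, an element $h\in H$ is quasi-central if it lies in the quasi-center $\mathrm{QZ}(H):=\{h\in H\mid Z_H(h)\text{ is open in }H\}$. For $H\le\mathrm{Aut}(T_d)$ and $x\in V$, $H_x^{(1)}\le\mathrm{Sym}(E(x))$ is the permutation group induced by the stabilizer $H_x$ on $E(x)$; $H$ is locally "X" if $H_x^{(1)}$ has property "X" for all $x\in V$. A permutation group is quasiprimitive if it is transitive and all its non-trivial normal subgroups are transitive; semiprimitive if it is transitive and all its normal subgroups are transitive or semiregular (all point stabilizers trivial). Automorphism types: for $g\in\mathrm{Aut}(T_d)$ let $l(g)=\min_{x\in V}d(x,gx)$ and $V(g)=\{x\in V\mid d(x,gx)=l(g)\}$. If $l(g)=0$, $g$ is elliptic. If $l(g)>0$ and $V(g)$ is infinite, $g$ is hyperbolic of length $l(g)$. If $l(g)>0$ and $V(g)$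 is finite then $l(g)=1$, $g$ maps some edge $e$ to $\overline e$ and $g$ is an inversion. An element is edge-fixating if it fixes some edge $e\in E$. *)

theory Defs
  imports "HOL-Analysis.Abstract_Topology" "HOL-Algebra.Group_Action" "HOL-Algebra.Generated_Groups"
begin

section \<open>Graphs in the sense of Serre\<close>

record ('v, 'e) sgraph =
  verts :: "'v set"
  edges :: "'e set"
  orig :: "'e \<Rightarrow> 'v"
  bar :: "'e \<Rightarrow> 'e"

definition serre_graph :: "('v, 'e, 'z) sgraph_scheme \<Rightarrow> bool" where
  "serre_graph T \<longleftrightarrow>
     (\<forall>e \<in> edges T. orig T e \<in> verts T \<and> bar T e \<in> edges T \<and> bar T (bar T e) = e \<and> bar T e \<noteq> e)"

definition tmn :: "('v, 'e, 'z) sgraph_scheme \<Rightarrow> 'e \<Rightarrow> 'v" where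
  "tmn T e = orig T (bar T e)"

definition star :: "('v, 'e, 'z) sgraph_scheme \<Rightarrow> 'v \<Rightarrow> 'e set" where
  "star T x = {e \<in> edges T. orig T e = x}"

fun walk :: "('v, 'e, 'z) sgraph_scheme \<Rightarrow> 'v \<Rightarrow> 'e list \<Rightarrow> 'v \<Rightarrow> bool" where
  "walk T x [] y \<longleftrightarrow> x \<in> verts T \<and> x = y"
| "walk T x (e # es) y \<longleftrightarrow> e \<in> star T x \<and> walk T (tmn T e) es y"

definition reduced :: "('v, 'e, 'z) sgraph_scheme \<Rightarrow> 'e list \<Rightarrow> bool" where
  "reduced T es \<longleftrightarrow> successively (\<lambda>e f. f \<noteq> bar T e) es"

definition gdist :: "('v, 'e, 'z) sgraph_scheme \<Rightarrow> 'v \<Rightarrow> 'v \<Rightarrow> nat" where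
  "gdist T x y = (LEAST n. \<exists>es. walk T x es y \<and> length es = n)"

text \<open>A tree is a non-empty connected graph without circuits; the absence of circuits is expressed
  by saying that there is no non-empty reduced closed walk.\<close>

definition regular_tree :: "nat \<Rightarrow> ('v, 'e, 'z) sgraph_scheme \<Rightarrow> bool" where
  "regular_tree d T \<longleftrightarrow>
     serre_graph T \<and> verts T \<noteq> {} \<and>
     (\<forall>x \<in> verts T. \<forall>y \<in> verts T. \<exists>es. walk T x es y) \<and>
     (\<forall>x es. walk T x es x \<and> reduced T es \<longrightarrow> es = []) \<and>
     (\<forall>x \<in> verts T. finite (star T x) \<and> card (star T x) = d)"


section \<open>The d-regular tree\<close>

text \<open>A concrete model of $T_d$: the vertices are the words over $\{0,\dots,d-1\}$ without two
  equal consecutive letters, and two vertices are adjacent if one arises from the other by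
  appending one letter. An oriented edge is the pair consisting of its origin and its terminus.
  Lemma \<open>regular_tree_Td\<close> below shows that this is a d-regular tree; as such it is
  unique up to isomorphism.\<close>

definition Td_verts :: "nat \<Rightarrow> nat list set" where
  "Td_verts d = {w. set w \<subseteq> {..<d} \<and> distinct_adj w}"

definition Td :: "nat \<Rightarrow> (nat list, nat list \<times> nat list) sgraph" where
  "Td d = \<lparr>verts = Td_verts d,
           edges = {(x, y). x \<in> Td_verts d \<and> y \<in> Td_verts d \<and> (\<exists>c. y = x @ [c] \<or> x = y @ [c])},
           orig = fst,
           bar = prod.swap\<rparr>"

lemma Td_simps:
  "verts (Td d) = Td_verts d"
  "(x, y) \<in> edges (Td d) \<longleftrightarrow>
     x \<in> Td_verts d \<and> y \<in> Td_verts d \<and> (\<exists>c. y = x @ [c] \<or> x = y @ [c])"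
  "orig (Td d) = fst" "bar (Td d) = prod.swap" "tmn (Td d) = snd"
  "(a, y) \<in> star (Td d) x \<longleftrightarrow> a = x \<and> (x, y) \<in> edges (Td d)"
  by (auto simp: Td_def tmn_def star_def)

lemma Td_verts_snoc:
  "w @ [c] \<in> Td_verts d \<longleftrightarrow> w \<in> Td_verts d \<and> c < d \<and> (w = [] \<or> c \<noteq> last w)"
  by (auto simp: Td_verts_def distinct_adj_append_iff)

lemma walk_append:
  "walk T x es y \<Longrightarrow> walk T y fs z \<Longrightarrow> walk T x (es @ fs) z"
  by (induction es arbitrary: x) auto

lemma Td_walk_to_Nil: "w \<in> Td_verts d \<Longrightarrow> \<exists>es. walk (Td d) w es []"
proof (induction w rule: rev_induct)
  case Nil
  then show ?case by (intro exI[of _ "[]"]) (simp add: Td_simps)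
next
  case (snoc c w)
  then obtain es where "walk (Td d) w es []" by (auto simp: Td_verts_snoc)
  with snoc.prems show ?case
    by (intro exI[of _ "(w @ [c], w) # es"]) (auto simp: Td_simps Td_verts_snoc)
qed

lemma Td_walk_from_Nil: "w \<in> Td_verts d \<Longrightarrow> \<exists>es. walk (Td d) [] es w"
proof (induction w rule: rev_induct)
  case Nil
  then show ?case by (intro exI[of _ "[]"]) (simp add: Td_simps)
next
  case (snoc c w)
  then obtain es where "walk (Td d) [] es w" by (auto simp: Td_verts_snoc)
  moreover have "walk (Td d) w [(w, w @ [c])] (w @ [c])"
    using snoc.prems by (auto simp: Td_simps Td_verts_snoc)
  ultimately have "walk (Td d) [] (es @ [(w, w @ [c])]) (w @ [c])" by (rule walk_append)
  then show ?case by (rule exI)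
qed

lemma Td_reduced_up:
  assumes "walk (Td d) x ((x, x @ [c]) # es) y" "reduced (Td d) ((x, x @ [c]) # es)"
  shows "\<exists>zs. y = x @ [c] @ zs"
  using assms
proof (induction es arbitrary: x c)
  case Nil
  then show ?case by (auto simp: Td_simps)
next
  case (Cons e es)
  obtain z where e: "e = (x @ [c], z)" and z: "(x @ [c], z) \<in> edges (Td d)"
    using Cons.prems(1) by (cases e) (auto simp: Td_simps)
  have "z \<noteq> x" using Cons.prems(2) e by (auto simp: reduced_def Td_simps)
  then obtain c' where z': "z = (x @ [c]) @ [c']" using z by (auto simp: Td_simps)
  have "\<exists>zs. y = (x @ [c]) @ [c'] @ zs"
  proof (rule Cons.IH)
    show "walk (Td d) (x @ [c]) ((x @ [c], (x @ [c]) @ [c']) # es) y"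
      using Cons.prems(1) unfolding e z' by (auto simp: Td_simps)
    show "reduced (Td d) ((x @ [c], (x @ [c]) @ [c']) # es)"
      using Cons.prems(2) unfolding e z' by (auto simp: reduced_def Td_simps)
  qed
  then show ?case by auto
qed

lemma Td_reduced_down:
  assumes "walk (Td d) (x @ [c]) ((x @ [c], x) # es) y" "reduced (Td d) ((x @ [c], x) # es)"
  shows "\<nexists>zs. y = x @ [c] @ zs"
  using assms
proof (induction es arbitrary: x c)
  case Nil
  then show ?case by (auto simp: Td_simps)
next
  case (Cons e es)
  obtain z where e: "e = (x, z)" and z: "(x, z) \<in> edges (Td d)"
    using Cons.prems(1) by (cases e) (auto simp: Td_simps)
  have w: "walk (Td d) x ((x, z) # es) y" and r: "reduced (Td d) ((x, z) # es)"
    using Cons.prems unfolding e by (auto simp: reduced_def Td_simps)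
  have ne: "z \<noteq> x @ [c]" using Cons.prems(2) e by (auto simp: reduced_def Td_simps)
  from z consider c' where "z = x @ [c']" | c' where "x = z @ [c']" by (auto simp: Td_simps)
  then show ?case
  proof cases
    case 1
    with w r obtain zs where "y = x @ [c'] @ zs" using Td_reduced_up by blast
    then show ?thesis using ne 1 by auto
  next
    case 2
    then have "\<nexists>zs. y = z @ [c'] @ zs" using Cons.IH[of z c'] w r by auto
    then show ?thesis using 2 by auto
  qed
qed

lemma Td_no_circuit:
  assumes "walk (Td d) x es x" "reduced (Td d) es"
  shows "es = []"
proof (rule ccontr)
  assume "es \<noteq> []"
  then obtain z fs where es: "es = (x, z) # fs" and z: "(x, z) \<in> edges (Td d)"
    using assms(1) by (cases es) (auto simp: Td_simps)
  from z consider c where "z = x @ [c]" | c where "x = z @ [c]" by (auto simp: Td_simps)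
  then show False
  proof cases
    case 1
    then show False using Td_reduced_up[of d x c fs x] assms es by auto
  next
    case 2
    then show False using Td_reduced_down[of d z c fs x] assms es by auto
  qed
qed

lemma Td_star:
  assumes "x \<in> Td_verts d"
  shows "finite (star (Td d) x) \<and> card (star (Td d) x) = d"
proof (cases x rule: rev_cases)
  case Nil
  have "star (Td d) x = (\<lambda>c. ([], [c])) ` {..<d}"
    by (auto simp: Nil Td_simps Td_verts_def)
  moreover have "inj_on (\<lambda>c. ([] :: nat list, [c])) {..<d}" by (auto simp: inj_on_def)
  ultimately show ?thesis by (simp add: card_image)
next
  case (snoc w a)
  have a: "a < d" "w \<in> Td_verts d" using assms by (auto simp: snoc Td_verts_snoc)
  have eq: "star (Td d) x = insert (x, w) ((\<lambda>c. (x, x @ [c])) ` ({..<d} - {a}))"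
  proof (rule Set.set_eqI)
    fix e :: "nat list \<times> nat list"
    obtain u y where e: "e = (u, y)" by (cases e)
    have "y = x @ [c] \<or> x = y @ [c] \<longleftrightarrow> y = x @ [c] \<or> y = w \<and> c = a" for c
      by (auto simp: snoc)
    moreover have "x @ [c] \<in> Td_verts d \<longleftrightarrow> c < d \<and> c \<noteq> a" for c
      using assms unfolding Td_verts_snoc[of x] by (simp add: snoc)
    ultimately show "e \<in> star (Td d) x \<longleftrightarrow> e \<in> insert (x, w) ((\<lambda>c. (x, x @ [c])) ` ({..<d} - {a}))"
      using assms a(2) unfolding e Td_simps by auto
  qed
  have inj: "inj_on (\<lambda>c. (x, x @ [c])) ({..<d} - {a})" by (auto simp: inj_on_def)
  have "(x, w) \<notin> (\<lambda>c. (x, x @ [c])) ` ({..<d} - {a})" by (auto simp: snoc)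
  then have "card (star (Td d) x) = Suc (d - 1)"
    unfolding eq using a by (simp add: card_image[OF inj])
  then show ?thesis using a eq by auto
qed

lemma regular_tree_Td: "regular_tree d (Td d)"
proof -
  have "serre_graph (Td d)"
    unfolding serre_graph_def
  proof (intro ballI)
    fix e assume e: "e \<in> edges (Td d)"
    obtain x y where xy: "e = (x, y)" by (cases e)
    have "x \<noteq> y" "(y, x) \<in> edges (Td d)" "x \<in> Td_verts d"
      using e unfolding xy Td_simps by auto
    then show "orig (Td d) e \<in> verts (Td d) \<and> bar (Td d) e \<in> edges (Td d) \<and>
        bar (Td d) (bar (Td d) e) = e \<and> bar (Td d) e \<noteq> e"
      unfolding xy Td_simps(1,3,4) by simp
  qed
  moreover have "\<exists>es. walk (Td d) x es y" if x: "x \<in> Td_verts d" and y: "y \<in> Td_verts d" for x y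
  proof -
    obtain es where "walk (Td d) x es []" using Td_walk_to_Nil[OF x] ..
    moreover obtain fs where "walk (Td d) [] fs y" using Td_walk_from_Nil[OF y] ..
    ultimately have "walk (Td d) x (es @ fs) y" by (rule walk_append)
    then show ?thesis ..
  qed
  moreover have "[] \<in> Td_verts d" by (simp add: Td_verts_def)
  moreover have "\<forall>x es. walk (Td d) x es x \<and> reduced (Td d) es \<longrightarrow> es = []"
    by (metis Td_no_circuit)
  ultimately show ?thesis
    unfolding regular_tree_def Td_simps(1) by (simp add: Td_star) (metis empty_iff)
qed


section \<open>The automorphism group and its permutation topology\<close>

text \<open>An automorphism is a pair consisting of a permutation of the vertices and a permutation of
  the edges; as in \<^const>\<open>BijGroup\<close>, both are \<^const>\<open>undefined\<close> outside of
  these sets.\<close>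

definition AutG :: "('v, 'e, 'z) sgraph_scheme \<Rightarrow> (('v \<Rightarrow> 'v) \<times> ('e \<Rightarrow> 'e)) monoid" where
  "AutG T = (BijGroup (verts T) \<times>\<times> BijGroup (edges T))
     \<lparr>carrier := {(g, h) \<in> Bij (verts T) \<times> Bij (edges T).
        \<forall>e \<in> edges T. orig T (h e) = g (orig T e) \<and> h (bar T e) = bar T (h e)}\<rparr>"

definition aut_cylinder ::
  "('v, 'e, 'z) sgraph_scheme \<Rightarrow> ('v \<Rightarrow> 'v) \<times> ('e \<Rightarrow> 'e) \<Rightarrow> 'v set \<Rightarrow> 'e set
    \<Rightarrow> (('v \<Rightarrow> 'v) \<times> ('e \<Rightarrow> 'e)) set" where
  "aut_cylinder T g A B =
     {h \<in> carrier (AutG T). (\<forall>x \<in> A. fst h x = fst g x) \<and> (\<forall>e \<in> B. snd h e = snd g e)}"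

definition aut_topology ::
  "('v, 'e, 'z) sgraph_scheme \<Rightarrow> (('v \<Rightarrow> 'v) \<times> ('e \<Rightarrow> 'e)) topology" where
  "aut_topology T = topology_generated_by
     {aut_cylinder T g A B | g A B.
        g \<in> carrier (AutG T) \<and> finite A \<and> A \<subseteq> verts T \<and> finite B \<and> B \<subseteq> edges T}"

lemma topspace_aut_topology: "topspace (aut_topology T) = carrier (AutG T)"
proof -
  have "aut_cylinder T g A B \<subseteq> carrier (AutG T)" for g A B
    by (auto simp: aut_cylinder_def)
  moreover have "g \<in> aut_cylinder T g {} {}" if "g \<in> carrier (AutG T)" for g
    using that by (simp add: aut_cylinder_def)
  ultimately show ?thesis
    unfolding aut_topology_def topology_generated_by_topspace by blast
qed

abbreviation aut_subgroup ::
  "('v, 'e, 'z) sgraph_scheme \<Rightarrow> (('v \<Rightarrow> 'v) \<times> ('e \<Rightarrow> 'e)) set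
    \<Rightarrow> (('v \<Rightarrow> 'v) \<times> ('e \<Rightarrow> 'e)) monoid" where
  "aut_subgroup T H \<equiv> (AutG T)\<lparr>carrier := H\<rparr>"

abbreviation aut_subtopology ::
  "('v, 'e, 'z) sgraph_scheme \<Rightarrow> (('v \<Rightarrow> 'v) \<times> ('e \<Rightarrow> 'e)) set
    \<Rightarrow> (('v \<Rightarrow> 'v) \<times> ('e \<Rightarrow> 'e)) topology" where
  "aut_subtopology T H \<equiv> subtopology (aut_topology T) H"

lemma group_AutG:
  assumes "serre_graph T"
  shows "group (AutG T)"
proof -
  let ?P = "BijGroup (verts T) \<times>\<times> BijGroup (edges T)"
  interpret P: group ?P by (intro DirProd_group group_BijGroup)
  have T: "orig T e \<in> verts T" "bar T e \<in> edges T" if "e \<in> edges T" for e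
    using assms that by (auto simp: serre_graph_def)
  have "subgroup (carrier (AutG T)) ?P"
  proof (rule P.subgroupI)
    show "carrier (AutG T) \<subseteq> carrier ?P"
      by (auto simp: AutG_def BijGroup_def)
    show "carrier (AutG T) \<noteq> {}"
      using T by (auto simp: AutG_def intro!: exI[of _ "\<lambda>x\<in>verts T. x"] exI[of _ "\<lambda>x\<in>edges T. x"] id_Bij)
  next
    fix p q assume p: "p \<in> carrier (AutG T)" and q: "q \<in> carrier (AutG T)"
    obtain g h g' h' where pq: "p = (g, h)" "q = (g', h')" by (cases p, cases q)
    have "h' e \<in> edges T" if "e \<in> edges T" for e
      using q that by (auto simp: pq AutG_def dest!: Bij_imp_funcset)
    then show "p \<otimes>\<^bsub>?P\<^esub> q \<in> carrier (AutG T)"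
      using p q T by (auto simp: pq AutG_def BijGroup_def compose_Bij compose_eq)
  next
    fix p assume p: "p \<in> carrier (AutG T)"
    obtain g h where gh: "p = (g, h)" by (cases p)
    let ?g = "\<lambda>x\<in>verts T. inv_into (verts T) g x" and ?h = "\<lambda>x\<in>edges T. inv_into (edges T) h x"
    have g: "g \<in> Bij (verts T)" and h: "h \<in> Bij (edges T)"
      and c: "\<And>e. e \<in> edges T \<Longrightarrow> orig T (h e) = g (orig T e)"
             "\<And>e. e \<in> edges T \<Longrightarrow> h (bar T e) = bar T (h e)"
      using p by (auto simp: gh AutG_def)
    have bg: "bij_betw g (verts T) (verts T)" and bh: "bij_betw h (edges T) (edges T)"
      using g h by (auto simp: Bij_def)
    have "inv\<^bsub>?P\<^esub> p = (?g, ?h)"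
    proof -
      have "g \<in> carrier (BijGroup (verts T))" "h \<in> carrier (BijGroup (edges T))"
        using g h by (auto simp: BijGroup_def)
      then show ?thesis
        unfolding gh by (simp add: inv_DirProd group_BijGroup inv_BijGroup g h)
    qed
    moreover have "(?g, ?h) \<in> carrier (AutG T)"
    proof -
      have "orig T (?h e) = ?g (orig T e) \<and> ?h (bar T e) = bar T (?h e)" if e: "e \<in> edges T" for e
      proof -
        obtain f where f: "f \<in> edges T" "e = h f" using bh e by (auto simp: bij_betw_def)
        have "?h e = f" using f bh e by (auto simp: bij_betw_def)
        moreover have "?g (orig T e) = orig T f"
          using f c T[of f] T[OF e] bg by (auto simp: bij_betw_def)
        moreover have "?h (bar T e) = bar T f"
          using f T[of f] T[OF e] bh c(2)[of f, symmetric] by (auto simp: bij_betw_def)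
        ultimately show ?thesis by simp
      qed
      then show ?thesis using g h by (auto simp: AutG_def restrict_inv_into_Bij)
    qed
    ultimately show "inv\<^bsub>?P\<^esub> p \<in> carrier (AutG T)" by simp
  qed
  from P.subgroup_imp_group[OF this] show ?thesis by (simp add: AutG_def)
qed


section \<open>Topological groups\<close>

definition group_centralizer :: "('a, 'b) monoid_scheme \<Rightarrow> 'a \<Rightarrow> 'a set" where
  "group_centralizer G h = {k \<in> carrier G. k \<otimes>\<^bsub>G\<^esub> h = h \<otimes>\<^bsub>G\<^esub> k}"

definition quasi_center :: "('a, 'b) monoid_scheme \<Rightarrow> 'a topology \<Rightarrow> 'a set" where
  "quasi_center G X = {h \<in> carrier G. openin X (group_centralizer G h)}"

definition compactly_generated :: "('a, 'b) monoid_scheme \<Rightarrow> 'a topology \<Rightarrow> bool" where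
  "compactly_generated G X \<longleftrightarrow> (\<exists>K. compactin X K \<and> generate G K = carrier G)"

definition closed_nondiscrete_cg_subgroup ::
  "('v, 'e, 'z) sgraph_scheme \<Rightarrow> (('v \<Rightarrow> 'v) \<times> ('e \<Rightarrow> 'e)) set \<Rightarrow> bool" where
  "closed_nondiscrete_cg_subgroup T H \<longleftrightarrow>
     subgroup H (AutG T) \<and>
     closedin (aut_topology T) H \<and>
     aut_subtopology T H \<noteq> discrete_topology H \<and>
     compactly_generated (aut_subgroup T H) (aut_subtopology T H)"

definition quasi_central ::
  "('v, 'e, 'z) sgraph_scheme \<Rightarrow> (('v \<Rightarrow> 'v) \<times> ('e \<Rightarrow> 'e)) set
    \<Rightarrow> ('v \<Rightarrow> 'v) \<times> ('e \<Rightarrow> 'e) \<Rightarrow> bool" where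
  "quasi_central T H g \<longleftrightarrow> g \<in> quasi_center (aut_subgroup T H) (aut_subtopology T H)"


section \<open>Permutation groups and local actions\<close>

text \<open>A permutation group on \<open>S\<close> is given by its carrier \<open>P\<close>, a subgroup of
  \<^term>\<open>BijGroup S\<close>.\<close>

abbreviation perm_group :: "'a set \<Rightarrow> ('a \<Rightarrow> 'a) set \<Rightarrow> ('a \<Rightarrow> 'a) monoid" where
  "perm_group S P \<equiv> (BijGroup S)\<lparr>carrier := P\<rparr>"

definition perm_transitive :: "'a set \<Rightarrow> ('a \<Rightarrow> 'a) set \<Rightarrow> bool" where
  "perm_transitive S P \<longleftrightarrow> (\<forall>x \<in> S. orbit (perm_group S P) (\<lambda>p. p) x = S)"

definition perm_intransitive :: "'a set \<Rightarrow> ('a \<Rightarrow> 'a) set \<Rightarrow> bool" where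
  "perm_intransitive S P \<longleftrightarrow> \<not> perm_transitive S P"

definition perm_semiregular :: "'a set \<Rightarrow> ('a \<Rightarrow> 'a) set \<Rightarrow> bool" where
  "perm_semiregular S P \<longleftrightarrow>
     (\<forall>x \<in> S. stabilizer (perm_group S P) (\<lambda>p. p) x = {\<one>\<^bsub>perm_group S P\<^esub>})"

definition perm_quasiprimitive :: "'a set \<Rightarrow> ('a \<Rightarrow> 'a) set \<Rightarrow> bool" where
  "perm_quasiprimitive S P \<longleftrightarrow>
     perm_transitive S P \<and>
     (\<forall>N. N \<lhd> perm_group S P \<and> N \<noteq> {\<one>\<^bsub>perm_group S P\<^esub>} \<longrightarrow> perm_transitive S N)"

definition perm_semiprimitive :: "'a set \<Rightarrow> ('a \<Rightarrow> 'a) set \<Rightarrow> bool" where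
  "perm_semiprimitive S P \<longleftrightarrow>
     perm_transitive S P \<and>
     (\<forall>N. N \<lhd> perm_group S P \<longrightarrow> perm_transitive S N \<or> perm_semiregular S N)"

definition local_action ::
  "('v, 'e, 'z) sgraph_scheme \<Rightarrow> (('v \<Rightarrow> 'v) \<times> ('e \<Rightarrow> 'e)) set \<Rightarrow> 'v \<Rightarrow> ('e \<Rightarrow> 'e) set" where
  "local_action T H x =
     (\<lambda>g. restrict (snd g) (star T x)) ` stabilizer (aut_subgroup T H) fst x"

definition locally_acts ::
  "('e set \<Rightarrow> ('e \<Rightarrow> 'e) set \<Rightarrow> bool) \<Rightarrow> ('v, 'e, 'z) sgraph_scheme
    \<Rightarrow> (('v \<Rightarrow> 'v) \<times> ('e \<Rightarrow> 'e)) set \<Rightarrow> bool" where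
  "locally_acts X T H \<longleftrightarrow> (\<forall>x \<in> verts T. X (star T x) (local_action T H x))"


section \<open>Types of automorphisms\<close>

definition translation_length ::
  "('v, 'e, 'z) sgraph_scheme \<Rightarrow> ('v \<Rightarrow> 'v) \<times> ('e \<Rightarrow> 'e) \<Rightarrow> nat" where
  "translation_length T g = (LEAST n. \<exists>x \<in> verts T. gdist T x (fst g x) = n)"

definition min_displacement_set ::
  "('v, 'e, 'z) sgraph_scheme \<Rightarrow> ('v \<Rightarrow> 'v) \<times> ('e \<Rightarrow> 'e) \<Rightarrow> 'v set" where
  "min_displacement_set T g = {x \<in> verts T. gdist T x (fst g x) = translation_length T g}"

definition elliptic ::
  "('v, 'e, 'z) sgraph_scheme \<Rightarrow> ('v \<Rightarrow> 'v) \<times> ('e \<Rightarrow> 'e) \<Rightarrow> bool" where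
  "elliptic T g \<longleftrightarrow> translation_length T g = 0"

definition hyperbolic_of_length ::
  "('v, 'e, 'z) sgraph_scheme \<Rightarrow> nat \<Rightarrow> ('v \<Rightarrow> 'v) \<times> ('e \<Rightarrow> 'e) \<Rightarrow> bool" where
  "hyperbolic_of_length T n g \<longleftrightarrow>
     translation_length T g > 0 \<and> infinite (min_displacement_set T g) \<and> translation_length T g = n"

text \<open>The first two conjuncts determine the type; for automorphisms of a tree they imply the
  other two.\<close>

definition inversion ::
  "('v, 'e, 'z) sgraph_scheme \<Rightarrow> ('v \<Rightarrow> 'v) \<times> ('e \<Rightarrow> 'e) \<Rightarrow> bool" where
  "inversion T g \<longleftrightarrow>
     translation_length T g > 0 \<and> finite (min_displacement_set T g) \<and>
     translation_length T g = 1 \<and> (\<exists>e \<in> edges T. snd g e = bar T e)"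

definition edge_fixating ::
  "('v, 'e, 'z) sgraph_scheme \<Rightarrow> ('v \<Rightarrow> 'v) \<times> ('e \<Rightarrow> 'e) \<Rightarrow> bool" where
  "edge_fixating T g \<longleftrightarrow> (\<exists>e \<in> edges T. snd g e = e)"

end

theory Submission
  imports Defs "HOL-Combinatorics.Permutations" "HOL-Analysis.Function_Topology"
begin

text \<open>Colour the edges of the \<open>d\<close>-regular tree so that every edge has the same colour at both ends and every
vertex sees each of the \<open>d\<close> colours once. The vertices are then the reduced words of the free product of
\<open>d\<close> groups of order two, the neighbour of \<open>w\<close> along the colour \<open>c\<close> is the product \<open>w \<cdot> c\<close>
(\<open>nbr\<close>), and an automorphism is the same thing as the image of the root together with one permutation
of the colours at each vertex (its portrait), subject to one condition: the permutations at the two ends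
of an edge agree on the colour of that edge (\<open>build_locally_by\<close>).

All five groups come from one construction (\<open>label_action\<close>). Two commuting permutation groups \<open>A\<close> and
\<open>Z\<close> act on the colours, and a labelling \<open>\<pi>\<close> sends every colour to a label or to nothing; \<open>Z\<close> preserves the
labelling and \<open>A\<close> permutes its fibres. Replacing the letters of a word by their labels, deleting those
without a label, and reducing gives a map \<open>proj\<close> from the tree to the tree of reduced words in the labels.
The group \<open>H\<close> consists of the automorphisms whose portrait takes values in one coset
\<open>A \<circ> z\<close> and is constant on the fibres of \<open>proj\<close>. Such an automorphism descends to the tree of labels
(\<open>proj_image_eq_iff\<close>), so that \<open>H\<close> is a group. It is closed, as its defining conditions involve
finitely many vertices at a time. Its root stabilizer is the continuous image of a closed set of
portraits, which is compact by Tychonoff's theorem, and \<open>H\<close> is generated by it and by the left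
multiplications by single letters (\<open>H_compactly_generated\<close>). Every constant portrait in
\<open>F = A \<circ> Z\<close> occurs, so that the local action of \<open>H\<close> at each vertex is \<open>F\<close> (\<open>local_action_H\<close>). If some
\<open>f \<noteq> id\<close> in \<open>A\<close> fixes all colours with a given label, it can be applied in a remote branch of the label
tree alone, and \<open>H\<close> is not discrete (\<open>H_not_discrete\<close>).

The quasi-central elements in question are those with constant portrait \<open>z \<in> Z\<close> for which the image \<open>v\<close> of the root
projects to the root. They leave \<open>proj\<close> invariant; therefore an element \<open>k\<close> of \<open>H\<close> commutes with one of
them as soon as it does so at the root, a condition on \<open>k\<close> at finitely many vertices
(\<open>quasi_central_aut_of\<close>).

It remains to choose the data. Symmetric group on three labelled colours and one unlabelled colour:
left multiplication by the latter is an inversion. Two unlabelled colours and \<open>Z\<close> generated by their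
transposition \<open>\<tau>\<close>: left multiplication by one of them after the automorphism with constant portrait \<open>\<tau>\<close>
has translation length one. Colours \<open>3 \<times> 3\<close> labelled by the row, \<open>A\<close> permuting the rows and \<open>Z\<close> the
columns: \<open>F\<close> is transitive, and the transposition of two columns fixes the edges at the root whose colour lies in the third.
Colours the ordered pairs of distinct elements of a set with five elements, labelled by the underlying
unordered pair, \<open>A\<close> the symmetric group of that set: every non-trivial normal subgroup of \<open>A\<close> is
2-transitive on the set (\<open>normal_Sym_2_transitive\<close>), that is, transitive on the colours. With trivial \<open>Z\<close>
this makes \<open>F\<close> quasiprimitive, and the product of the letters \<open>(a, b)\<close> and \<open>(b, a)\<close> is a hyperbolic
element of length two with trivial label word. With \<open>Z\<close> generated by \<open>(a, b) \<mapsto> (b, a)\<close>, which has no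
fixed colour, \<open>F\<close> is semiprimitive, and \<open>Z\<close> provides an elliptic element.\<close>

section \<open>The free product of groups of order two\<close>

text \<open>The elements of the free product of groups of order two, one for each \<open>k \<in> K\<close>, as reduced words. The
alphabet is arbitrary because the words in the labels of a coloured tree are used as well.\<close>
definition words :: "'k set \<Rightarrow> 'k list set" where
  "words K = {w. set w \<subseteq> K \<and> distinct_adj w}"

text \<open>Right multiplication by the generator \<open>k\<close>. As an edge of the tree it leads back along the same colour
(\<open>nbr_nbr\<close>).\<close>
definition nbr :: "'k list \<Rightarrow> 'k \<Rightarrow> 'k list" where
  "nbr w k = (if w \<noteq> [] \<and> last w = k then butlast w else w @ [k])"

lemma Nil_in_words [simp]: "[] \<in> words K"
  by (simp add: words_def)

lemma words_snoc:
  "w @ [k] \<in> words K \<longleftrightarrow> w \<in> words K \<and> k \<in> K \<and> (w = [] \<or> last w \<noteq> k)"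
  by (auto simp: words_def distinct_adj_append_iff)

lemma words_induct [consumes 1, case_names Nil snoc]:
  assumes "w \<in> words K" "P []"
    and "\<And>w k. w \<in> words K \<Longrightarrow> w @ [k] \<in> words K \<Longrightarrow> P w \<Longrightarrow> P (w @ [k])"
  shows "P w"
  using assms(1)
proof (induction w rule: rev_induct)
  case (snoc k w)
  then show ?case using assms(3)[of w k] by (simp add: words_snoc)
qed (simp add: assms(2))

lemma butlast_neq_snoc [simp]: "butlast w \<noteq> w @ [k]" "w @ [k] \<noteq> butlast w"
  by (metis length_append_singleton length_butlast diff_le_self not_less_eq_eq order_refl)+

lemma nbr_snoc_same [simp]: "nbr (w @ [k]) k = w"
  by (simp add: nbr_def)

lemma nbr_snoc: "w @ [k] \<in> words K \<Longrightarrow> nbr w k = w @ [k]"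
  by (auto simp: nbr_def words_snoc)

lemma nbr_cases:
  assumes "w \<in> words K" "k \<in> K"
  obtains (up) "nbr w k = w @ [k]" "w @ [k] \<in> words K"
  | (down) u where "w = u @ [k]" "nbr w k = u" "u \<in> words K"
proof (cases "w \<noteq> [] \<and> last w = k")
  case True
  then have "w = butlast w @ [k]" by (metis append_butlast_last_id)
  then show ?thesis using down[of "butlast w"] assms by (metis nbr_snoc_same words_snoc)
next
  case False
  then have "w @ [k] \<in> words K" using assms by (auto simp: words_snoc)
  then show ?thesis using up nbr_snoc[of w k K] by simp
qed

lemma nbr_in_words: "w \<in> words K \<Longrightarrow> k \<in> K \<Longrightarrow> nbr w k \<in> words K"
  by (erule (1) nbr_cases) auto

lemma nbr_nbr:
  assumes "w \<in> words K" "k \<in> K"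
  shows "nbr (nbr w k) k = w"
  using assms
proof (cases rule: nbr_cases)
  case (down u)
  then show ?thesis using nbr_snoc[of u k K] assms by simp
qed simp

lemma nbr_eq_iff [simp]: "nbr w k = nbr w k' \<longleftrightarrow> k = k'"
proof
  assume *: "nbr w k = nbr w k'"
  from * show "k = k'"
    by (simp add: nbr_def split: if_splits)
qed simp

lemma even_length_nbr: "even (length (nbr w k)) \<longleftrightarrow> odd (length w)"
  by (cases w rule: rev_cases) (simp_all add: nbr_def)

text \<open>The product in the free product. Left multiplication commutes with right multiplication (\<open>lmul_nbr\<close>),
hence is an automorphism of the tree that preserves all colours.\<close>
definition lmul :: "'k list \<Rightarrow> 'k list \<Rightarrow> 'k list" where
  "lmul v w = foldl nbr v w"

lemma lmul_Nil2 [simp]: "lmul v [] = v"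
  and lmul_snoc: "lmul v (w @ [k]) = nbr (lmul v w) k"
  by (simp_all add: lmul_def)

lemma lmul_in_words: "w \<in> words K \<Longrightarrow> v \<in> words K \<Longrightarrow> lmul v w \<in> words K"
  by (induction w rule: words_induct) (auto simp: lmul_snoc words_snoc nbr_in_words)

lemma lmul_nbr:
  assumes "v \<in> words K" "w \<in> words K" "k \<in> K"
  shows "lmul v (nbr w k) = nbr (lmul v w) k"
  using assms(2,3)
proof (cases rule: nbr_cases)
  case up
  then show ?thesis by (simp add: lmul_snoc)
next
  case (down u)
  then show ?thesis using assms by (simp add: lmul_snoc nbr_nbr[OF lmul_in_words[of u K v]])
qed

lemma lmul_Nil1: "w \<in> words K \<Longrightarrow> lmul [] w = w"
  by (induction w rule: words_induct) (auto simp: lmul_snoc nbr_snoc)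

lemma lmul_assoc:
  assumes "u \<in> words K" "v \<in> words K" "w \<in> words K"
  shows "lmul (lmul u v) w = lmul u (lmul v w)"
  using assms(3)
proof (induction w rule: words_induct)
  case (snoc w k)
  then have "w \<in> words K" "k \<in> K" by (simp_all add: words_snoc)
  then show ?case
    using snoc.IH lmul_nbr[OF assms(1) lmul_in_words[OF _ assms(2)], of w k] by (simp add: lmul_snoc)
qed simp

lemma rev_in_words [simp]: "rev w \<in> words K \<longleftrightarrow> w \<in> words K"
  by (simp add: words_def)

lemma lmul_rev: "lmul v (rev v) = []"
  by (induction v rule: rev_induct) (simp_all add: lmul_def)

text \<open>The free product acts freely on its Cayley tree: a fixed vertex is moved to the root by right
multiplications.\<close>
lemma lmul_fixed:
  assumes "w \<in> words K" "v \<in> words K" "lmul v w = w"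
  shows "v = []"
  using assms(1,3)
proof (induction w rule: words_induct)
  case Nil
  then show ?case by simp
next
  case (snoc w k)
  then have k: "k \<in> K" "w \<in> words K" by (auto simp: words_snoc)
  have "nbr (lmul v w) k = nbr w k" using snoc by (simp add: lmul_snoc nbr_snoc)
  then have "lmul v w = w"
    using k assms(2) by (metis lmul_in_words nbr_nbr)
  then show ?case using snoc by blast
qed

section \<open>Maps between trees given by their local permutations\<close>

text \<open>The map \<open>g\<close> is a morphism of trees that sends the edge of colour \<open>k\<close> at \<open>w\<close> to the edge of colour
\<open>\<beta> w k\<close> at \<open>g w\<close>.\<close>
definition locally_by :: "'k set \<Rightarrow> ('k list \<Rightarrow> 'l list) \<Rightarrow> ('k list \<Rightarrow> 'k \<Rightarrow> 'l) \<Rightarrow> bool" where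
  "locally_by K g \<beta> \<longleftrightarrow> (\<forall>w \<in> words K. \<forall>k \<in> K. g (nbr w k) = nbr (g w) (\<beta> w k))"

lemma locally_byD:
  "locally_by K g \<beta> \<Longrightarrow> w \<in> words K \<Longrightarrow> k \<in> K \<Longrightarrow> g (nbr w k) = nbr (g w) (\<beta> w k)"
  by (auto simp: locally_by_def)

lemma nbr_inverse_imp:
  assumes "nbr (nbr x a) b = x"
  shows "a = b"
proof (cases "x \<noteq> [] \<and> last x = a")
  case True
  then obtain u where x: "x = u @ [a]" by (metis append_butlast_last_id)
  have "nbr u b = u @ [a]" using assms x by simp
  then show ?thesis by (simp add: nbr_def split: if_splits)
next
  case False
  then have "nbr x a = x @ [a]" by (auto simp: nbr_def)
  then have "nbr (x @ [a]) b = x" using assms by simp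
  then show ?thesis by (simp add: nbr_def split: if_splits)
qed

text \<open>The colour of an edge and that of its image do not depend on the end from which they are read.\<close>
lemma locally_by_same_colour:
  assumes "locally_by K g \<beta>" "w \<in> words K" "k \<in> K"
  shows "\<beta> (nbr w k) k = \<beta> w k"
proof -
  have "g w = nbr (g (nbr w k)) (\<beta> (nbr w k) k)"
    using locally_byD[OF assms(1) nbr_in_words[OF assms(2,3)] assms(3)] assms by (simp add: nbr_nbr)
  then show ?thesis using assms nbr_inverse_imp[of "g w" "\<beta> w k" "\<beta> (nbr w k) k"]
    by (simp add: locally_byD)
qed

text \<open>A locally injective map takes paths without backtracking to paths without backtracking: the last letter of
\<open>g w\<close> is the image of the last letter of \<open>w\<close>, hence differs from the image of any other colour at \<open>w\<close>.\<close>
lemma rooted_snoc: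
  assumes "locally_by K g \<beta>" "g [] = []" "\<And>w. w \<in> words K \<Longrightarrow> inj_on (\<beta> w) K"
    and "w @ [k] \<in> words K"
  shows "g (w @ [k]) = g w @ [\<beta> w k]"
proof -
  have w: "w \<in> words K" "k \<in> K" using assms(4) by (auto simp: words_snoc)
  have eq: "g (w @ [k]) = nbr (g w) (\<beta> w k)"
    using locally_byD[OF assms(1) w] nbr_snoc[OF assms(4)] by simp
  from w(1) assms(4) have "g w = [] \<or> last (g w) \<noteq> \<beta> w k"
  proof (induction w arbitrary: k rule: words_induct)
    case Nil
    then show ?case using assms(2) by simp
  next
    case (snoc u j)
    then have u: "u \<in> words K" "j \<in> K" "k \<in> K" "j \<noteq> k"
      using words_snoc[of "u @ [j]" k K] words_snoc[of u j K] by auto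
    have "g (u @ [j]) = nbr (g u) (\<beta> u j)"
      using locally_byD[OF assms(1) u(1,2)] nbr_snoc[OF snoc.hyps(2)] by simp
    then have "g (u @ [j]) = g u @ [\<beta> u j]"
      using snoc.IH[OF snoc.hyps(2)] by (auto simp: nbr_def)
    moreover have "\<beta> u j = \<beta> (u @ [j]) j"
      using locally_by_same_colour[OF assms(1) u(1,2)] nbr_snoc[OF snoc.hyps(2)] by simp
    moreover have "\<beta> (u @ [j]) j \<noteq> \<beta> (u @ [j]) k"
      using inj_onD[OF assms(3)[OF snoc.hyps(2)], of j k] u by auto
    ultimately show ?case by simp
  qed
  then show ?thesis using eq by (auto simp: nbr_def)
qed

text \<open>After a left translation the root is fixed. Then the letters of \<open>g w\<close> are found one by one
by \<open>rooted_snoc\<close>, and \<open>w\<close> can be read off from them.\<close>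
lemma locally_by_inj:
  assumes g: "locally_by K g \<beta>" and root: "g [] \<in> words L"
    and \<beta>: "\<And>w. w \<in> words K \<Longrightarrow> inj_on (\<beta> w) K" "\<And>w. w \<in> words K \<Longrightarrow> \<beta> w ` K \<subseteq> L"
  shows "inj_on g (words K)"
proof -
  have g_words: "g w \<in> words L" if "w \<in> words K" for w
    using that
  proof (induction w rule: words_induct)
    case (snoc w k)
    then have "g (w @ [k]) = nbr (g w) (\<beta> w k)"
      using locally_byD[OF g] by (metis nbr_snoc words_snoc)
    then show ?case using snoc \<beta>(2)[of w] by (metis image_subset_iff nbr_in_words words_snoc)
  qed (rule root)
  \<comment> \<open>The inverse of a word in the free product is its reversal.\<close>
  let ?h = "\<lambda>w. lmul (rev (g [])) (g w)"
  have h: "locally_by K ?h \<beta>"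
    unfolding locally_by_def
  proof (intro ballI)
    fix w k assume w: "w \<in> words K" "k \<in> K"
    have "\<beta> w k \<in> L" using \<beta>(2) w by blast
    then show "?h (nbr w k) = nbr (?h w) (\<beta> w k)"
      using locally_byD[OF g w] lmul_nbr[of "rev (g [])" L "g w"] g_words w root by simp
  qed
  have h0: "?h [] = []" using lmul_rev[of "rev (g [])"] by simp
  have snoc_eq: "?h (w @ [k]) = ?h w @ [\<beta> w k]" if "w @ [k] \<in> words K" for w k
    by (rule rooted_snoc[OF h h0 \<beta>(1) that])
  have len: "length (?h w) = length w" if "w \<in> words K" for w
    using that by (induction w rule: words_induct) (use snoc_eq h0 in auto)
  have "w = w'" if "w \<in> words K" "w' \<in> words K" "?h w = ?h w'" for w w'
    using that
  proof (induction w arbitrary: w' rule: words_induct)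
    case Nil
    then show ?case using len[of w'] h0 by (metis length_0_conv)
  next
    case (snoc w k)
    have "length w' = Suc (length w)" using len[OF snoc.hyps(2)] len[OF snoc.prems(1)] snoc.prems by simp
    then obtain u j where w': "w' = u @ [j]" by (metis append_butlast_last_id list.size(3) nat.distinct(1))
    have "?h w @ [\<beta> w k] = ?h u @ [\<beta> u j]"
      using snoc_eq[OF snoc.hyps(2)] snoc_eq[of u j] snoc.prems w' by simp
    moreover have "u \<in> words K" "j \<in> K" "k \<in> K" using snoc w' by (auto simp: words_snoc)
    ultimately have "w = u" "\<beta> w k = \<beta> u j" using snoc.IH[of u] by auto
    then show ?case using w' \<beta>(1)[OF snoc.hyps(1)] \<open>j \<in> K\<close> \<open>k \<in> K\<close> by (auto dest: inj_onD)
  qed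
  then show ?thesis by (intro inj_onI) metis
qed

text \<open>The map with \<open>g [] = v\<close> and local permutations \<open>\<sigma>\<close>, by following the path from the root to \<open>w\<close>.\<close>
function build :: "'l list \<Rightarrow> ('k list \<Rightarrow> 'k \<Rightarrow> 'l) \<Rightarrow> 'k list \<Rightarrow> 'l list" where
  "build v \<sigma> w = (if w = [] then v else nbr (build v \<sigma> (butlast w)) (\<sigma> (butlast w) (last w)))"
  by pat_completeness auto
termination by (relation "measure (\<lambda>(v, \<sigma>, w). length w)") auto

declare build.simps [simp del]

lemma build_Nil [simp]: "build v \<sigma> [] = v"
  and build_snoc [simp]: "build v \<sigma> (w @ [k]) = nbr (build v \<sigma> w) (\<sigma> w k)"
  by (subst build.simps, simp)+

lemma build_in_words:
  assumes "v \<in> words L" "\<And>w k. w \<in> words K \<Longrightarrow> k \<in> K \<Longrightarrow> \<sigma> w k \<in> L"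
  shows "w \<in> words K \<Longrightarrow> build v \<sigma> w \<in> words L"
  by (induction w rule: words_induct) (use assms in \<open>auto simp: words_snoc nbr_in_words\<close>)

text \<open>The recursion only prescribes the images of the edges that lead away from the root. The edge leading
back from \<open>w @ [k]\<close> is the same edge, and this is what the compatibility condition accounts for.\<close>
lemma build_locally_by:
  assumes "v \<in> words L" "\<And>w k. w \<in> words K \<Longrightarrow> k \<in> K \<Longrightarrow> \<sigma> w k \<in> L"
    and compat: "\<And>w k. w @ [k] \<in> words K \<Longrightarrow> \<sigma> (w @ [k]) k = \<sigma> w k"
  shows "locally_by K (build v \<sigma>) \<sigma>"
  unfolding locally_by_def
proof (intro ballI)
  fix w k assume w: "w \<in> words K" "k \<in> K"
  then show "build v \<sigma> (nbr w k) = nbr (build v \<sigma> w) (\<sigma> w k)"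
  proof (cases rule: nbr_cases)
    case (down u)
    have "build v \<sigma> u \<in> words L" using down by (intro build_in_words[of v L K]) (auto simp: assms)
    then show ?thesis
      using compat[of u k] w down assms(2)[of u k] by (simp add: nbr_nbr[of _ L])
  qed simp
qed

lemma locally_by_unique:
  assumes "locally_by K g \<sigma>" "locally_by K h \<tau>" "g [] = h []"
    and "\<And>w k. w \<in> words K \<Longrightarrow> k \<in> K \<Longrightarrow> \<sigma> w k = \<tau> w k" "w \<in> words K"
  shows "g w = h w"
  using assms(5)
proof (induction w rule: words_induct)
  case (snoc w k)
  then have w: "w \<in> words K" "k \<in> K" "nbr w k = w @ [k]"
    using nbr_snoc[OF snoc.hyps(2)] by (simp_all add: words_snoc)
  then show ?case using locally_byD[OF assms(1) w(1,2)] locally_byD[OF assms(2) w(1,2)] snoc assms(4) by simp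
qed (rule assms(3))

section \<open>Automorphisms of the regular tree and their portraits\<close>

lemma Td_verts_words: "Td_verts d = words {..<d}"
  by (simp add: Td_verts_def words_def)

lemma verts_Td [simp]: "verts (Td d) = words {..<d}"
  by (simp add: Td_simps Td_verts_words)

lemma edges_Td: "edges (Td d) = {(x, nbr x c) | x c. x \<in> words {..<d} \<and> c < d}" (is "_ = ?R")
proof -
  have "(x, y) \<in> edges (Td d) \<longleftrightarrow> (x, y) \<in> ?R" for x y
  proof
    assume "(x, y) \<in> edges (Td d)"
    then obtain c where xy: "x \<in> words {..<d}" "y \<in> words {..<d}" "y = x @ [c] \<or> x = y @ [c]"
      by (auto simp: Td_simps Td_verts_words)
    then have "c < d" by (auto simp: words_snoc)
    moreover have "y = nbr x c" using xy nbr_snoc[of x c] nbr_snoc_same[of y c] by auto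
    ultimately show "(x, y) \<in> ?R" using xy by auto
  next
    assume "(x, y) \<in> ?R"
    then obtain c where x: "x \<in> words {..<d}" "c < d" "y = nbr x c" by auto
    then have "y \<in> words {..<d}" by (simp add: nbr_in_words)
    moreover have "\<exists>c. y = x @ [c] \<or> x = y @ [c]"
      using nbr_cases[of x "{..<d}" c] x by (metis lessThan_iff)
    ultimately show "(x, y) \<in> edges (Td d)" using x by (simp add: Td_simps Td_verts_words)
  qed
  then show ?thesis by auto
qed

lemma serre_graph_Td: "serre_graph (Td d)"
  using regular_tree_Td[of d] by (simp add: regular_tree_def)

lemma group_AutG_Td: "group (AutG (Td d))"
  by (rule group_AutG[OF serre_graph_Td])

text \<open>The permutation of the colours that \<open>g\<close> induces from the edges at \<open>w\<close> to the edges at \<open>g w\<close>. It is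
extended by the identity to a permutation of the natural numbers, so that composition and inverse are those of
functions.\<close>
definition loc :: "nat \<Rightarrow> (nat list \<Rightarrow> nat list) \<Rightarrow> nat list \<Rightarrow> nat \<Rightarrow> nat" where
  "loc d g w c = (if c < d then THE k. g (nbr w c) = nbr (g w) k else c)"

lemma loc_eqI: "g (nbr w c) = nbr (g w) k \<Longrightarrow> c < d \<Longrightarrow> loc d g w c = k"
  by (simp add: loc_def)

lemma loc_eq:
  assumes "locally_by {..<d} g \<sigma>" "w \<in> words {..<d}" "\<sigma> w permutes {..<d}"
  shows "loc d g w = \<sigma> w"
proof
  fix c
  show "loc d g w c = \<sigma> w c"
  proof (cases "c < d")
    case True
    then show ?thesis using locally_byD[OF assms(1,2)] by (simp add: loc_eqI)
  next
    case False
    then show ?thesis using permutes_not_in[OF assms(3)] by (simp add: loc_def)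
  qed
qed

lemma
  assumes "g \<in> carrier (AutG (Td d))"
  shows AutG_bij: "bij_betw (fst g) (words {..<d}) (words {..<d})"
    and AutG_extensional: "fst g \<in> extensional (words {..<d})"
    and AutG_locally_by: "locally_by {..<d} (fst g) (loc d (fst g))"
    and AutG_loc_permutes: "w \<in> words {..<d} \<Longrightarrow> loc d (fst g) w permutes {..<d}"
    and AutG_snd: "snd g = restrict (map_prod (fst g) (fst g)) (edges (Td d))"
proof -
  obtain a h where g: "g = (a, h)" by (cases g)
  have a: "a \<in> Bij (words {..<d})" and h: "h \<in> Bij (edges (Td d))"
    and c: "\<And>e. e \<in> edges (Td d) \<Longrightarrow> fst (h e) = a (fst e)"
           "\<And>e. e \<in> edges (Td d) \<Longrightarrow> h (prod.swap e) = prod.swap (h e)"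
    using assms by (auto simp: g AutG_def Td_simps Td_verts_words)
  show b: "bij_betw (fst g) (words {..<d}) (words {..<d})"
    and "fst g \<in> extensional (words {..<d})"
    using a by (auto simp: g Bij_def)
  have hE: "h (x, y) = (a x, a y)" if "(x, y) \<in> edges (Td d)" for x y
  proof -
    have "(y, x) \<in> edges (Td d)" using that by (auto simp: Td_simps)
    then have "fst (h (y, x)) = a y" "h (y, x) = prod.swap (h (x, y))"
      using c[of "(y, x)"] c(2)[OF that] by auto
    then show ?thesis using c(1)[OF that] by (cases "h (x, y)") auto
  qed
  then show "snd g = restrict (map_prod (fst g) (fst g)) (edges (Td d))"
    using h by (auto simp: g Bij_def extensional_def restrict_def fun_eq_iff)
  have ex: "\<exists>k<d. a (nbr w c) = nbr (a w) k" if "w \<in> words {..<d}" "c < d" for w c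
  proof -
    have "(w, nbr w c) \<in> edges (Td d)" using that by (auto simp: edges_Td)
    then have "h (w, nbr w c) \<in> edges (Td d)" "h (w, nbr w c) = (a w, a (nbr w c))"
      using Bij_imp_funcset[OF h] hE by blast+
    then show ?thesis by (auto simp: edges_Td)
  qed
  have loc: "loc d a w c < d \<and> a (nbr w c) = nbr (a w) (loc d a w c)"
    if "w \<in> words {..<d}" "c < d" for w c
    using ex[OF that] loc_eqI[of a w c _ d] that by auto
  then show "locally_by {..<d} (fst g) (loc d (fst g))"
    by (auto simp: g locally_by_def)
  show "loc d (fst g) w permutes {..<d}" if w: "w \<in> words {..<d}"
  proof (rule inj_imp_permutes)
    show "inj_on (loc d (fst g) w) {..<d}"
    proof (rule inj_onI)
      fix c c' assume c: "c \<in> {..<d}" "c' \<in> {..<d}" "loc d (fst g) w c = loc d (fst g) w c'"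
      then have "a (nbr w c) = a (nbr w c')" using loc[OF w] g by (metis fst_conv lessThan_iff)
      then have "nbr w c = nbr w c'"
        using inj_onD[OF bij_betw_imp_inj_on[OF b], of "nbr w c" "nbr w c'"] w c g
        by (simp add: nbr_in_words)
      then show "c = c'" by simp
    qed
  qed (use loc[OF w] g in \<open>auto simp: loc_def\<close>)
qed

lemma AutG_in_words:
  "g \<in> carrier (AutG (Td d)) \<Longrightarrow> w \<in> words {..<d} \<Longrightarrow> fst g w \<in> words {..<d}"
  using AutG_bij bij_betwE by blast

lemma AutG_nbr:
  "g \<in> carrier (AutG (Td d)) \<Longrightarrow> w \<in> words {..<d} \<Longrightarrow> c < d \<Longrightarrow>
    fst g (nbr w c) = nbr (fst g w) (loc d (fst g) w c)"
  using locally_byD[OF AutG_locally_by] by auto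

lemma AutG_eqI:
  assumes "g \<in> carrier (AutG (Td d))" "h \<in> carrier (AutG (Td d))"
    and "\<And>w. w \<in> words {..<d} \<Longrightarrow> fst g w = fst h w"
  shows "g = h"
proof -
  have "fst g = fst h"
    using AutG_extensional[OF assms(1)] AutG_extensional[OF assms(2)] assms(3)
    by (rule extensionalityI)
  then show ?thesis using AutG_snd[OF assms(1)] AutG_snd[OF assms(2)] by (simp add: prod_eq_iff)
qed

text \<open>An automorphism is determined by the image of the root and its local permutations; identities in the
automorphism group are checked in this form below.\<close>
lemma AutG_eqI_loc:
  assumes "g \<in> carrier (AutG (Td d))" "h \<in> carrier (AutG (Td d))" "fst g [] = fst h []"
    and "\<And>w. w \<in> words {..<d} \<Longrightarrow> loc d (fst g) w = loc d (fst h) w"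
  shows "g = h"
  using locally_by_unique[OF AutG_locally_by[OF assms(1)] AutG_locally_by[OF assms(2)] assms(3)] assms(4)
  by (intro AutG_eqI[OF assms(1,2)]) auto

lemma AutG_mult_fst:
  assumes "g \<in> carrier (AutG (Td d))" "h \<in> carrier (AutG (Td d))" "w \<in> words {..<d}"
  shows "fst (g \<otimes>\<^bsub>AutG (Td d)\<^esub> h) w = fst g (fst h w)"
proof -
  obtain a b a' b' where gh: "g = (a, b)" "h = (a', b')" by (cases g, cases h)
  then show ?thesis using assms by (auto simp: AutG_def BijGroup_def DirProd_def compose_def)
qed

lemma AutG_one_fst: "w \<in> words {..<d} \<Longrightarrow> fst \<one>\<^bsub>AutG (Td d)\<^esub> w = w"
  by (auto simp: AutG_def BijGroup_def DirProd_def)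

lemma AutG_inv_fst:
  assumes g: "g \<in> carrier (AutG (Td d))" and w: "w \<in> words {..<d}"
  shows "fst (inv\<^bsub>AutG (Td d)\<^esub> g) (fst g w) = w"
    "fst g (fst (inv\<^bsub>AutG (Td d)\<^esub> g) w) = w"
proof -
  interpret group "AutG (Td d)" by (rule group_AutG_Td)
  show "fst (inv\<^bsub>AutG (Td d)\<^esub> g) (fst g w) = w"
    using AutG_mult_fst[OF inv_closed[OF g] g w] AutG_one_fst[OF w] g by simp
  show "fst g (fst (inv\<^bsub>AutG (Td d)\<^esub> g) w) = w"
    using AutG_mult_fst[OF g inv_closed[OF g] w] AutG_one_fst[OF w] g by simp
qed

lemma loc_mult:
  assumes g: "g \<in> carrier (AutG (Td d))" and h: "h \<in> carrier (AutG (Td d))" and w: "w \<in> words {..<d}"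
  shows "loc d (fst (g \<otimes>\<^bsub>AutG (Td d)\<^esub> h)) w = loc d (fst g) (fst h w) \<circ> loc d (fst h) w"
proof
  fix c
  show "loc d (fst (g \<otimes>\<^bsub>AutG (Td d)\<^esub> h)) w c = (loc d (fst g) (fst h w) \<circ> loc d (fst h) w) c"
  proof (cases "c < d")
    case True
    have "loc d (fst h) w c < d" using permutes_in_image[OF AutG_loc_permutes[OF h w]] True by simp
    then show ?thesis
      using True by (intro loc_eqI)
        (simp_all add: AutG_mult_fst[OF g h] AutG_nbr[OF g] AutG_nbr[OF h] AutG_in_words[OF h] w nbr_in_words)
  next
    case False
    then show ?thesis by (simp add: loc_def)
  qed
qed

lemma loc_one: "w \<in> words {..<d} \<Longrightarrow> loc d (fst \<one>\<^bsub>AutG (Td d)\<^esub>) w = id"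
  by (rule ext) (auto simp: loc_def AutG_one_fst nbr_in_words)

lemma loc_inv:
  assumes g: "g \<in> carrier (AutG (Td d))" and w: "w \<in> words {..<d}"
  shows "loc d (fst (inv\<^bsub>AutG (Td d)\<^esub> g)) (fst g w) = inv_into UNIV (loc d (fst g) w)"
proof -
  interpret group "AutG (Td d)" by (rule group_AutG_Td)
  have "loc d (fst (inv\<^bsub>AutG (Td d)\<^esub> g)) (fst g w) \<circ> loc d (fst g) w = id" (is "?a \<circ> ?l = id")
    using loc_mult[OF inv_closed[OF g] g w] loc_one[OF w] g by simp
  moreover have "?l \<circ> inv_into UNIV ?l = id"
    by (rule permutes_inv_o[OF AutG_loc_permutes[OF g w]])
  ultimately show ?thesis
    using comp_assoc[of ?a ?l "inv_into UNIV ?l"] by simp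
qed

type_synonym td_aut = "(nat list \<Rightarrow> nat list) \<times> (nat list \<times> nat list \<Rightarrow> nat list \<times> nat list)"
definition lift :: "nat \<Rightarrow> (nat list \<Rightarrow> nat list) \<Rightarrow> td_aut" where
  "lift d g = (restrict g (verts (Td d)), restrict (map_prod g g) (edges (Td d)))"

definition portrait :: "nat \<Rightarrow> (nat list \<Rightarrow> nat \<Rightarrow> nat) \<Rightarrow> bool" where
  "portrait d \<sigma> \<longleftrightarrow> (\<forall>w \<in> words {..<d}. \<sigma> w permutes {..<d}) \<and>
     (\<forall>w c. w @ [c] \<in> words {..<d} \<longrightarrow> \<sigma> (w @ [c]) c = \<sigma> w c)"

definition aut_of :: "nat \<Rightarrow> nat list \<Rightarrow> (nat list \<Rightarrow> nat \<Rightarrow> nat) \<Rightarrow> td_aut" where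
  "aut_of d v \<sigma> = lift d (build v \<sigma>)"

context
  fixes d :: nat and v :: "nat list" and \<sigma> :: "nat list \<Rightarrow> nat \<Rightarrow> nat"
  assumes v: "v \<in> words {..<d}" and \<sigma>: "portrait d \<sigma>"
begin

lemma portrait_less: "w \<in> words {..<d} \<Longrightarrow> c < d \<Longrightarrow> \<sigma> w c < d"
  using \<sigma> permutes_in_image[of "\<sigma> w" "{..<d}" c] by (auto simp: portrait_def)

lemma portrait_build_in_words: "w \<in> words {..<d} \<Longrightarrow> build v \<sigma> w \<in> words {..<d}"
  by (rule build_in_words[OF v]) (auto simp: portrait_less)

lemma portrait_build_locally_by: "locally_by {..<d} (build v \<sigma>) \<sigma>"
  by (rule build_locally_by[OF v]) (use \<sigma> in \<open>auto simp: portrait_less portrait_def\<close>)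

text \<open>The image contains with every vertex all its neighbours, since the local permutations are surjective; as
the tree is connected, the map is surjective.\<close>
lemma portrait_build_bij: "bij_betw (build v \<sigma>) (words {..<d}) (words {..<d})"
proof -
  let ?I = "build v \<sigma> ` words {..<d}"
  have perm: "\<sigma> w permutes {..<d}" if "w \<in> words {..<d}" for w
    using \<sigma> that by (simp add: portrait_def)
  have inj: "inj_on (build v \<sigma>) (words {..<d})"
    by (rule locally_by_inj[OF portrait_build_locally_by, of "{..<d}"])
      (use v permutes_inj_on[OF perm] in \<open>auto simp: portrait_less\<close>)
  have closed: "nbr x c \<in> ?I" if x: "x \<in> ?I" and c: "c < d" for x c
  proof -
    obtain w where w: "w \<in> words {..<d}" "x = build v \<sigma> w" using x by auto
    obtain c' where c': "c' < d" "\<sigma> w c' = c"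
      using permutes_image[OF perm[OF w(1)]] c by (metis imageE lessThan_iff)
    have "nbr x c = build v \<sigma> (nbr w c')"
      using locally_byD[OF portrait_build_locally_by w(1), of c'] c' w by simp
    then show ?thesis using w c' by (simp add: nbr_in_words)
  qed
  have "[] \<in> ?I"
  proof -
    have "u \<in> words {..<d} \<Longrightarrow> u \<in> ?I \<Longrightarrow> [] \<in> ?I" for u
    proof (induction u rule: words_induct)
      case (snoc u c)
      then have "u \<in> ?I" using closed[of "u @ [c]" c] by (simp add: words_snoc)
      then show ?case using snoc by simp
    qed
    moreover have "v \<in> ?I" by (metis Nil_in_words build_Nil image_eqI)
    ultimately show ?thesis using v by blast
  qed
  have "w \<in> ?I" if "w \<in> words {..<d}" for w
    using that
  proof (induction w rule: words_induct)
    case (snoc w c)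
    then show ?case using closed[of w c] nbr_snoc[OF snoc.hyps(2)] by (simp add: words_snoc)
  qed fact
  then have "?I = words {..<d}" using portrait_build_in_words by auto
  then show ?thesis using inj by (simp add: bij_betw_def)
qed

lemma aut_of_in_AutG: "aut_of d v \<sigma> \<in> carrier (AutG (Td d))"
proof -
  let ?g = "build v \<sigma>" and ?E = "edges (Td d)"
  have g: "bij_betw ?g (words {..<d}) (words {..<d})" by (rule portrait_build_bij)
  have E: "map_prod ?g ?g e \<in> ?E" if e: "e \<in> ?E" for e
  proof -
    obtain w c where w: "e = (w, nbr w c)" "w \<in> words {..<d}" "c < d" using e by (auto simp: edges_Td)
    then have "map_prod ?g ?g e = (?g w, nbr (?g w) (\<sigma> w c))"
      using locally_byD[OF portrait_build_locally_by] by simp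
    then show ?thesis using w portrait_build_in_words portrait_less by (auto simp: edges_Td)
  qed
  have surj: "?E \<subseteq> map_prod ?g ?g ` ?E"
  proof
    fix e assume "e \<in> ?E"
    then obtain x c where x: "e = (x, nbr x c)" "x \<in> words {..<d}" "c < d" by (auto simp: edges_Td)
    then obtain w where w: "w \<in> words {..<d}" "x = ?g w" using g by (auto simp: bij_betw_def)
    have "\<sigma> w permutes {..<d}" using \<sigma> w by (simp add: portrait_def)
    then obtain c' where c': "c' < d" "\<sigma> w c' = c"
      using permutes_image x by (metis imageE lessThan_iff)
    have "e = map_prod ?g ?g (w, nbr w c')"
      using locally_byD[OF portrait_build_locally_by w(1)] c' w x by simp
    then show "e \<in> map_prod ?g ?g ` ?E" using w c' by (auto simp: edges_Td)
  qed
  have "inj_on (map_prod ?g ?g) ?E"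
  proof (rule inj_on_subset)
    show "inj_on (map_prod ?g ?g) (words {..<d} \<times> words {..<d})"
      using g by (auto simp: bij_betw_def intro: map_prod_inj_on)
    show "?E \<subseteq> words {..<d} \<times> words {..<d}" by (auto simp: edges_Td nbr_in_words)
  qed
  then have b: "bij_betw (map_prod ?g ?g) ?E ?E" using E surj by (auto simp: bij_betw_def)
  have "restrict ?g (words {..<d}) \<in> Bij (words {..<d})" "restrict (map_prod ?g ?g) ?E \<in> Bij ?E"
    using g b by (auto simp: Bij_def bij_betw_restrict_eq)
  moreover have "fst (restrict (map_prod ?g ?g) ?E e) = restrict ?g (words {..<d}) (fst e)
      \<and> restrict (map_prod ?g ?g) ?E (prod.swap e) = prod.swap (restrict (map_prod ?g ?g) ?E e)"
    if e: "e \<in> ?E" for e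
  proof -
    have "prod.swap e \<in> ?E" using e serre_graph_Td[of d] by (auto simp: serre_graph_def Td_simps(4))
    moreover have "fst e \<in> words {..<d}" using e by (auto simp: edges_Td)
    ultimately show ?thesis using e by (cases e) auto
  qed
  ultimately show ?thesis
    by (auto simp: aut_of_def lift_def AutG_def Td_simps(3,4))
qed

lemma fst_aut_of: "w \<in> words {..<d} \<Longrightarrow> fst (aut_of d v \<sigma>) w = build v \<sigma> w"
  by (simp add: aut_of_def lift_def)

lemma loc_aut_of: "w \<in> words {..<d} \<Longrightarrow> loc d (fst (aut_of d v \<sigma>)) w = \<sigma> w"
proof -
  assume w: "w \<in> words {..<d}"
  have "locally_by {..<d} (fst (aut_of d v \<sigma>)) \<sigma>"
    using portrait_build_locally_by by (auto simp: locally_by_def fst_aut_of nbr_in_words)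
  then show ?thesis by (rule loc_eq) (use w \<sigma> in \<open>auto simp: portrait_def\<close>)
qed

end

lemma AutG_portrait: "g \<in> carrier (AutG (Td d)) \<Longrightarrow> portrait d (loc d (fst g))"
proof -
  assume g: "g \<in> carrier (AutG (Td d))"
  have "loc d (fst g) (w @ [c]) c = loc d (fst g) w c" if w: "w @ [c] \<in> words {..<d}" for w c
    using locally_by_same_colour[OF AutG_locally_by[OF g], of w c] nbr_snoc[OF w] w by (simp add: words_snoc)
  then show ?thesis using AutG_loc_permutes[OF g] by (simp add: portrait_def)
qed

lemma portrait_cong:
  assumes "portrait d \<sigma>" "\<And>w. w \<in> words {..<d} \<Longrightarrow> \<tau> w = \<sigma> w"
  shows "portrait d \<tau>"
  using assms by (auto simp: portrait_def words_snoc)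

lemma portrait_const: "f permutes {..<d} \<Longrightarrow> portrait d (\<lambda>_. f)"
  by (simp add: portrait_def)

lemma build_id: "w \<in> words K \<Longrightarrow> build v (\<lambda>_. id) w = lmul v w"
  by (induction w rule: words_induct) (simp_all add: lmul_snoc)

section \<open>Groups of automorphisms that descend to a label tree\<close>

definition permutations_group :: "'a set \<Rightarrow> ('a \<Rightarrow> 'a) set \<Rightarrow> bool" where
  "permutations_group S F \<longleftrightarrow>
     (\<forall>f \<in> F. f permutes S) \<and> id \<in> F \<and> (\<forall>f \<in> F. \<forall>g \<in> F. f \<circ> g \<in> F) \<and> (\<forall>f \<in> F. inv_into UNIV f \<in> F)"

text \<open>The colours \<open>c\<close> with \<open>\<pi> c = None\<close> are those that the label tree contracts.\<close>
locale label_action =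
  fixes d :: nat and \<pi> :: "nat \<Rightarrow> 'k option" and A Z :: "(nat \<Rightarrow> nat) set"
  assumes A: "permutations_group {..<d} A" and Z: "permutations_group {..<d} Z"
    and commute: "a \<in> A \<Longrightarrow> z \<in> Z \<Longrightarrow> a \<circ> z = z \<circ> a"
    and A_label: "a \<in> A \<Longrightarrow> c < d \<Longrightarrow> c' < d \<Longrightarrow> \<pi> c = \<pi> c' \<Longrightarrow> \<pi> (a c) = \<pi> (a c')"
    and A_None: "a \<in> A \<Longrightarrow> c < d \<Longrightarrow> \<pi> c = None \<Longrightarrow> \<pi> (a c) = None"
    and Z_label: "z \<in> Z \<Longrightarrow> c < d \<Longrightarrow> \<pi> (z c) = \<pi> c"
begin

definition F :: "(nat \<Rightarrow> nat) set" where
  "F = {a \<circ> z | a z. a \<in> A \<and> z \<in> Z}"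

lemma A_permutes: "a \<in> A \<Longrightarrow> a permutes {..<d}" and Z_permutes: "z \<in> Z \<Longrightarrow> z permutes {..<d}"
  and A_comp: "a \<in> A \<Longrightarrow> b \<in> A \<Longrightarrow> a \<circ> b \<in> A" and Z_comp: "y \<in> Z \<Longrightarrow> z \<in> Z \<Longrightarrow> y \<circ> z \<in> Z"
  and A_id: "id \<in> A" and Z_id: "id \<in> Z"
  and A_inv: "a \<in> A \<Longrightarrow> inv_into UNIV a \<in> A" and Z_inv: "z \<in> Z \<Longrightarrow> inv_into UNIV z \<in> Z"
  using A Z by (auto simp: permutations_group_def)

lemma comp_exchange:
  assumes "a \<in> A" "b \<in> A" "y \<in> Z" "z \<in> Z"
  shows "(a \<circ> y) \<circ> (b \<circ> z) = (a \<circ> b) \<circ> (y \<circ> z)"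
  using commute[OF assms(2,3)] by (metis comp_assoc)

lemma inv_exchange:
  assumes "a \<in> A" "z \<in> Z"
  shows "inv_into UNIV (a \<circ> z) = inv_into UNIV a \<circ> inv_into UNIV z"
proof -
  have "inv_into UNIV (a \<circ> z) = inv_into UNIV z \<circ> inv_into UNIV a"
    using permutes_bij[OF A_permutes[OF assms(1)]] permutes_bij[OF Z_permutes[OF assms(2)]]
    by (intro o_inv_distrib)
  then show ?thesis using commute[OF A_inv[OF assms(1)] Z_inv[OF assms(2)]] by simp
qed

lemma F_group: "permutations_group {..<d} F"
  unfolding permutations_group_def
proof (intro conjI ballI)
  have "id \<circ> id \<in> F" unfolding F_def using A_id Z_id by blast
  then show "id \<in> F" by simp
next
  fix f assume "f \<in> F"
  then obtain a z where f: "f = a \<circ> z" "a \<in> A" "z \<in> Z" by (auto simp: F_def)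
  show "f permutes {..<d}"
    unfolding f(1) by (rule permutes_compose[OF Z_permutes A_permutes]) (use f in auto)
  show "inv_into UNIV f \<in> F" using inv_exchange[OF f(2,3)] f A_inv Z_inv by (auto simp: F_def)
  fix g assume "g \<in> F"
  then obtain b y where g: "g = b \<circ> y" "b \<in> A" "y \<in> Z" by (auto simp: F_def)
  show "f \<circ> g \<in> F"
    unfolding f(1) g(1) comp_exchange[OF f(2) g(2) f(3) g(3)] F_def
    using f g A_comp Z_comp by blast
qed

lemma F_permutes: "f \<in> F \<Longrightarrow> f permutes {..<d}" and F_id: "id \<in> F"
  and F_inv: "f \<in> F \<Longrightarrow> inv_into UNIV f \<in> F"
  using F_group by (auto simp: permutations_group_def)

lemma Z_sub_F: "Z \<subseteq> F"
proof -
  have "id \<circ> z \<in> F" if "z \<in> Z" for z unfolding F_def using A_id that by blast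
  then show "Z \<subseteq> F" by auto
qed

lemma finite_F: "finite F" and finite_Z: "finite Z"
proof -
  show "finite F"
    by (rule finite_subset[of _ "{f. f permutes {..<d}}"]) (auto simp: F_permutes finite_permutations)
  then show "finite Z" using Z_sub_F finite_subset by blast
qed

lemma F_less: "f \<in> F \<Longrightarrow> c < d \<Longrightarrow> f c < d"
  using permutes_in_image[OF F_permutes] by (metis lessThan_iff)

lemma F_label:
  assumes "f \<in> F" "c < d" "c' < d" "\<pi> c = \<pi> c'"
  shows "\<pi> (f c) = \<pi> (f c')"
proof -
  obtain a z where f: "f = a \<circ> z" "a \<in> A" "z \<in> Z" using assms(1) by (auto simp: F_def)
  have "z c < d" "z c' < d" using assms f F_less Z_sub_F by auto
  then show ?thesis using assms f A_label[of a "z c" "z c'"] Z_label by simp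
qed

lemma F_None:
  assumes "f \<in> F" "c < d"
  shows "\<pi> (f c) = None \<longleftrightarrow> \<pi> c = None"
proof -
  have *: "\<pi> (f c) = None" if fF: "f \<in> F" and c: "c < d" "\<pi> c = None" for f c
  proof -
    obtain a z where f: "f = a \<circ> z" "a \<in> A" "z \<in> Z" using fF by (auto simp: F_def)
    have "z c < d" using c f F_less Z_sub_F by auto
    then show ?thesis using c f A_None[of a "z c"] Z_label by simp
  qed
  show ?thesis
    using *[OF assms] *[OF F_inv[OF assms(1)] F_less[OF assms]]
      permutes_inverses(2)[OF F_permutes[OF assms(1)]] by auto
qed

lemma F_label_inj:
  assumes "f \<in> F" "c < d" "c' < d" "\<pi> (f c) = \<pi> (f c')"
  shows "\<pi> c = \<pi> c'"
  using F_label[OF F_inv[OF assms(1)] F_less[OF assms(1,2)] F_less[OF assms(1,3)] assms(4)]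
    permutes_inverses(2)[OF F_permutes[OF assms(1)]] by simp

definition labels :: "'k set" where
  "labels = {k. \<exists>c < d. \<pi> c = Some k}"

lemma label_in_labels: "c < d \<Longrightarrow> \<pi> c = Some k \<Longrightarrow> k \<in> labels"
  by (auto simp: labels_def)

text \<open>The effect on the label tree of crossing an edge of colour \<open>c\<close>.\<close>
definition label_step :: "'k list \<Rightarrow> nat \<Rightarrow> 'k list" where
  "label_step u c = (case \<pi> c of None \<Rightarrow> u | Some k \<Rightarrow> nbr u k)"

definition proj :: "nat list \<Rightarrow> 'k list" where
  "proj w = foldl label_step [] w"

lemma proj_Nil [simp]: "proj [] = []" and proj_snoc: "proj (w @ [c]) = label_step (proj w) c"
  by (simp_all add: proj_def)

lemma label_step_in_words: "u \<in> words labels \<Longrightarrow> c < d \<Longrightarrow> label_step u c \<in> words labels"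
  by (auto simp: label_step_def label_in_labels nbr_in_words split: option.split)

lemma label_step_pmul: "u \<in> words labels \<Longrightarrow> c < d \<Longrightarrow> label_step (label_step u c) c = u"
  by (auto simp: label_step_def label_in_labels nbr_nbr[of u labels] split: option.split)

lemma proj_in_words: "w \<in> words {..<d} \<Longrightarrow> proj w \<in> words labels"
  by (induction w rule: words_induct) (auto simp: proj_snoc words_snoc label_step_in_words)

lemma proj_nbr:
  assumes "w \<in> words {..<d}" "c < d"
  shows "proj (nbr w c) = label_step (proj w) c"
proof -
  have "c \<in> {..<d}" using assms by simp
  with assms(1) show ?thesis
  proof (cases rule: nbr_cases)
    case (down u)
    then show ?thesis using assms(2) by (simp add: proj_snoc label_step_pmul proj_in_words)
  qed (simp add: proj_snoc)
qed

text \<open>A choice of a colour for each label; applied letterwise it is a section of \<open>proj\<close>.\<close>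
definition label_rep :: "'k \<Rightarrow> nat" where
  "label_rep k = (SOME c. c < d \<and> \<pi> c = Some k)"

lemma label_rep: "k \<in> labels \<Longrightarrow> label_rep k < d \<and> \<pi> (label_rep k) = Some k"
  unfolding label_rep_def labels_def mem_Collect_eq by (rule someI_ex)

lemma map_label_rep_in_words: "u \<in> words labels \<Longrightarrow> map label_rep u \<in> words {..<d}"
proof (induction u rule: words_induct)
  case (snoc u k)
  then have k: "k \<in> labels" "u \<in> words labels" "u = [] \<or> last u \<noteq> k" by (auto simp: words_snoc)
  then have "last u \<in> labels" if "u \<noteq> []" using that last_in_set by (auto simp: words_def)
  then have "u = [] \<or> label_rep (last u) \<noteq> label_rep k"
    using k label_rep by (metis option.inject)
  then show ?case using snoc k label_rep by (auto simp: words_snoc last_map)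
qed simp

lemma proj_map_label_rep: "u \<in> words labels \<Longrightarrow> proj (map label_rep u) = u"
proof (induction u rule: words_induct)
  case (snoc u k)
  then show ?case using nbr_snoc[OF snoc.hyps(2)] label_rep[of k] by (simp add: proj_snoc label_step_def words_snoc)
qed simp

context
  fixes g :: "nat list \<Rightarrow> nat list" and \<sigma> :: "nat list \<Rightarrow> nat \<Rightarrow> nat"
  assumes g: "locally_by {..<d} g \<sigma>" and g_words: "\<And>w. w \<in> words {..<d} \<Longrightarrow> g w \<in> words {..<d}"
    and \<sigma>_F: "\<And>w. w \<in> words {..<d} \<Longrightarrow> \<sigma> w \<in> F"
    and \<sigma>_proj: "\<And>x y. x \<in> words {..<d} \<Longrightarrow> y \<in> words {..<d} \<Longrightarrow> proj x = proj y \<Longrightarrow> \<sigma> x = \<sigma> y"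
begin

text \<open>The map that \<open>g\<close> induces on the label tree, computed through the section \<open>map label_rep\<close>.\<close>
definition descent :: "'k list \<Rightarrow> 'k list" where
  "descent u = proj (g (map label_rep u))"

definition descent_loc :: "'k list \<Rightarrow> 'k \<Rightarrow> 'k" where
  "descent_loc u k = the (\<pi> (\<sigma> (map label_rep u) (label_rep k)))"

lemma descent_loc:
  assumes "u \<in> words labels" "k \<in> labels"
  shows "\<pi> (\<sigma> (map label_rep u) (label_rep k)) = Some (descent_loc u k)" "descent_loc u k \<in> labels"
proof -
  have f: "\<sigma> (map label_rep u) \<in> F" using \<sigma>_F map_label_rep_in_words assms by blast
  show 1: "\<pi> (\<sigma> (map label_rep u) (label_rep k)) = Some (descent_loc u k)"
    using F_None[OF f, of "label_rep k"] label_rep[OF assms(2)] by (auto simp: descent_loc_def)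
  show "descent_loc u k \<in> labels" using 1 F_less[OF f] label_rep[OF assms(2)] by (auto simp: labels_def)
qed

lemma descent_in_words: "u \<in> words labels \<Longrightarrow> descent u \<in> words labels"
  by (simp add: descent_def proj_in_words g_words map_label_rep_in_words)

lemma descent_snoc:
  assumes u: "u @ [k] \<in> words labels"
  shows "descent (u @ [k]) = nbr (descent u) (descent_loc u k)"
proof -
  have k: "u \<in> words labels" "k \<in> labels" using u by (auto simp: words_snoc)
  then have w: "map label_rep u \<in> words {..<d}" "label_rep k \<in> {..<d}" using map_label_rep_in_words label_rep by auto
  have "map label_rep (u @ [k]) = nbr (map label_rep u) (label_rep k)"
    using nbr_snoc[of "map label_rep u" "label_rep k" "{..<d}"] map_label_rep_in_words[OF u] by simp
  then have "descent (u @ [k]) = label_step (descent u) (\<sigma> (map label_rep u) (label_rep k))"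
    using locally_byD[OF g w] w g_words proj_nbr F_less[OF \<sigma>_F[OF w(1)]] by (simp add: descent_def)
  then show ?thesis using descent_loc[OF k] by (simp add: label_step_def)
qed

lemma descent_locally_by: "locally_by labels descent descent_loc"
  unfolding locally_by_def
proof (intro ballI)
  fix u k assume u: "u \<in> words labels" "k \<in> labels"
  then show "descent (nbr u k) = nbr (descent u) (descent_loc u k)"
  proof (cases rule: nbr_cases)
    case up
    then show ?thesis by (simp add: descent_snoc)
  next
    case (down t)
    have w: "map label_rep t \<in> words {..<d}" "label_rep k \<in> {..<d}" using map_label_rep_in_words label_rep u down by auto
    have "map label_rep u = nbr (map label_rep t) (label_rep k)"
      using nbr_snoc[of "map label_rep t" "label_rep k" "{..<d}"] map_label_rep_in_words[OF u(1)] down by simp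
    then have "descent_loc u k = descent_loc t k"
      using locally_by_same_colour[OF g w] by (simp add: descent_loc_def)
    moreover have "descent u = nbr (descent t) (descent_loc t k)" using descent_snoc[of t k] u down by simp
    ultimately show ?thesis
      using down descent_loc[OF _ u(2), of t] nbr_nbr[OF descent_in_words[of t]] by simp
  qed
qed

text \<open>By induction along the path to \<open>w\<close>: since \<open>\<sigma>\<close> is constant on the fibres of \<open>proj\<close> and its values
respect the labelling, the label of the image of an edge depends only on the projection of the edge.\<close>
lemma proj_image: "w \<in> words {..<d} \<Longrightarrow> proj (g w) = descent (proj w)"
proof (induction w rule: words_induct)
  case Nil
  then show ?case by (simp add: descent_def)
next
  case (snoc w c)
  then have w: "w \<in> words {..<d}" "c \<in> {..<d}" by (auto simp: words_snoc)
  have eq: "proj (g (w @ [c])) = label_step (descent (proj w)) (\<sigma> w c)"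
    using locally_byD[OF g w] nbr_snoc[OF snoc.hyps(2)] proj_nbr[of "g w" "\<sigma> w c"] g_words w
      F_less[OF \<sigma>_F[OF w(1)]] snoc.IH by simp
  show ?case
  proof (cases "\<pi> c")
    case None
    then have "\<pi> (\<sigma> w c) = None" using F_None[OF \<sigma>_F[OF w(1)], of c] w by simp
    then show ?thesis using eq None by (simp add: label_step_def proj_snoc)
  next
    case (Some k)
    then have k: "k \<in> labels" using w by (auto simp: labels_def)
    have p: "proj w \<in> words labels" using proj_in_words w by blast
    have "\<sigma> w = \<sigma> (map label_rep (proj w))"
      by (rule \<sigma>_proj) (simp_all add: w map_label_rep_in_words proj_map_label_rep p)
    moreover have "\<pi> (\<sigma> w c) = \<pi> (\<sigma> w (label_rep k))"
      using F_label[OF \<sigma>_F[OF w(1)], of c "label_rep k"] w label_rep[OF k] Some by simp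
    ultimately have "\<pi> (\<sigma> w c) = Some (descent_loc (proj w) k)"
      using descent_loc[OF p k] by simp
    then show ?thesis
      using eq Some locally_byD[OF descent_locally_by p k] by (simp add: label_step_def proj_snoc)
  qed
qed

text \<open>The induced map on the label tree is again locally injective, because the values of \<open>\<sigma>\<close> separate labels;
hence it is injective. This is what closes the group \<open>H\<close> below under inverses.\<close>
lemma proj_image_eq_iff:
  assumes "x \<in> words {..<d}" "y \<in> words {..<d}"
  shows "proj (g x) = proj (g y) \<longleftrightarrow> proj x = proj y"
proof -
  have "inj_on descent (words labels)"
  proof (rule locally_by_inj[OF descent_locally_by])
    show "descent [] \<in> words labels" by (simp add: descent_in_words)
    fix u assume u: "u \<in> words labels"
    show "descent_loc u ` labels \<subseteq> labels" using descent_loc u by blast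
    show "inj_on (descent_loc u) labels"
    proof (rule inj_onI)
      fix k k' assume k: "k \<in> labels" "k' \<in> labels" "descent_loc u k = descent_loc u k'"
      then have "\<pi> (\<sigma> (map label_rep u) (label_rep k)) = \<pi> (\<sigma> (map label_rep u) (label_rep k'))"
        using descent_loc u by metis
      then show "k = k'"
        using F_label_inj[OF \<sigma>_F, of "map label_rep u" "label_rep k" "label_rep k'"] map_label_rep_in_words[OF u] label_rep k by simp
    qed
  qed
  then show ?thesis
    using proj_image assms proj_in_words by (auto dest: inj_onD)
qed

end

text \<open>The factor \<open>z\<close> is the same for all vertices. Without this the elements with portrait in \<open>Z\<close> would in
general not be quasi-central: the commutator with an element of \<open>H\<close> that is trivial near the root could
be non-trivial further away.\<close>
definition compatible :: "(nat list \<Rightarrow> nat \<Rightarrow> nat) \<Rightarrow> bool" where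
  "compatible \<sigma> \<longleftrightarrow>
     (\<exists>z \<in> Z. \<forall>x \<in> words {..<d}. \<exists>a \<in> A. \<sigma> x = a \<circ> z) \<and>
     (\<forall>x \<in> words {..<d}. \<forall>y \<in> words {..<d}. proj x = proj y \<longrightarrow> \<sigma> x = \<sigma> y)"

definition H :: "td_aut set" where
  "H = {g \<in> carrier (AutG (Td d)). compatible (loc d (fst g))}"

lemma compatible_F: "compatible \<sigma> \<Longrightarrow> x \<in> words {..<d} \<Longrightarrow> \<sigma> x \<in> F"
  unfolding compatible_def F_def by blast

lemma compatible_proj:
  "compatible \<sigma> \<Longrightarrow> x \<in> words {..<d} \<Longrightarrow> y \<in> words {..<d} \<Longrightarrow> proj x = proj y \<Longrightarrow> \<sigma> x = \<sigma> y"
  unfolding compatible_def by blast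

lemma compatible_cong:
  assumes "\<And>w. w \<in> words {..<d} \<Longrightarrow> \<tau> w = \<sigma> w"
  shows "compatible \<tau> \<longleftrightarrow> compatible \<sigma>"
proof -
  have "(\<forall>x \<in> words {..<d}. \<exists>a \<in> A. \<tau> x = a \<circ> z) \<longleftrightarrow> (\<forall>x \<in> words {..<d}. \<exists>a \<in> A. \<sigma> x = a \<circ> z)" for z
    by (intro ball_cong refl) (simp add: assms)
  moreover have "(\<forall>x \<in> words {..<d}. \<forall>y \<in> words {..<d}. proj x = proj y \<longrightarrow> \<tau> x = \<tau> y) \<longleftrightarrow>
      (\<forall>x \<in> words {..<d}. \<forall>y \<in> words {..<d}. proj x = proj y \<longrightarrow> \<sigma> x = \<sigma> y)"
    by (intro ball_cong refl) (simp add: assms)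
  ultimately show ?thesis by (simp only: compatible_def)
qed

lemma compatible_const: "f \<in> F \<Longrightarrow> compatible (\<lambda>_. f)"
  by (auto simp: compatible_def F_def)

lemma H_AutG: "g \<in> H \<Longrightarrow> g \<in> carrier (AutG (Td d))"
  and H_compatible: "g \<in> H \<Longrightarrow> compatible (loc d (fst g))"
  by (simp_all add: H_def)

lemma H_proj_iff:
  assumes "g \<in> H" "x \<in> words {..<d}" "y \<in> words {..<d}"
  shows "proj (fst g x) = proj (fst g y) \<longleftrightarrow> proj x = proj y"
proof (rule proj_image_eq_iff[OF AutG_locally_by[OF H_AutG[OF assms(1)]] _ _ _ assms(2,3)])
  show "fst g w \<in> words {..<d}" "loc d (fst g) w \<in> F" if "w \<in> words {..<d}" for w
    using that by (rule AutG_in_words[OF H_AutG[OF assms(1)]] compatible_F[OF H_compatible[OF assms(1)]])+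
  show "loc d (fst g) x = loc d (fst g) y"
    if "x \<in> words {..<d}" "y \<in> words {..<d}" "proj x = proj y" for x y
    using that by (rule compatible_proj[OF H_compatible[OF assms(1)]])
qed

lemma compatibleE:
  assumes "compatible \<sigma>"
  obtains z where "z \<in> Z" "\<And>x. x \<in> words {..<d} \<Longrightarrow> \<exists>a \<in> A. \<sigma> x = a \<circ> z"
  using assms unfolding compatible_def by blast

lemma compatibleI:
  assumes "z \<in> Z" "\<And>x. x \<in> words {..<d} \<Longrightarrow> \<exists>a \<in> A. \<sigma> x = a \<circ> z"
    and "\<And>x y. x \<in> words {..<d} \<Longrightarrow> y \<in> words {..<d} \<Longrightarrow> proj x = proj y \<Longrightarrow> \<sigma> x = \<sigma> y"
  shows "compatible \<sigma>"
  using assms unfolding compatible_def by blast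

lemma H_subgroup: "subgroup H (AutG (Td d))"
proof -
  interpret group "AutG (Td d)" by (rule group_AutG_Td)
  show ?thesis
  proof (rule subgroupI)
    show "H \<subseteq> carrier (AutG (Td d))" by (auto simp: H_def)
    have "\<one>\<^bsub>AutG (Td d)\<^esub> \<in> H"
      using compatible_cong[of "loc d (fst \<one>\<^bsub>AutG (Td d)\<^esub>)" "\<lambda>_. id"] loc_one
        compatible_const[OF F_id] by (simp add: H_def)
    then show "H \<noteq> {}" by blast
  next
    fix g assume g: "g \<in> H"
    note gA = H_AutG[OF g]
    let ?i = "inv\<^bsub>AutG (Td d)\<^esub> g"
    have loc_i: "loc d (fst ?i) x = inv_into UNIV (loc d (fst g) (fst ?i x))" if "x \<in> words {..<d}" for x
      using loc_inv[OF gA, of "fst ?i x"] AutG_inv_fst[OF gA that] AutG_in_words[OF inv_closed[OF gA] that]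
      by simp
    have iw: "fst ?i x \<in> words {..<d}" if "x \<in> words {..<d}" for x
      using AutG_in_words[OF inv_closed[OF gA] that] .
    obtain z where z: "z \<in> Z" "\<And>x. x \<in> words {..<d} \<Longrightarrow> \<exists>a \<in> A. loc d (fst g) x = a \<circ> z"
      using H_compatible[OF g] by (rule compatibleE) blast
    have "\<exists>a \<in> A. loc d (fst ?i) x = a \<circ> inv_into UNIV z" if x: "x \<in> words {..<d}" for x
      using z(2)[OF iw[OF x]] loc_i[OF x] inv_exchange[OF _ z(1)] A_inv by metis
    moreover have "loc d (fst ?i) x = loc d (fst ?i) y"
      if "x \<in> words {..<d}" "y \<in> words {..<d}" "proj x = proj y" for x y
    proof -
      have "proj (fst ?i x) = proj (fst ?i y)"
        using H_proj_iff[OF g iw[OF that(1)] iw[OF that(2)]] that(3)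
          AutG_inv_fst(2)[OF gA that(1)] AutG_inv_fst(2)[OF gA that(2)] by simp
      then have "loc d (fst g) (fst ?i x) = loc d (fst g) (fst ?i y)"
        by (rule compatible_proj[OF H_compatible[OF g] iw[OF that(1)] iw[OF that(2)]])
      then show ?thesis using loc_i[OF that(1)] loc_i[OF that(2)] by simp
    qed
    ultimately have "compatible (loc d (fst ?i))" by (rule compatibleI[OF Z_inv[OF z(1)]])
    then show "?i \<in> H" using inv_closed[OF gA] by (simp add: H_def)
  next
    fix g h assume g: "g \<in> H" and h: "h \<in> H"
    note gA = H_AutG[OF g] and hA = H_AutG[OF h]
    let ?m = "g \<otimes>\<^bsub>AutG (Td d)\<^esub> h"
    have hw: "fst h x \<in> words {..<d}" if "x \<in> words {..<d}" for x
      using AutG_in_words[OF hA that] .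
    obtain z where z: "z \<in> Z" "\<And>x. x \<in> words {..<d} \<Longrightarrow> \<exists>a \<in> A. loc d (fst g) x = a \<circ> z"
      using H_compatible[OF g] by (rule compatibleE) blast
    obtain y where y: "y \<in> Z" "\<And>x. x \<in> words {..<d} \<Longrightarrow> \<exists>a \<in> A. loc d (fst h) x = a \<circ> y"
      using H_compatible[OF h] by (rule compatibleE) blast
    have "\<exists>a \<in> A. loc d (fst ?m) x = a \<circ> (z \<circ> y)" if x: "x \<in> words {..<d}" for x
    proof -
      obtain a b where "a \<in> A" "b \<in> A" "loc d (fst g) (fst h x) = a \<circ> z" "loc d (fst h) x = b \<circ> y"
        using y(2)[OF x] z(2)[OF hw[OF x]] by blast
      then show ?thesis
        using loc_mult[OF gA hA x] comp_exchange[of a b z y] y z A_comp by metis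
    qed
    moreover have "loc d (fst ?m) x = loc d (fst ?m) y"
      if "x \<in> words {..<d}" "y \<in> words {..<d}" "proj x = proj y" for x y
    proof -
      have "proj (fst h x) = proj (fst h y)" using H_proj_iff[OF h that(1,2)] that(3) by simp
      then have "loc d (fst g) (fst h x) = loc d (fst g) (fst h y)"
        by (rule compatible_proj[OF H_compatible[OF g] hw[OF that(1)] hw[OF that(2)]])
      moreover have "loc d (fst h) x = loc d (fst h) y"
        by (rule compatible_proj[OF H_compatible[OF h] that])
      ultimately show ?thesis using loc_mult[OF gA hA that(1)] loc_mult[OF gA hA that(2)] by simp
    qed
    ultimately have "compatible (loc d (fst ?m))" by (rule compatibleI[OF Z_comp[OF z(1) y(1)]])
    then show "?m \<in> H" using m_closed[OF gA hA] by (simp add: H_def)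
  qed
qed

lemma aut_of_in_H:
  assumes "v \<in> words {..<d}" "portrait d \<sigma>" "compatible \<sigma>"
  shows "aut_of d v \<sigma> \<in> H"
  using assms compatible_cong[of "loc d (fst (aut_of d v \<sigma>))" \<sigma>] loc_aut_of aut_of_in_AutG
  by (simp add: H_def)

lemma aut_of_const_in_H: "v \<in> words {..<d} \<Longrightarrow> f \<in> F \<Longrightarrow> aut_of d v (\<lambda>_. f) \<in> H"
  by (intro aut_of_in_H compatible_const portrait_const F_permutes)

end

section \<open>Topology of the groups and quasi-central elements\<close>

lemma openin_aut_cylinder:
  assumes "g \<in> carrier (AutG (Td d))" "finite P" "P \<subseteq> words {..<d}"
  shows "openin (aut_topology (Td d)) (aut_cylinder (Td d) g P {})"
  unfolding aut_topology_def
  using assms by (intro topology_generated_by_Basis CollectI exI[of _ g] exI[of _ P] exI[of _ "{}"]) simp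

lemma aut_cylinder_subset:
  assumes g0: "g0 \<in> carrier (AutG (Td d))" and g: "g \<in> aut_cylinder (Td d) g0 P B" and B: "B \<subseteq> edges (Td d)"
  shows "aut_cylinder (Td d) g (P \<union> fst ` B \<union> snd ` B) {} \<subseteq> aut_cylinder (Td d) g0 P B"
proof
  fix h assume h: "h \<in> aut_cylinder (Td d) g (P \<union> fst ` B \<union> snd ` B) {}"
  have hA: "h \<in> carrier (AutG (Td d))" and gA: "g \<in> carrier (AutG (Td d))"
    using g h by (auto simp: aut_cylinder_def)
  have "snd h e = snd g e" if "e \<in> B" for e
  proof -
    have "fst h (fst e) = fst g (fst e)" "fst h (snd e) = fst g (snd e)"
      using h that by (auto simp: aut_cylinder_def)
    then show ?thesis using AutG_snd[OF hA] AutG_snd[OF gA] that B by (cases e) auto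
  qed
  then show "h \<in> aut_cylinder (Td d) g0 P B" using g h by (auto simp: aut_cylinder_def)
qed

text \<open>An automorphism acts on an edge as it acts on the two ends, so that the cylinders given by finitely many
vertices form a basis.\<close>
lemma openin_aut_topology_iff:
  "openin (aut_topology (Td d)) U \<longleftrightarrow> U \<subseteq> carrier (AutG (Td d)) \<and>
     (\<forall>g \<in> U. \<exists>P. finite P \<and> P \<subseteq> words {..<d} \<and> aut_cylinder (Td d) g P {} \<subseteq> U)"
  (is "?L \<longleftrightarrow> ?R")
proof
  assume U: ?L
  have "U \<subseteq> carrier (AutG (Td d))" using openin_subset[OF U] topspace_aut_topology by blast
  moreover have "\<exists>P. finite P \<and> P \<subseteq> words {..<d} \<and> aut_cylinder (Td d) g P {} \<subseteq> U" if "g \<in> U" for g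
    using U that unfolding aut_topology_def openin_topology_generated_by_iff
  proof (induction arbitrary: g rule: generate_topology_on.induct)
    case Empty
    then show ?case by simp
  next
    case (Int a b)
    obtain P where P: "finite P" "P \<subseteq> words {..<d}" "aut_cylinder (Td d) g P {} \<subseteq> a"
      using Int.IH(1)[of g] Int.prems by blast
    obtain Q where Q: "finite Q" "Q \<subseteq> words {..<d}" "aut_cylinder (Td d) g Q {} \<subseteq> b"
      using Int.IH(2)[of g] Int.prems by blast
    have "aut_cylinder (Td d) g (P \<union> Q) {} \<subseteq> aut_cylinder (Td d) g P {} \<inter> aut_cylinder (Td d) g Q {}"
      by (auto simp: aut_cylinder_def)
    then show ?case using P Q by (intro exI[of _ "P \<union> Q"]) blast
  next
    case (UN K)
    then obtain k where k: "k \<in> K" "g \<in> k" by blast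
    then obtain P where "finite P" "P \<subseteq> words {..<d}" "aut_cylinder (Td d) g P {} \<subseteq> k"
      using UN.IH[of k g] by blast
    then show ?case using k by (intro exI[of _ P]) blast
  next
    case (Basis s)
    then obtain g0 P B where s: "s = aut_cylinder (Td d) g0 P B" "g0 \<in> carrier (AutG (Td d))"
      "finite P" "P \<subseteq> words {..<d}" "finite B" "B \<subseteq> edges (Td d)" by auto
    have "fst ` B \<union> snd ` B \<subseteq> words {..<d}" using s(6) by (auto simp: edges_Td nbr_in_words)
    then show ?case
      using s aut_cylinder_subset[OF s(2) _ s(6), of g P] Basis
      by (intro exI[of _ "P \<union> fst ` B \<union> snd ` B"]) auto
  qed
  ultimately show ?R by blast
next
  assume R: ?R
  show ?L
  proof (subst openin_subopen, intro ballI)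
    fix g assume g: "g \<in> U"
    then obtain P where P: "finite P" "P \<subseteq> words {..<d}" "aut_cylinder (Td d) g P {} \<subseteq> U" using R by blast
    have gA: "g \<in> carrier (AutG (Td d))" using g R by blast
    then have "g \<in> aut_cylinder (Td d) g P {}" by (simp add: aut_cylinder_def)
    with openin_aut_cylinder[OF gA P(1,2)] P(3)
    show "\<exists>T. openin (aut_topology (Td d)) T \<and> g \<in> T \<and> T \<subseteq> U"
      by blast
  qed
qed

definition nbhd :: "nat \<Rightarrow> nat list \<Rightarrow> nat list set" where
  "nbhd d w = insert w (nbr w ` {..<d})"

lemma finite_nbhd: "finite (nbhd d w)" and nbhd_sub: "w \<in> words {..<d} \<Longrightarrow> nbhd d w \<subseteq> words {..<d}"
  by (auto simp: nbhd_def nbr_in_words)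

lemma loc_cong:
  assumes "\<And>x. x \<in> nbhd d w \<Longrightarrow> g x = h x"
  shows "loc d g w = loc d h w"
proof
  fix c show "loc d g w c = loc d h w c"
    using assms[of w] assms[of "nbr w c"] by (cases "c < d") (auto simp: loc_def nbhd_def)
qed

lemma build_cong:
  assumes "w \<in> words K" "\<And>n. n < length w \<Longrightarrow> \<sigma> (take n w) = \<tau> (take n w)"
  shows "build v \<sigma> w = build v \<tau> w"
  using assms
proof (induction w rule: words_induct)
  case (snoc w k)
  have "\<sigma> (take n w) = \<tau> (take n w)" if "n < length w" for n
    using snoc.prems[of n] that by simp
  moreover have "\<sigma> w = \<tau> w" using snoc.prems[of "length w"] by simp
  ultimately show ?case using snoc.IH by simp
qed simp

lemma take_in_words: "w \<in> words K \<Longrightarrow> take n w \<in> words K"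
proof (induction w rule: words_induct)
  case (snoc w k)
  then show ?case by (cases "n \<le> length w") auto
qed simp

context label_action
begin

text \<open>A violation of compatibility is visible at finitely many vertices, one for each of the finitely many
candidates \<open>z\<close>, or two in the same fibre. Both the closedness of \<open>H\<close> and that of the set of portraits
follow.\<close>
lemma incompatible_finite:
  assumes "\<not> compatible \<sigma>"
  obtains P where "finite P" "P \<subseteq> words {..<d}"
    "\<And>\<tau>. (\<And>x. x \<in> P \<Longrightarrow> \<tau> x = \<sigma> x) \<Longrightarrow> \<not> compatible \<tau>"
proof (cases "\<forall>z \<in> Z. \<exists>x \<in> words {..<d}. \<forall>a \<in> A. \<sigma> x \<noteq> a \<circ> z")
  case True
  then obtain f where f: "\<And>z. z \<in> Z \<Longrightarrow> f z \<in> words {..<d}" "\<And>z a. z \<in> Z \<Longrightarrow> a \<in> A \<Longrightarrow> \<sigma> (f z) \<noteq> a \<circ> z"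
    by metis
  show thesis
  proof (rule that[of "f ` Z"])
    fix \<tau> assume \<tau>: "\<And>x. x \<in> f ` Z \<Longrightarrow> \<tau> x = \<sigma> x"
    show "\<not> compatible \<tau>"
    proof
      assume "compatible \<tau>"
      then obtain z where z: "z \<in> Z" "\<And>x. x \<in> words {..<d} \<Longrightarrow> \<exists>a \<in> A. \<tau> x = a \<circ> z"
        by (rule compatibleE) blast
      then show False using f(1)[OF z(1)] f(2)[OF z(1)] \<tau>[of "f z"] by (metis imageI)
    qed
  qed (use f finite_Z in auto)
next
  case False
  then obtain z where "z \<in> Z" "\<And>x. x \<in> words {..<d} \<Longrightarrow> \<exists>a \<in> A. \<sigma> x = a \<circ> z" by blast
  then have "\<not> (\<forall>x \<in> words {..<d}. \<forall>y \<in> words {..<d}. proj x = proj y \<longrightarrow> \<sigma> x = \<sigma> y)"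
    using assms unfolding compatible_def by blast
  then obtain x y where xy: "x \<in> words {..<d}" "y \<in> words {..<d}" "proj x = proj y" "\<sigma> x \<noteq> \<sigma> y" by blast
  show thesis
  proof (rule that[of "{x, y}"])
    fix \<tau> assume \<tau>: "\<And>w. w \<in> {x, y} \<Longrightarrow> \<tau> w = \<sigma> w"
    have "\<tau> x \<noteq> \<tau> y" using \<tau>[of x] \<tau>[of y] xy(4) by simp
    then show "\<not> compatible \<tau>" using compatible_proj[OF _ xy(1,2,3), of \<tau>] by blast
  qed (use xy in auto)
qed

lemma H_closed: "closedin (aut_topology (Td d)) H"
  unfolding closedin_def topspace_aut_topology openin_aut_topology_iff
proof (intro conjI ballI)
  show "H \<subseteq> carrier (AutG (Td d))" by (auto simp: H_def)
  show "carrier (AutG (Td d)) - H \<subseteq> carrier (AutG (Td d))" by blast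
  fix g assume g: "g \<in> carrier (AutG (Td d)) - H"
  then have "\<not> compatible (loc d (fst g))" by (simp add: H_def)
  then obtain P where P: "finite P" "P \<subseteq> words {..<d}"
    "\<And>\<tau>. (\<And>x. x \<in> P \<Longrightarrow> \<tau> x = loc d (fst g) x) \<Longrightarrow> \<not> compatible \<tau>"
    by (rule incompatible_finite) blast
  let ?Q = "\<Union>x \<in> P. nbhd d x"
  have "h \<in> carrier (AutG (Td d)) - H" if h: "h \<in> aut_cylinder (Td d) g ?Q {}" for h
  proof -
    have "loc d (fst h) x = loc d (fst g) x" if "x \<in> P" for x
      by (rule loc_cong) (use that h in \<open>auto simp: aut_cylinder_def\<close>)
    then have "\<not> compatible (loc d (fst h))" by (rule P(3))
    then show ?thesis using h by (simp add: aut_cylinder_def H_def)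
  qed
  moreover have "finite ?Q" using P(1) finite_nbhd by blast
  moreover have "?Q \<subseteq> words {..<d}" using P(2) nbhd_sub by blast
  ultimately show "\<exists>Q. finite Q \<and> Q \<subseteq> words {..<d} \<and>
      aut_cylinder (Td d) g Q {} \<subseteq> carrier (AutG (Td d)) - H"
    by (intro exI[of _ ?Q]) blast
qed

text \<open>The compact space in which the portraits of the elements fixing the root form a closed set.\<close>
definition portraits :: "(nat list \<Rightarrow> nat \<Rightarrow> nat) topology" where
  "portraits = product_topology (\<lambda>_. discrete_topology F) (words {..<d})"

definition root_portraits :: "(nat list \<Rightarrow> nat \<Rightarrow> nat) set" where
  "root_portraits = {\<sigma> \<in> topspace portraits. portrait d \<sigma> \<and> compatible \<sigma>}"

lemma topspace_portraits: "topspace portraits = PiE (words {..<d}) (\<lambda>_. F)"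
  by (simp add: portraits_def)

lemma openin_portraits_agree:
  assumes "\<sigma> \<in> topspace portraits" "finite P" "P \<subseteq> words {..<d}"
  shows "openin portraits {\<tau> \<in> topspace portraits. \<forall>x \<in> P. \<tau> x = \<sigma> x}"
proof -
  let ?X = "\<lambda>x. if x \<in> P then {\<sigma> x} else F"
  have "{\<tau> \<in> topspace portraits. \<forall>x \<in> P. \<tau> x = \<sigma> x} = PiE (words {..<d}) ?X"
  proof (intro Set.set_eqI iffI)
    fix \<tau> assume "\<tau> \<in> PiE (words {..<d}) ?X"
    then have \<tau>: "\<tau> \<in> extensional (words {..<d})" "\<And>x. x \<in> words {..<d} \<Longrightarrow> \<tau> x \<in> ?X x"
      by (simp_all add: PiE_iff)
    have "\<tau> x = \<sigma> x" if "x \<in> P" for x using \<tau>(2)[of x] that assms(3) by auto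
    moreover have "\<tau> x \<in> F" if "x \<in> words {..<d}" for x
      using \<tau>(2)[OF that] assms(1) that by (auto simp: topspace_portraits PiE_iff split: if_splits)
    ultimately show "\<tau> \<in> {\<tau> \<in> topspace portraits. \<forall>x \<in> P. \<tau> x = \<sigma> x}"
      using \<tau>(1) by (simp add: topspace_portraits PiE_iff)
  qed (simp add: topspace_portraits PiE_iff)
  moreover have "openin portraits (PiE (words {..<d}) ?X)"
    unfolding portraits_def
    by (rule product_topology_basis)
      (use assms in \<open>auto simp: topspace_portraits PiE_iff intro: finite_subset[of _ P]\<close>)
  ultimately show ?thesis by simp
qed

lemma root_portraits_compact: "compactin portraits root_portraits"
proof (rule closedin_compact_space)
  show "compact_space portraits"
    by (simp add: portraits_def compact_space_product_topology finite_F compact_space_discrete_topology)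
  show "closedin portraits root_portraits"
    unfolding closedin_def
  proof
    show "root_portraits \<subseteq> topspace portraits" by (auto simp: root_portraits_def)
    show "openin portraits (topspace portraits - root_portraits)"
    proof (subst openin_subopen, intro ballI)
      fix \<sigma> assume \<sigma>: "\<sigma> \<in> topspace portraits - root_portraits"
      have "\<exists>P. finite P \<and> P \<subseteq> words {..<d} \<and>
        (\<forall>\<tau>. (\<forall>x \<in> P. \<tau> x = \<sigma> x) \<longrightarrow> \<not> (portrait d \<tau> \<and> compatible \<tau>))"
      proof (cases "compatible \<sigma>")
        case True
        then have "\<not> portrait d \<sigma>" using \<sigma> by (simp add: root_portraits_def)
        moreover have "\<sigma> w permutes {..<d}" if "w \<in> words {..<d}" for w
          using \<sigma> that F_permutes by (auto simp: topspace_portraits PiE_iff)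
        ultimately obtain w c where w: "w @ [c] \<in> words {..<d}" "\<sigma> (w @ [c]) c \<noteq> \<sigma> w c"
          by (auto simp: portrait_def)
        then show ?thesis
        proof (intro exI[of _ "{w, w @ [c]}"] conjI allI impI)
            fix \<tau> assume "\<forall>x \<in> {w, w @ [c]}. \<tau> x = \<sigma> x"
            then have "\<tau> (w @ [c]) c \<noteq> \<tau> w c" using w(2) by simp
            then show "\<not> (portrait d \<tau> \<and> compatible \<tau>)" using w(1) unfolding portrait_def by blast
          qed (use w in \<open>auto simp: words_snoc\<close>)
      next
        case False
        then obtain P where "finite P" "P \<subseteq> words {..<d}"
          "\<And>\<tau>. (\<And>x. x \<in> P \<Longrightarrow> \<tau> x = \<sigma> x) \<Longrightarrow> \<not> compatible \<tau>"
          by (rule incompatible_finite) blast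
        then show ?thesis by (intro exI[of _ P]) simp
      qed
      then obtain P where P: "finite P" "P \<subseteq> words {..<d}"
        "\<And>\<tau>. \<forall>x \<in> P. \<tau> x = \<sigma> x \<Longrightarrow> \<not> (portrait d \<tau> \<and> compatible \<tau>)" by blast
      have "{\<tau> \<in> topspace portraits. \<forall>x \<in> P. \<tau> x = \<sigma> x} \<subseteq> topspace portraits - root_portraits"
        using P(3) unfolding root_portraits_def by blast
      moreover have "openin portraits {\<tau> \<in> topspace portraits. \<forall>x \<in> P. \<tau> x = \<sigma> x}"
        using openin_portraits_agree P \<sigma> by blast
      ultimately show "\<exists>T. openin portraits T \<and> \<sigma> \<in> T \<and> T \<subseteq> topspace portraits - root_portraits"
        using \<sigma> by blast
    qed
  qed
qed

lemma root_portraitsD: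
  "\<sigma> \<in> root_portraits \<Longrightarrow> portrait d \<sigma>" "\<sigma> \<in> root_portraits \<Longrightarrow> compatible \<sigma>"
  by (auto simp: root_portraits_def)

text \<open>The image of the vertex \<open>x\<close> depends only on the portrait at the proper prefixes of \<open>x\<close>.\<close>
lemma aut_of_continuous:
  "continuous_map (subtopology portraits root_portraits) (aut_topology (Td d)) (aut_of d [])"
  unfolding continuous_map_def
proof (intro conjI allI impI)
  show "aut_of d [] \<in> topspace (subtopology portraits root_portraits) \<rightarrow> topspace (aut_topology (Td d))"
    using aut_of_in_AutG[of "[]"] root_portraitsD by (auto simp: topspace_aut_topology)
  fix U assume U: "openin (aut_topology (Td d)) U"
  let ?S = "{\<sigma> \<in> topspace (subtopology portraits root_portraits). aut_of d [] \<sigma> \<in> U}"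
  show "openin (subtopology portraits root_portraits) ?S"
  proof (subst openin_subopen, intro ballI)
    fix \<sigma> assume \<sigma>: "\<sigma> \<in> ?S"
    then have \<sigma>C: "\<sigma> \<in> root_portraits" "\<sigma> \<in> topspace portraits" by auto
    obtain P where P: "finite P" "P \<subseteq> words {..<d}" "aut_cylinder (Td d) (aut_of d [] \<sigma>) P {} \<subseteq> U"
      using U \<sigma> unfolding openin_aut_topology_iff by blast
    \<comment> \<open>The vertices at which the portrait enters the recursion for the images of the elements of \<open>P\<close>.\<close>
    let ?Q = "\<Union>x \<in> P. (\<lambda>n. take n x) ` {..<length x}"
    let ?T = "{\<tau> \<in> topspace portraits. \<forall>x \<in> ?Q. \<tau> x = \<sigma> x}"
    have "?Q \<subseteq> words {..<d}" using P(2) take_in_words by blast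
    moreover have "finite ?Q" using P(1) by blast
    ultimately have "openin portraits ?T" by (intro openin_portraits_agree[OF \<sigma>C(2)])
    then have "openin (subtopology portraits root_portraits) (?T \<inter> root_portraits)"
      unfolding openin_subtopology by blast
    moreover have "\<sigma> \<in> ?T \<inter> root_portraits" using \<sigma>C by simp
    moreover have "?T \<inter> root_portraits \<subseteq> ?S"
    proof
      fix \<tau> assume \<tau>: "\<tau> \<in> ?T \<inter> root_portraits"
      then have "build [] \<tau> x = build [] \<sigma> x" if "x \<in> P" for x
        using that P(2) by (intro build_cong[of x "{..<d}"]) auto
      then have "aut_of d [] \<tau> \<in> aut_cylinder (Td d) (aut_of d [] \<sigma>) P {}"
        using aut_of_in_AutG[of "[]" d \<tau>] root_portraitsD[of \<tau>] root_portraitsD[OF \<sigma>C(1)] \<tau> P(2)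
        by (auto simp: aut_cylinder_def fst_aut_of subset_iff)
      then show "\<tau> \<in> ?S" using P(3) \<tau> by auto
    qed
    ultimately show "\<exists>T. openin (subtopology portraits root_portraits) T \<and> \<sigma> \<in> T \<and> T \<subseteq> ?S" by blast
  qed
qed

lemma aut_of_compose:
  assumes v: "v \<in> words {..<d}" and \<sigma>: "portrait d \<sigma>" and u: "u \<in> words {..<d}"
  shows "aut_of d v (\<lambda>_. id) \<otimes>\<^bsub>AutG (Td d)\<^esub> aut_of d u \<sigma> = aut_of d (lmul v u) \<sigma>"
proof -
  interpret group "AutG (Td d)" by (rule group_AutG_Td)
  have id: "portrait d (\<lambda>_. id)" by (rule portrait_const) simp
  note A1 = aut_of_in_AutG[OF v id] and A2 = aut_of_in_AutG[OF u \<sigma>]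
  have vu: "lmul v u \<in> words {..<d}" using lmul_in_words u v by blast
  show ?thesis
  proof (rule AutG_eqI_loc)
    show "fst (aut_of d v (\<lambda>_. id) \<otimes>\<^bsub>AutG (Td d)\<^esub> aut_of d u \<sigma>) [] = fst (aut_of d (lmul v u) \<sigma>) []"
      using AutG_mult_fst[OF A1 A2] fst_aut_of v u \<sigma> id vu build_id[OF u] by simp
    fix w assume w: "w \<in> words {..<d}"
    have "fst (aut_of d u \<sigma>) w \<in> words {..<d}" using AutG_in_words[OF A2 w] .
    then show "loc d (fst (aut_of d v (\<lambda>_. id) \<otimes>\<^bsub>AutG (Td d)\<^esub> aut_of d u \<sigma>)) w
        = loc d (fst (aut_of d (lmul v u) \<sigma>)) w"
      using loc_mult[OF A1 A2 w] loc_aut_of[OF v id] loc_aut_of[OF u \<sigma> w] loc_aut_of[OF vu \<sigma> w] by simp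
  qed (use A1 A2 aut_of_in_AutG[OF vu \<sigma>] in auto)
qed

text \<open>Left multiplications are products of left multiplications by letters, and they act transitively on the
vertices; modulo these every element of \<open>H\<close> fixes the root.\<close>
lemma H_compactly_generated:
  "compactly_generated (aut_subgroup (Td d) H) (aut_subtopology (Td d) H)"
proof -
  interpret group "AutG (Td d)" by (rule group_AutG_Td)
  let ?L = "\<lambda>v. aut_of d v (\<lambda>_. id)"
  let ?K = "aut_of d [] ` root_portraits \<union> (\<lambda>c. ?L [c]) ` {..<d}"
  let ?G = "aut_subgroup (Td d) H"
  have letter: "[c] \<in> words {..<d}" if "c < d" for c using that by (simp add: words_def)
  have K_H: "?K \<subseteq> H"
    using aut_of_in_H[of "[]"] root_portraitsD aut_of_const_in_H[OF letter F_id] by auto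
  have "compactin (subtopology portraits root_portraits) root_portraits"
    using root_portraits_compact by (simp add: compactin_subtopology)
  then have "compactin (aut_topology (Td d)) (aut_of d [] ` root_portraits)"
    using aut_of_continuous by (rule image_compactin)
  moreover have "compactin (aut_topology (Td d)) ((\<lambda>c. ?L [c]) ` {..<d})"
  proof (rule finite_imp_compactin)
    show "(\<lambda>c. ?L [c]) ` {..<d} \<subseteq> topspace (aut_topology (Td d))"
      using K_H H_AutG unfolding topspace_aut_topology by blast
  qed simp
  ultimately have "compactin (aut_subtopology (Td d) H) ?K"
    using K_H by (simp add: compactin_subtopology compactin_Un)
  moreover have "generate ?G ?K = carrier ?G"
  proof
    have "group ?G" by (rule subgroup.subgroup_is_group[OF H_subgroup group_AutG_Td])
    then show "generate ?G ?K \<subseteq> carrier ?G" using K_H by (intro group.generate_incl) auto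
    have L_gen: "?L v \<in> generate ?G ?K" if "v \<in> words {..<d}" for v
      using that
    proof (induction v rule: words_induct)
      case Nil
      have "?L [] = \<one>\<^bsub>?G\<^esub>"
        using aut_of_in_AutG[OF Nil_in_words portrait_const[OF permutes_id]] loc_one AutG_one_fst
          fst_aut_of[OF Nil_in_words portrait_const[OF permutes_id]]
          loc_aut_of[OF Nil_in_words portrait_const[OF permutes_id]]
        by (intro AutG_eqI_loc) auto
      then show ?case using generate.one[of ?G ?K] by metis
    next
      case (snoc v c)
      then have c: "c < d" "v \<in> words {..<d}" by (auto simp: words_snoc)
      have eq: "?L (v @ [c]) = ?L v \<otimes>\<^bsub>?G\<^esub> ?L [c]"
        using aut_of_compose[OF c(2) portrait_const[OF permutes_id] letter[OF c(1)]]
          nbr_snoc[OF snoc.hyps(2)] by (simp add: lmul_def)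
      have "?L [c] \<in> generate ?G ?K" using c by (intro generate.incl) auto
      then show ?case unfolding eq by (rule generate.eng[OF snoc.IH])
    qed
    show "carrier ?G \<subseteq> generate ?G ?K"
    proof
      fix h assume "h \<in> carrier ?G"
      then have h: "h \<in> H" by simp
      note hA = H_AutG[OF h]
      define \<sigma> where "\<sigma> = restrict (loc d (fst h)) (words {..<d})"
      have \<sigma>_eq: "\<sigma> w = loc d (fst h) w" if "w \<in> words {..<d}" for w
        using that by (simp add: \<sigma>_def)
      have p: "portrait d \<sigma>" using portrait_cong[OF AutG_portrait[OF hA] \<sigma>_eq] .
      have c: "compatible \<sigma>" using compatible_cong[of \<sigma>, OF \<sigma>_eq] H_compatible[OF h] by simp
      have "\<sigma> \<in> topspace portraits"
        using compatible_F[OF c] by (auto simp: topspace_portraits \<sigma>_def)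
      then have "aut_of d [] \<sigma> \<in> ?K" using p c by (auto simp: root_portraits_def)
      then have s: "aut_of d [] \<sigma> \<in> generate ?G ?K" by (rule generate.incl)
      have v: "fst h [] \<in> words {..<d}" using AutG_in_words[OF hA] by simp
      have "h = aut_of d (fst h []) \<sigma>"
        using loc_aut_of[OF v p] \<sigma>_eq fst_aut_of[OF v p] by (intro AutG_eqI_loc[OF hA aut_of_in_AutG[OF v p]]) auto
      also have "\<dots> = ?L (fst h []) \<otimes>\<^bsub>AutG (Td d)\<^esub> aut_of d [] \<sigma>"
        using aut_of_compose[OF v p Nil_in_words] by simp
      finally show "h \<in> generate ?G ?K"
        using generate.eng[OF L_gen[OF v] s] by simp
    qed
  qed
  ultimately show ?thesis unfolding compactly_generated_def by blast
qed

lemma length_proj: "length (proj w) \<le> length w"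
proof (induction w rule: rev_induct)
  case (snoc c w)
  have "length (label_step u c) \<le> Suc (length u)" for u
    by (auto simp: label_step_def nbr_def split: option.split)
  then show ?case using snoc by (metis Suc_le_mono le_trans length_append_singleton proj_snoc)
qed simp

lemma long_word:
  assumes "a \<in> labels" "b \<in> labels" "a \<noteq> b"
  shows "\<exists>u. u @ [a] \<in> words labels \<and> length u = n"
  using assms
proof (induction n arbitrary: a b)
  case 0
  then show ?case by (simp add: words_def)
next
  case (Suc n)
  then obtain u where u: "u @ [b] \<in> words labels" "length u = n" by metis
  then have "(u @ [b]) @ [a] \<in> words labels"
    using Suc.prems by (subst words_snoc) simp
  then show ?case using u(2) by (intro exI[of _ "u @ [b]"]) simp
qed

text \<open>Let the branch at \<open>u @ [a]\<close> be the set of words beginning with \<open>u @ [a]\<close>. The only edge that enters or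
leaves it has colour \<open>a\<close>.\<close>
lemma branch_boundary:
  assumes q: "q \<in> words K" and k: "k \<in> K"
    and ne: "(take (Suc n) (nbr q k) = u @ [a]) \<noteq> (take (Suc n) q = u @ [a])" and n: "length u = n"
  shows "k = a"
proof -
  have up: "k = a" if "(take (Suc n) (p @ [k]) = u @ [a]) \<noteq> (take (Suc n) p = u @ [a])" for p
  proof (cases "Suc n \<le> length p")
    case True
    then show ?thesis using that by simp
  next
    case False
    then have "take (Suc n) p \<noteq> u @ [a]" using n by (auto dest: arg_cong[of _ _ length])
    then have "p @ [k] = u @ [a]" using that False by simp
    then show ?thesis by simp
  qed
  from q k show ?thesis
  proof (cases rule: nbr_cases)
    case 1: up
    then show ?thesis using up[of q] ne by simp
  next
    case (down p)
    then show ?thesis using up[of p] ne by auto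
  qed
qed

text \<open>Apply \<open>f\<close> at all vertices that project into a branch of the label tree whose first edge has label \<open>a\<close>,
and the identity elsewhere. On the edges that lead into the branch the two prescriptions agree because
\<open>f\<close> fixes all colours of label \<open>a\<close>. If the branch starts at distance more than \<open>n\<close> from the root, the resulting
automorphism fixes all words of length at most \<open>n\<close>, as \<open>proj\<close> does not increase the length.\<close>
lemma H_not_discrete:
  assumes f: "f \<in> A" "f \<noteq> id" and a: "a \<in> labels" and b: "b \<in> labels" "a \<noteq> b"
    and fix_a: "\<And>c. c < d \<Longrightarrow> \<pi> c = Some a \<Longrightarrow> f c = c"
  shows "aut_subtopology (Td d) H \<noteq> discrete_topology H"
proof
  assume "aut_subtopology (Td d) H = discrete_topology H"
  moreover have one_H: "\<one>\<^bsub>AutG (Td d)\<^esub> \<in> H" by (rule subgroup.one_closed[OF H_subgroup])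
  ultimately have "openin (aut_subtopology (Td d) H) {\<one>\<^bsub>AutG (Td d)\<^esub>}" by simp
  then obtain U where U: "openin (aut_topology (Td d)) U" "{\<one>\<^bsub>AutG (Td d)\<^esub>} = U \<inter> H"
    by (auto simp: openin_subtopology)
  then obtain P where P: "finite P" "P \<subseteq> words {..<d}" "aut_cylinder (Td d) \<one>\<^bsub>AutG (Td d)\<^esub> P {} \<subseteq> U"
    unfolding openin_aut_topology_iff by blast
  define n where "n = Max (insert 0 (length ` P))"
  have n: "length x \<le> n" if "x \<in> P" for x using P(1) that by (auto simp: n_def)
  obtain u where u: "u @ [a] \<in> words labels" "length u = n" using long_word[OF a b] by blast
  define \<sigma> where "\<sigma> w = (if take (Suc n) (proj w) = u @ [a] then f else id)" for w
  have "portrait d \<sigma>"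
    unfolding portrait_def
  proof (intro conjI ballI allI impI)
    show "\<sigma> w permutes {..<d}" for w using A_permutes[OF f(1)] by (simp add: \<sigma>_def)
    fix w c assume w: "w @ [c] \<in> words {..<d}"
    then have c: "w \<in> words {..<d}" "c < d" by (auto simp: words_snoc)
    show "\<sigma> (w @ [c]) c = \<sigma> w c"
    proof (cases "\<sigma> (w @ [c]) = \<sigma> w")
      case False
      then have ne: "(take (Suc n) (label_step (proj w) c) = u @ [a]) \<noteq> (take (Suc n) (proj w) = u @ [a])"
        by (auto simp: \<sigma>_def proj_snoc)
      then obtain k where k: "\<pi> c = Some k" by (cases "\<pi> c") (auto simp: label_step_def)
      then have "k = a"
        using branch_boundary[OF proj_in_words[OF c(1)] label_in_labels[OF c(2) k] _ u(2)] ne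
        by (simp add: label_step_def)
      then show ?thesis using fix_a[OF c(2)] k by (simp add: \<sigma>_def)
    qed simp
  qed
  note p = this
  have "compatible \<sigma>"
    by (rule compatibleI[OF Z_id]) (auto simp: \<sigma>_def f A_id)
  then have gH: "aut_of d [] \<sigma> \<in> H" by (rule aut_of_in_H[OF Nil_in_words p])
  have "build [] \<sigma> x = x" if "x \<in> P" for x
  proof -
    have xw: "x \<in> words {..<d}" using P(2) that by blast
    have "build [] \<sigma> x = build [] (\<lambda>_. id) x"
    proof (rule build_cong[OF xw])
      fix m assume "m < length x"
      then have "length (proj (take m x)) < Suc n"
        using length_proj[of "take m x"] n[OF that] by simp
      then have "take (Suc n) (proj (take m x)) \<noteq> u @ [a]"
        using u(2) by (auto dest: arg_cong[of _ _ length])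
      then show "\<sigma> (take m x) = id" by (simp add: \<sigma>_def)
    qed
    then show ?thesis using build_id[OF xw] lmul_Nil1[OF xw] by simp
  qed
  then have "aut_of d [] \<sigma> \<in> aut_cylinder (Td d) \<one>\<^bsub>AutG (Td d)\<^esub> P {}"
    using aut_of_in_AutG[OF Nil_in_words p] fst_aut_of[OF Nil_in_words p] AutG_one_fst P(2)
    by (auto simp: aut_cylinder_def subset_iff)
  then have "aut_of d [] \<sigma> = \<one>\<^bsub>AutG (Td d)\<^esub>" using U(2) P(3) gH by blast
  \<comment> \<open>The branch is not empty: at the section of its first word the portrait is \<open>f\<close>.\<close>
  moreover have uw: "map label_rep (u @ [a]) \<in> words {..<d}" by (rule map_label_rep_in_words[OF u(1)])
  ultimately have "\<sigma> (map label_rep (u @ [a])) = id"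
    using loc_aut_of[OF Nil_in_words p uw] loc_one[OF uw] by simp
  moreover have "\<sigma> (map label_rep (u @ [a])) = f"
    using proj_map_label_rep[OF u(1)] u(2) by (simp add: \<sigma>_def del: map_append)
  ultimately show False using f(2) by simp
qed

lemma H_closed_nondiscrete_cg:
  assumes "f \<in> A" "f \<noteq> id" "a \<in> labels" "b \<in> labels" "a \<noteq> b"
    and "\<And>c. c < d \<Longrightarrow> \<pi> c = Some a \<Longrightarrow> f c = c"
  shows "closed_nondiscrete_cg_subgroup (Td d) H"
  unfolding closed_nondiscrete_cg_subgroup_def
  using H_subgroup H_closed H_not_discrete[OF assms] H_compactly_generated by blast

text \<open>Let \<open>g\<close> be the automorphism in question. As \<open>proj (g x) = proj x\<close>, an element \<open>k\<close> of \<open>H\<close> has the same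
local permutation at \<open>g x\<close> and \<open>x\<close>; so \<open>k\<close> commutes with \<open>g\<close> if and only if
\<open>k v = g (k [])\<close> and all local permutations of \<open>k\<close> commute with \<open>z\<close>. The latter all lie in one coset of \<open>A\<close>,
and \<open>A\<close> commutes with \<open>z\<close>; so it is enough to know that the local permutation at the root does.\<close>
lemma quasi_central_aut_of:
  assumes v: "v \<in> words {..<d}" "proj v = []" and z: "z \<in> Z"
  shows "quasi_central (Td d) H (aut_of d v (\<lambda>_. z))"
proof -
  let ?g = "aut_of d v (\<lambda>_. z)"
  have p: "portrait d (\<lambda>_. z)" by (rule portrait_const[OF Z_permutes[OF z]])
  note gA = aut_of_in_AutG[OF v(1) p]
  have gH: "?g \<in> H" using aut_of_const_in_H v z Z_sub_F by blast
  have proj_g: "proj (fst ?g x) = proj x" if "x \<in> words {..<d}" for x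
    using that
  proof (induction x rule: words_induct)
    case Nil
    then show ?case using fst_aut_of[OF v(1) p] v by simp
  next
    case (snoc x c)
    then have x: "x \<in> words {..<d}" "c < d" by (auto simp: words_snoc)
    have "fst ?g (x @ [c]) = nbr (fst ?g x) (z c)"
      using fst_aut_of[OF v(1) p] snoc.hyps x by simp
    moreover have "z c < d" using F_less Z_sub_F z x by blast
    ultimately have "proj (fst ?g (x @ [c])) = label_step (proj (fst ?g x)) (z c)"
      using proj_nbr[OF AutG_in_words[OF gA x(1)]] by simp
    then show ?case
      using snoc.IH Z_label[OF z x(2)] by (simp add: proj_snoc label_step_def)
  qed
  let ?C = "{k \<in> carrier (AutG (Td d)). fst k v = fst ?g (fst k []) \<and>
    loc d (fst k) [] \<circ> z = z \<circ> loc d (fst k) []}"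
  have "group_centralizer (aut_subgroup (Td d) H) ?g = ?C \<inter> H"
  proof (intro Set.set_eqI)
    fix k
    show "k \<in> group_centralizer (aut_subgroup (Td d) H) ?g \<longleftrightarrow> k \<in> ?C \<inter> H"
    proof (cases "k \<in> H")
      case False
      then show ?thesis by (simp add: group_centralizer_def)
    next
      case k: True
      interpret group "AutG (Td d)" by (rule group_AutG_Td)
      note kA = H_AutG[OF k]
      have kw: "fst k x \<in> words {..<d}" if "x \<in> words {..<d}" for x using AutG_in_words[OF kA that] .
      have loc1: "loc d (fst (k \<otimes>\<^bsub>AutG (Td d)\<^esub> ?g)) x = loc d (fst k) x \<circ> z" if x: "x \<in> words {..<d}" for x
        using loc_mult[OF kA gA x] loc_aut_of[OF v(1) p x]
          compatible_proj[OF H_compatible[OF k] AutG_in_words[OF gA x] x proj_g[OF x]] by simp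
      have loc2: "loc d (fst (?g \<otimes>\<^bsub>AutG (Td d)\<^esub> k)) x = z \<circ> loc d (fst k) x" if x: "x \<in> words {..<d}" for x
        using loc_mult[OF gA kA x] loc_aut_of[OF v(1) p kw[OF x]] by simp
      have root: "fst (k \<otimes>\<^bsub>AutG (Td d)\<^esub> ?g) [] = fst k v"
        "fst (?g \<otimes>\<^bsub>AutG (Td d)\<^esub> k) [] = fst ?g (fst k [])"
        using AutG_mult_fst[OF kA gA] AutG_mult_fst[OF gA kA] fst_aut_of[OF v(1) p] by simp_all
      \<comment> \<open>One coset of \<open>A\<close> contains all local permutations of \<open>k\<close>, and \<open>A\<close> commutes with \<open>z\<close>.\<close>
      have spread: "loc d (fst k) x \<circ> z = z \<circ> loc d (fst k) x"
        if 0: "loc d (fst k) [] \<circ> z = z \<circ> loc d (fst k) []" and x: "x \<in> words {..<d}" for x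
      proof -
        obtain y where y: "y \<in> Z" "\<And>x. x \<in> words {..<d} \<Longrightarrow> \<exists>a \<in> A. loc d (fst k) x = a \<circ> y"
          using H_compatible[OF k] by (rule compatibleE) blast
        obtain a b where a: "a \<in> A" "loc d (fst k) [] = a \<circ> y" and b: "b \<in> A" "loc d (fst k) x = b \<circ> y"
          using y(2)[OF Nil_in_words] y(2)[OF x] by blast
        have "a \<circ> (y \<circ> z) = a \<circ> (z \<circ> y)"
          using 0 a(2) commute[OF a(1) z] by (metis comp_assoc)
        then have "y \<circ> z = z \<circ> y"
          using permutes_inv_o(2)[OF A_permutes[OF a(1)]] by (metis comp_assoc id_comp)
        then show ?thesis using b(2) commute[OF b(1) z] by (metis comp_assoc)
      qed
      have "k \<otimes>\<^bsub>AutG (Td d)\<^esub> ?g = ?g \<otimes>\<^bsub>AutG (Td d)\<^esub> k \<longleftrightarrow> k \<in> ?C"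
      proof
        assume "k \<otimes>\<^bsub>AutG (Td d)\<^esub> ?g = ?g \<otimes>\<^bsub>AutG (Td d)\<^esub> k"
        then show "k \<in> ?C" using root loc1[OF Nil_in_words] loc2[OF Nil_in_words] kA by simp
      next
        assume C: "k \<in> ?C"
        show "k \<otimes>\<^bsub>AutG (Td d)\<^esub> ?g = ?g \<otimes>\<^bsub>AutG (Td d)\<^esub> k"
        proof (rule AutG_eqI_loc[OF m_closed[OF kA gA] m_closed[OF gA kA]])
          show "fst (k \<otimes>\<^bsub>AutG (Td d)\<^esub> ?g) [] = fst (?g \<otimes>\<^bsub>AutG (Td d)\<^esub> k) []" using C root by simp
          show "loc d (fst (k \<otimes>\<^bsub>AutG (Td d)\<^esub> ?g)) x = loc d (fst (?g \<otimes>\<^bsub>AutG (Td d)\<^esub> k)) x"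
            if x: "x \<in> words {..<d}" for x
            using spread[OF _ x] loc1[OF x] loc2[OF x] C by simp
        qed
      qed
      then show ?thesis using k by (simp add: group_centralizer_def)
    qed
  qed
  moreover have "openin (aut_topology (Td d)) ?C"
    unfolding openin_aut_topology_iff
  proof (intro conjI ballI)
    fix k assume k: "k \<in> ?C"
    let ?P = "insert v (nbhd d [])"
    have "h \<in> ?C" if h: "h \<in> aut_cylinder (Td d) k ?P {}" for h
    proof -
      have "loc d (fst h) [] = loc d (fst k) []"
        by (rule loc_cong) (use h in \<open>auto simp: aut_cylinder_def\<close>)
      moreover have "fst h v = fst k v" "fst h [] = fst k []"
        using h by (auto simp: aut_cylinder_def nbhd_def)
      ultimately show ?thesis using h k by (simp add: aut_cylinder_def)
    qed
    moreover have "finite ?P" "?P \<subseteq> words {..<d}" using v finite_nbhd nbhd_sub[of "[]"] by auto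
    ultimately show "\<exists>P. finite P \<and> P \<subseteq> words {..<d} \<and> aut_cylinder (Td d) k P {} \<subseteq> ?C"
      by (intro exI[of _ ?P]) blast
  qed blast
  ultimately show ?thesis
    using gH unfolding quasi_central_def quasi_center_def by (auto simp: openin_subtopology)
qed

end

section \<open>The local action\<close>

definition colour :: "'k list \<Rightarrow> 'k list \<Rightarrow> 'k" where
  "colour x y = (THE c. nbr x c = y)"

lemma colour_nbr [simp]: "colour x (nbr x c) = c"
  by (simp add: colour_def)

text \<open>The permutation of the star of \<open>x\<close> that corresponds to the permutation \<open>f\<close> of the colours.\<close>
definition star_perm :: "nat \<Rightarrow> nat list \<Rightarrow> (nat \<Rightarrow> nat) \<Rightarrow> nat list \<times> nat list \<Rightarrow> nat list \<times> nat list" where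
  "star_perm d x f = (\<lambda>e \<in> star (Td d) x. (x, nbr x (f (colour x (snd e)))))"

lemma star_Td: "x \<in> words {..<d} \<Longrightarrow> star (Td d) x = (\<lambda>c. (x, nbr x c)) ` {..<d}"
  by (auto simp: star_def edges_Td Td_simps(3))

lemma star_perm_apply:
  "x \<in> words {..<d} \<Longrightarrow> c < d \<Longrightarrow> star_perm d x f (x, nbr x c) = (x, nbr x (f c))"
  by (simp add: star_perm_def star_Td)

lemma star_perm_eqI:
  assumes "x \<in> words {..<d}" "\<phi> \<in> extensional (star (Td d) x)"
    and "\<And>c. c < d \<Longrightarrow> \<phi> (x, nbr x c) = (x, nbr x (f c))"
  shows "\<phi> = star_perm d x f"
proof (rule extensionalityI[OF assms(2)])
  show "star_perm d x f \<in> extensional (star (Td d) x)" by (simp add: star_perm_def)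
  show "\<phi> e = star_perm d x f e" if "e \<in> star (Td d) x" for e
    using that assms star_perm_apply by (auto simp: star_Td)
qed

lemma star_perm_Bij:
  assumes "x \<in> words {..<d}" "f permutes {..<d}"
  shows "star_perm d x f \<in> Bij (star (Td d) x)"
proof -
  have f: "f c < d \<longleftrightarrow> c < d" for c using permutes_in_image[OF assms(2), of c] by simp
  have "inj_on (star_perm d x f) (star (Td d) x)"
  proof (rule inj_onI)
    fix e e' assume e: "e \<in> star (Td d) x" "e' \<in> star (Td d) x" "star_perm d x f e = star_perm d x f e'"
    then obtain c c' where c: "e = (x, nbr x c)" "e' = (x, nbr x c')" "c < d" "c' < d"
      using assms(1) by (auto simp: star_Td)
    then have "f c = f c'" using e(3) star_perm_apply[OF assms(1)] by simp
    then show "e = e'" using c permutes_inj[OF assms(2)] by (auto dest: injD)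
  qed
  moreover have "star_perm d x f ` star (Td d) x = star (Td d) x"
  proof
    show "star_perm d x f ` star (Td d) x \<subseteq> star (Td d) x"
      using star_perm_apply[OF assms(1)] f by (auto simp: star_Td[OF assms(1)])
    show "star (Td d) x \<subseteq> star_perm d x f ` star (Td d) x"
    proof
      fix e assume "e \<in> star (Td d) x"
      then obtain c where c: "e = (x, nbr x c)" "c < d" using assms(1) by (auto simp: star_Td)
      obtain c' where "c' < d" "f c' = c" using permutes_image[OF assms(2)] c(2) by (metis imageE lessThan_iff)
      then show "e \<in> star_perm d x f ` star (Td d) x"
        using c star_perm_apply[OF assms(1), of c' f] star_Td[OF assms(1)] by (metis imageI lessThan_iff)
    qed
  qed
  ultimately show ?thesis by (simp add: Bij_def bij_betw_def star_perm_def)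
qed

lemma star_perm_mult:
  assumes "x \<in> words {..<d}" "f permutes {..<d}" "g permutes {..<d}"
  shows "star_perm d x f \<otimes>\<^bsub>BijGroup (star (Td d) x)\<^esub> star_perm d x g = star_perm d x (f \<circ> g)"
proof -
  have g: "g c < d \<longleftrightarrow> c < d" for c using permutes_in_image[OF assms(3), of c] by simp
  have "star_perm d x f \<otimes>\<^bsub>BijGroup (star (Td d) x)\<^esub> star_perm d x g
      = compose (star (Td d) x) (star_perm d x f) (star_perm d x g)"
    using star_perm_Bij assms by (simp add: BijGroup_def)
  also have "\<dots> = star_perm d x (f \<circ> g)"
    by (rule star_perm_eqI) (use assms g in \<open>auto simp: compose_eq star_perm_apply star_Td\<close>)
  finally show ?thesis .
qed

lemma star_perm_id: "x \<in> words {..<d} \<Longrightarrow> star_perm d x id = \<one>\<^bsub>BijGroup (star (Td d) x)\<^esub>"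
  by (rule star_perm_eqI[symmetric]) (auto simp: BijGroup_def star_Td)

definition transitive_perms :: "'a set \<Rightarrow> ('a \<Rightarrow> 'a) set \<Rightarrow> bool" where
  "transitive_perms S M \<longleftrightarrow> (\<forall>a \<in> S. \<forall>b \<in> S. \<exists>f \<in> M. f a = b)"

lemma transitive_star_perm:
  assumes "x \<in> words {..<d}" "\<And>f. f \<in> M \<Longrightarrow> f permutes {..<d}"
  shows "perm_transitive (star (Td d) x) (star_perm d x ` M) \<longleftrightarrow> transitive_perms {..<d} M"
proof -
  have "orbit (perm_group (star (Td d) x) (star_perm d x ` M)) (\<lambda>p. p) (x, nbr x c)
      = (\<lambda>f. (x, nbr x (f c))) ` M" if "c < d" for c
  proof -
    have "orbit (perm_group (star (Td d) x) (star_perm d x ` M)) (\<lambda>p. p) (x, nbr x c)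
        = (\<lambda>p. p (x, nbr x c)) ` star_perm d x ` M" by (auto simp: orbit_def)
    then show ?thesis using star_perm_apply[OF assms(1) that] by (simp add: image_image)
  qed
  moreover have "(\<forall>e \<in> star (Td d) x. P e) \<longleftrightarrow> (\<forall>c < d. P (x, nbr x c))" for P
    using assms(1) by (auto simp: star_Td)
  ultimately have "perm_transitive (star (Td d) x) (star_perm d x ` M) \<longleftrightarrow>
      (\<forall>c < d. (\<lambda>f. (x, nbr x (f c))) ` M = star (Td d) x)"
    unfolding perm_transitive_def by simp
  also have "\<dots> \<longleftrightarrow> (\<forall>c < d. (\<lambda>f. (x, nbr x (f c))) ` M = (\<lambda>c. (x, nbr x c)) ` {..<d})"
    using assms(1) by (simp add: star_Td)
  also have "\<dots> \<longleftrightarrow> (\<forall>c < d. (\<lambda>f. f c) ` M = {..<d})"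
  proof -
    have "(\<lambda>f. (x, nbr x (f c))) ` M = (\<lambda>c. (x, nbr x c)) ` {..<d} \<longleftrightarrow> (\<lambda>f. f c) ` M = {..<d}" for c
      using inj_image_eq_iff[of "\<lambda>c. (x, nbr x c)" "(\<lambda>f. f c) ` M" "{..<d}"]
      by (simp add: inj_def image_image)
    then show ?thesis by simp
  qed
  also have "\<dots> \<longleftrightarrow> transitive_perms {..<d} M"
  proof -
    have "(\<lambda>f. f c) ` M = {..<d} \<longleftrightarrow> (\<forall>b < d. \<exists>f \<in> M. f c = b)" if "c < d" for c
    proof -
      have "f c \<in> {..<d}" if "f \<in> M" for f
        using permutes_in_image[OF assms(2)[OF that], of c] \<open>c < d\<close> by simp
      then have "(\<lambda>f. f c) ` M \<subseteq> {..<d}" by blast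
      then have "(\<lambda>f. f c) ` M = {..<d} \<longleftrightarrow> {..<d} \<subseteq> (\<lambda>f. f c) ` M" by blast
      also have "\<dots> \<longleftrightarrow> (\<forall>b < d. \<exists>f \<in> M. f c = b)" by (auto simp: subset_iff image_iff eq_commute)
      finally show ?thesis .
    qed
    then show ?thesis by (auto simp: transitive_perms_def)
  qed
  finally show ?thesis .
qed

text \<open>Normality for sets of permutations under composition, where no extensionality outside of the permuted
set intervenes.\<close>
definition normal_perms :: "('a \<Rightarrow> 'a) set \<Rightarrow> ('a \<Rightarrow> 'a) set \<Rightarrow> bool" where
  "normal_perms M F \<longleftrightarrow> M \<subseteq> F \<and> id \<in> M \<and> (\<forall>f \<in> M. \<forall>g \<in> M. f \<circ> g \<in> M) \<and>
     (\<forall>f \<in> M. inv_into UNIV f \<in> M) \<and> (\<forall>f \<in> F. \<forall>m \<in> M. f \<circ> m \<circ> inv_into UNIV f \<in> M)"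

text \<open>Identifying the star of \<open>x\<close> with the set of colours turns normal subgroups of the local action into
normal subgroups of \<open>F\<close>.\<close>
lemma normal_star_perm:
  assumes x: "x \<in> words {..<d}" and F: "permutations_group {..<d} F"
    and N: "N \<lhd> perm_group (star (Td d) x) (star_perm d x ` F)"
  obtains M where "normal_perms M F" "N = star_perm d x ` M"
proof -
  let ?G = "perm_group (star (Td d) x) (star_perm d x ` F)"
  interpret normal N ?G by (rule N)
  have perm: "f permutes {..<d}" if "f \<in> F" for f using F that by (simp add: permutations_group_def)
  define M where "M = {f \<in> F. star_perm d x f \<in> N}"
  have mult: "star_perm d x f \<otimes>\<^bsub>?G\<^esub> star_perm d x g = star_perm d x (f \<circ> g)" if "f \<in> F" "g \<in> F" for f g
    using star_perm_mult[OF x perm[OF that(1)] perm[OF that(2)]] by simp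
  have one: "star_perm d x id = \<one>\<^bsub>?G\<^esub>" using star_perm_id[OF x] by simp
  have inv: "inv\<^bsub>?G\<^esub> star_perm d x f = star_perm d x (inv_into UNIV f)" and invF: "inv_into UNIV f \<in> F"
    if f: "f \<in> F" for f
  proof -
    show i: "inv_into UNIV f \<in> F" using F f by (simp add: permutations_group_def)
    show "inv\<^bsub>?G\<^esub> star_perm d x f = star_perm d x (inv_into UNIV f)"
    proof (rule inv_equality)
      show "star_perm d x (inv_into UNIV f) \<otimes>\<^bsub>?G\<^esub> star_perm d x f = \<one>\<^bsub>?G\<^esub>"
        using mult[OF i f] permutes_inv_o(2)[OF perm[OF f]] one by simp
    qed (use f i in auto)
  qed
  have "normal_perms M F"
    unfolding normal_perms_def
  proof (intro conjI ballI)
    show "M \<subseteq> F" by (auto simp: M_def)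
    show "id \<in> M" unfolding M_def mem_Collect_eq one
      using subgroup.one_closed[OF normal_imp_subgroup[OF N]] F by (simp add: permutations_group_def)
  next
    fix f g assume "f \<in> M" "g \<in> M"
    then show "f \<circ> g \<in> M"
      using mult[of f g] F
        subgroup.m_closed[OF normal_imp_subgroup[OF N], of "star_perm d x f" "star_perm d x g"]
      by (simp add: M_def permutations_group_def)
  next
    fix f assume "f \<in> M"
    then show "inv_into UNIV f \<in> M"
      using inv[of f] invF[of f] m_inv_closed[of "star_perm d x f"] by (simp add: M_def)
  next
    fix f m assume f: "f \<in> F" and m: "m \<in> M"
    then have fm: "f \<circ> m \<in> F" "m \<in> F" using F by (auto simp: M_def permutations_group_def)
    have "star_perm d x f \<otimes>\<^bsub>?G\<^esub> star_perm d x m \<otimes>\<^bsub>?G\<^esub> inv\<^bsub>?G\<^esub> star_perm d x f \<in> N"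
      by (rule inv_op_closed2) (use f m in \<open>auto simp: M_def\<close>)
    then have "star_perm d x (f \<circ> m \<circ> inv_into UNIV f) \<in> N"
      using mult[OF f fm(2)] mult[OF fm(1) invF[OF f]] inv[OF f] by simp
    moreover have "f \<circ> m \<circ> inv_into UNIV f \<in> F" using fm(1) invF[OF f] F by (auto simp: permutations_group_def)
    ultimately show "f \<circ> m \<circ> inv_into UNIV f \<in> M" by (simp add: M_def)
  qed
  moreover have "N = star_perm d x ` M" using subset by (auto simp: M_def)
  ultimately show thesis by (rule that)
qed

lemma semiregular_star_perm:
  assumes x: "x \<in> words {..<d}" and M: "\<And>f. f \<in> M \<Longrightarrow> f permutes {..<d}" "id \<in> M"
    and fixfree: "\<And>f c. f \<in> M \<Longrightarrow> c < d \<Longrightarrow> f c = c \<Longrightarrow> f = id"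
  shows "perm_semiregular (star (Td d) x) (star_perm d x ` M)"
  unfolding perm_semiregular_def
proof
  fix e assume "e \<in> star (Td d) x"
  then obtain c where c: "e = (x, nbr x c)" "c < d" using x by (auto simp: star_Td)
  have "star_perm d x f e = e \<longleftrightarrow> f = id" if "f \<in> M" for f
    using star_perm_apply[OF x c(2), of f] fixfree[OF that c(2)] c(1) by auto
  then have "stabilizer (perm_group (star (Td d) x) (star_perm d x ` M)) (\<lambda>p. p) e = {star_perm d x id}"
    using M(2) by (auto simp: stabilizer_def)
  then show "stabilizer (perm_group (star (Td d) x) (star_perm d x ` M)) (\<lambda>p. p) e =
      {\<one>\<^bsub>perm_group (star (Td d) x) (star_perm d x ` M)\<^esub>}"
    using star_perm_id[OF x] by simp
qed

context label_action
begin

text \<open>For \<open>f \<in> F\<close> the automorphism with constant portrait \<open>f\<close> that fixes the root need not fix \<open>x\<close>, but a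
left multiplication, which has trivial portrait, brings the image of \<open>x\<close> back to \<open>x\<close>.\<close>
lemma local_action_H:
  assumes x: "x \<in> words {..<d}"
  shows "local_action (Td d) H x = star_perm d x ` F"
proof -
  interpret group "AutG (Td d)" by (rule group_AutG_Td)
  have eq: "restrict (snd g) (star (Td d) x) = star_perm d x (loc d (fst g) x)"
    if g: "g \<in> H" "fst g x = x" for g
  proof (rule star_perm_eqI[OF x])
    fix c assume c: "c < d"
    have "(x, nbr x c) \<in> edges (Td d)" using x c by (auto simp: edges_Td)
    then show "restrict (snd g) (star (Td d) x) (x, nbr x c) = (x, nbr x (loc d (fst g) x c))"
      using c x AutG_snd[OF H_AutG[OF g(1)]] AutG_nbr[OF H_AutG[OF g(1)] x c] g(2) by (simp add: star_Td)
  qed simp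
  show ?thesis
  proof
    show "local_action (Td d) H x \<subseteq> star_perm d x ` F"
    proof
      fix p assume "p \<in> local_action (Td d) H x"
      then obtain g where g: "g \<in> H" "fst g x = x" "p = restrict (snd g) (star (Td d) x)"
        unfolding local_action_def stabilizer_def by auto
      show "p \<in> star_perm d x ` F"
        unfolding g(3) eq[OF g(1,2)] using compatible_F[OF H_compatible[OF g(1)] x] by (rule imageI)
    qed
    show "star_perm d x ` F \<subseteq> local_action (Td d) H x"
    proof clarify
      fix f assume f: "f \<in> F"
      let ?a = "aut_of d [] (\<lambda>_. f)"
      have a: "?a \<in> H" using aut_of_const_in_H f by simp
      define y where "y = fst ?a x"
      have y: "y \<in> words {..<d}" unfolding y_def by (rule AutG_in_words[OF H_AutG[OF a] x])
      \<comment> \<open>Left multiplication by \<open>x \<cdot> y\<close> inverse takes \<open>y\<close> to \<open>x\<close>.\<close>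
      define v where "v = lmul x (rev y)"
      have v: "v \<in> words {..<d}" using x y by (simp add: v_def lmul_in_words)
      have vy: "lmul v y = x"
        using x y lmul_assoc[of x "{..<d}" "rev y" y] lmul_rev[of "rev y"] by (simp add: v_def)
      let ?t = "aut_of d v (\<lambda>_. id)"
      have t: "?t \<in> H" using aut_of_const_in_H[OF v F_id] .
      have p: "portrait d (\<lambda>_. id)" by (rule portrait_const) simp
      let ?g = "?t \<otimes>\<^bsub>AutG (Td d)\<^esub> ?a"
      have g: "?g \<in> H" by (rule subgroup.m_closed[OF H_subgroup t a])
      have "fst ?g x = x"
        using AutG_mult_fst[OF H_AutG[OF t] H_AutG[OF a] x] fst_aut_of[OF v p y] build_id[OF y] vy
        by (simp add: y_def)
      moreover have "loc d (fst ?g) x = f"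
        using loc_mult[OF H_AutG[OF t] H_AutG[OF a] x] loc_aut_of[OF v p y]
          loc_aut_of[OF Nil_in_words portrait_const[OF F_permutes[OF f]] x] by (simp add: y_def)
      ultimately have r: "star_perm d x f = restrict (snd ?g) (star (Td d) x)"
        and s: "?g \<in> stabilizer (aut_subgroup (Td d) H) fst x"
        using eq[OF g] g by (simp_all add: stabilizer_def)
      show "star_perm d x f \<in> local_action (Td d) H x"
        unfolding local_action_def r using s by (rule imageI)
    qed
  qed
qed

lemma locally_transitive_iff:
  "locally_acts perm_transitive (Td d) H \<longleftrightarrow> transitive_perms {..<d} F"
  "locally_acts perm_intransitive (Td d) H \<longleftrightarrow> \<not> transitive_perms {..<d} F"
proof -
  have ne: "\<exists>x. x \<in> words {..<d}" using Nil_in_words by blast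
  show "locally_acts perm_transitive (Td d) H \<longleftrightarrow> transitive_perms {..<d} F"
    "locally_acts perm_intransitive (Td d) H \<longleftrightarrow> \<not> transitive_perms {..<d} F"
    using ne transitive_star_perm[OF _ F_permutes]
    by (simp_all add: locally_acts_def local_action_H perm_intransitive_def)
qed

lemma locally_quasiprimitiveI:
  assumes "transitive_perms {..<d} F"
    and "\<And>M. normal_perms M F \<Longrightarrow> M \<noteq> {id} \<Longrightarrow> transitive_perms {..<d} M"
  shows "locally_acts perm_quasiprimitive (Td d) H"
  unfolding locally_acts_def
proof
  fix x assume "x \<in> verts (Td d)"
  then have x: "x \<in> words {..<d}" by simp
  show "perm_quasiprimitive (star (Td d) x) (local_action (Td d) H x)"
    unfolding perm_quasiprimitive_def local_action_H[OF x]
  proof (intro conjI allI impI)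
    show "perm_transitive (star (Td d) x) (star_perm d x ` F)"
      using assms(1) transitive_star_perm[OF x F_permutes] by blast
    fix N assume N: "N \<lhd> perm_group (star (Td d) x) (star_perm d x ` F) \<and>
      N \<noteq> {\<one>\<^bsub>perm_group (star (Td d) x) (star_perm d x ` F)\<^esub>}"
    then obtain M where M: "normal_perms M F" "N = star_perm d x ` M"
      using normal_star_perm[OF x F_group] by blast
    then have "M \<noteq> {id}" using N star_perm_id[OF x] by auto
    then have "transitive_perms {..<d} M" by (rule assms(2)[OF M(1)])
    moreover have "f permutes {..<d}" if "f \<in> M" for f
      using M(1) that F_permutes by (auto simp: normal_perms_def)
    ultimately show "perm_transitive (star (Td d) x) N"
      using transitive_star_perm[OF x, of M] M(2) by simp
  qed
qed

lemma locally_semiprimitiveI: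
  assumes "transitive_perms {..<d} F"
    and "\<And>M. normal_perms M F \<Longrightarrow>
      transitive_perms {..<d} M \<or> (\<forall>f \<in> M. \<forall>c < d. f c = c \<longrightarrow> f = id)"
  shows "locally_acts perm_semiprimitive (Td d) H"
  unfolding locally_acts_def
proof
  fix x assume "x \<in> verts (Td d)"
  then have x: "x \<in> words {..<d}" by simp
  show "perm_semiprimitive (star (Td d) x) (local_action (Td d) H x)"
    unfolding perm_semiprimitive_def local_action_H[OF x]
  proof (intro conjI allI impI)
    show "perm_transitive (star (Td d) x) (star_perm d x ` F)"
      using assms(1) transitive_star_perm[OF x F_permutes] by blast
    fix N assume N: "N \<lhd> perm_group (star (Td d) x) (star_perm d x ` F)"
    then obtain M where M: "normal_perms M F" "N = star_perm d x ` M"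
      using normal_star_perm[OF x F_group] by blast
    have perm: "f permutes {..<d}" if "f \<in> M" for f
      using M(1) that F_permutes by (auto simp: normal_perms_def)
    have id: "id \<in> M" using M(1) by (simp add: normal_perms_def)
    from assms(2)[OF M(1)]
    show "perm_transitive (star (Td d) x) N \<or> perm_semiregular (star (Td d) x) N"
    proof
      assume "transitive_perms {..<d} M"
      then show ?thesis using transitive_star_perm[OF x perm] M(2) by simp
    next
      assume "\<forall>f \<in> M. \<forall>c < d. f c = c \<longrightarrow> f = id"
      then show ?thesis using semiregular_star_perm[OF x perm id] M(2) by simp
    qed
  qed
qed

end

section \<open>Distances and translation lengths\<close>

text \<open>Word length modulo two is a proper 2-colouring of the vertices. Most lower bounds on displacements below
come from it.\<close>
lemma walk_Td_parity:
  "walk (Td d) x es y \<Longrightarrow> even (length es) \<longleftrightarrow> (even (length x) \<longleftrightarrow> even (length y))"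
proof (induction es arbitrary: x)
  case (Cons e es)
  then obtain c where c: "e = (x, nbr x c)" by (auto simp: star_def edges_Td Td_simps(3))
  then have "walk (Td d) (nbr x c) es y" using Cons.prems by (simp add: Td_simps(5))
  then show ?case using Cons.IH even_length_nbr[of x c] by auto
qed simp

lemma gdist_walk:
  assumes "x \<in> words {..<d}" "y \<in> words {..<d}"
  obtains es where "walk (Td d) x es y" "length es = gdist (Td d) x y"
proof -
  have "\<forall>x \<in> verts (Td d). \<forall>y \<in> verts (Td d). \<exists>es. walk (Td d) x es y"
    using regular_tree_Td[of d] unfolding regular_tree_def by blast
  then have "\<exists>es. walk (Td d) x es y" using assms by simp
  then have "\<exists>n es. walk (Td d) x es y \<and> length es = n" by blast
  from LeastI_ex[OF this] show thesis using that by (auto simp: gdist_def)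
qed

lemma gdist_le: "walk T x es y \<Longrightarrow> gdist T x y \<le> length es"
  unfolding gdist_def by (rule Least_le) blast

lemma gdist_parity:
  assumes "x \<in> words {..<d}" "y \<in> words {..<d}"
  shows "even (gdist (Td d) x y) \<longleftrightarrow> (even (length x) \<longleftrightarrow> even (length y))"
  using gdist_walk[OF assms] walk_Td_parity by metis

lemma gdist_eq_0D:
  assumes "x \<in> words {..<d}" "y \<in> words {..<d}" "gdist (Td d) x y = 0"
  shows "x = y"
  using gdist_walk[OF assms(1,2)] assms(3) by (metis length_0_conv walk.simps(1))

lemma gdist_eq_1D:
  assumes "x \<in> words {..<d}" "y \<in> words {..<d}" "gdist (Td d) x y = 1"
  obtains c where "c < d" "y = nbr x c"
proof -
  obtain es where es: "walk (Td d) x es y" "length es = 1" using gdist_walk[OF assms(1,2)] assms(3) by metis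
  then obtain e where "es = [e]" by (cases es) auto
  then show thesis using es that by (auto simp: star_def edges_Td Td_simps(3,5))
qed

lemma walk_nbr:
  "x \<in> words {..<d} \<Longrightarrow> c < d \<Longrightarrow> walk (Td d) x [(x, nbr x c)] (nbr x c)"
  by (auto simp: star_Td Td_simps(5) nbr_in_words)

lemma gdist_nbr:
  assumes "x \<in> words {..<d}" "c < d"
  shows "gdist (Td d) x (nbr x c) = 1"
proof -
  have "odd (gdist (Td d) x (nbr x c))"
    using gdist_parity[OF assms(1) nbr_in_words[OF assms(1)], of c] assms(2) even_length_nbr[of x c] by simp
  moreover have "gdist (Td d) x (nbr x c) \<le> 1" using gdist_le[OF walk_nbr[OF assms]] by simp
  ultimately show ?thesis by (cases "gdist (Td d) x (nbr x c)") auto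
qed

lemma gdist_nbr_nbr:
  assumes "x \<in> words {..<d}" "c < d" "c' < d" "c \<noteq> c'"
  shows "gdist (Td d) x (nbr (nbr x c) c') = 2"
proof -
  let ?y = "nbr (nbr x c) c'"
  have n: "nbr x c \<in> words {..<d}" using assms by (simp add: nbr_in_words)
  then have y: "?y \<in> words {..<d}" using assms by (simp add: nbr_in_words)
  have "walk (Td d) x [(x, nbr x c), (nbr x c, ?y)] ?y"
    using walk_append[OF walk_nbr[OF assms(1,2)] walk_nbr[OF n assms(3)]] y by simp
  then have "gdist (Td d) x ?y \<le> 2" using gdist_le by fastforce
  moreover have "even (gdist (Td d) x ?y)"
    using gdist_parity[OF assms(1) y] even_length_nbr[of x c] even_length_nbr[of "nbr x c" c'] by simp
  moreover have "gdist (Td d) x ?y \<noteq> 0"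
    using gdist_eq_0D[OF assms(1) y] nbr_inverse_imp[of x c c'] assms(4) by metis
  ultimately show ?thesis by presburger
qed

lemma translation_length_eqI:
  assumes "x \<in> verts T" "gdist T x (fst g x) = n" "\<And>y. y \<in> verts T \<Longrightarrow> n \<le> gdist T y (fst g y)"
  shows "translation_length T g = n"
  unfolding translation_length_def by (rule Least_equality) (use assms in auto)

lemma build_parity:
  "w \<in> words K \<Longrightarrow> even (length (build v \<sigma> w)) \<longleftrightarrow> (even (length v) \<longleftrightarrow> even (length w))"
  by (induction w rule: words_induct) (auto simp: even_length_nbr)

text \<open>The words \<open>a b a b \<dots>\<close>, which lie on the axis of the hyperbolic elements below.\<close>
fun zigzag :: "'k \<Rightarrow> 'k \<Rightarrow> nat \<Rightarrow> 'k list" where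
  "zigzag a b 0 = []"
| "zigzag a b (Suc n) = zigzag a b n @ [if even n then a else b]"

lemma length_zigzag [simp]: "length (zigzag a b n) = n"
  by (induction n) auto

lemma nbr_zigzag: "a \<noteq> b \<Longrightarrow> nbr (zigzag a b n) (if even n then a else b) = zigzag a b (Suc n)"
  by (cases n) (auto simp: nbr_def)

lemma zigzag_in_words: "a \<in> K \<Longrightarrow> b \<in> K \<Longrightarrow> a \<noteq> b \<Longrightarrow> zigzag a b n \<in> words K"
proof (induction n)
  case (Suc n)
  then show ?case using nbr_zigzag[of a b n] nbr_in_words[of "zigzag a b n" K "if even n then a else b"] by simp
qed simp

lemma hyperbolicI:
  assumes T: "\<And>w. w \<in> words {..<d} \<Longrightarrow> n \<le> gdist (Td d) w (fst g w)" and "n > 0"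
    and ab: "a < d" "b < d" "a \<noteq> b"
    and axis: "\<And>m. gdist (Td d) (zigzag a b m) (fst g (zigzag a b m)) = n"
  shows "hyperbolic_of_length (Td d) n g"
proof -
  have zw: "zigzag a b m \<in> words {..<d}" for m using ab by (simp add: zigzag_in_words)
  have tl: "translation_length (Td d) g = n"
    by (rule translation_length_eqI[of "zigzag a b 0"]) (use T axis[of 0] in auto)
  have "range (zigzag a b) \<subseteq> min_displacement_set (Td d) g"
    using axis zw tl by (auto simp: min_displacement_set_def)
  moreover have "inj (zigzag a b)" by (rule injI) (metis length_zigzag)
  then have "infinite (range (zigzag a b))" by (simp add: finite_image_iff)
  ultimately have "infinite (min_displacement_set (Td d) g)" using finite_subset by blast
  then show ?thesis using tl assms(2) by (simp add: hyperbolic_of_length_def)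
qed

text \<open>All displacements are odd, and the automorphism shifts the zigzag by one step: \<open>\<tau>\<close> exchanges its two
letters, which restores the alternation after the letter \<open>a\<close> has been put in front.\<close>
lemma hyperbolic_length_1:
  assumes \<tau>: "\<tau> permutes {..<d}" and ab: "a < d" "b < d" "a \<noteq> b" "\<tau> a = b" "\<tau> b = a"
  shows "hyperbolic_of_length (Td d) 1 (aut_of d [a] (\<lambda>_. \<tau>))"
proof -
  have p: "portrait d (\<lambda>_. \<tau>)" by (rule portrait_const[OF \<tau>])
  have aw: "[a] \<in> words {..<d}" using ab by (simp add: words_def)
  note fst_g = fst_aut_of[OF aw p]
  show ?thesis
  proof (rule hyperbolicI[OF _ _ ab(1-3)])
    fix w assume w: "w \<in> words {..<d}"
    then have "odd (gdist (Td d) w (build [a] (\<lambda>_. \<tau>) w))"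
      using gdist_parity[OF w portrait_build_in_words[OF aw p w]] build_parity[OF w, of "[a]"] by simp
    then show "1 \<le> gdist (Td d) w (fst (aut_of d [a] (\<lambda>_. \<tau>)) w)"
      using fst_g[OF w] by (simp add: odd_pos Suc_leI)
  next
    fix m
    have zw: "zigzag a b m \<in> words {..<d}" using ab by (simp add: zigzag_in_words)
    have "build [a] (\<lambda>_. \<tau>) (zigzag a b m) = zigzag a b (Suc m)"
    proof (induction m)
      case (Suc m)
      have "build [a] (\<lambda>_. \<tau>) (zigzag a b (Suc m))
          = nbr (zigzag a b (Suc m)) (if even (Suc m) then a else b)"
        using Suc ab by simp
      then show ?case using nbr_zigzag[OF ab(3), of "Suc m"] by simp
    qed simp
    then show "gdist (Td d) (zigzag a b m) (fst (aut_of d [a] (\<lambda>_. \<tau>)) (zigzag a b m)) = 1"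
      using fst_g[OF zw] gdist_nbr[OF zw, of "if even m then a else b"] ab nbr_zigzag[OF ab(3), of m] by simp
  qed simp
qed

text \<open>All displacements are even, and no vertex is fixed because left multiplication is free.\<close>
lemma hyperbolic_length_2:
  assumes ab: "a < d" "b < d" "a \<noteq> b"
  shows "hyperbolic_of_length (Td d) 2 (aut_of d [a, b] (\<lambda>_. id))"
proof -
  have p: "portrait d (\<lambda>_. id)" by (rule portrait_const) simp
  have aw: "[a, b] \<in> words {..<d}" using ab by (simp add: words_def)
  have fst_g: "fst (aut_of d [a, b] (\<lambda>_. id)) w = lmul [a, b] w" if "w \<in> words {..<d}" for w
    using fst_aut_of[OF aw p that] build_id[OF that] by simp
  show ?thesis
  proof (rule hyperbolicI[OF _ _ ab])
    fix w assume w: "w \<in> words {..<d}"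
    have l: "lmul [a, b] w \<in> words {..<d}" by (rule lmul_in_words[OF w aw])
    have "even (gdist (Td d) w (lmul [a, b] w))"
      using gdist_parity[OF w l] build_parity[OF w, of "[a, b]" "\<lambda>_. id"] build_id[OF w, of "[a, b]"] by simp
    moreover have "gdist (Td d) w (lmul [a, b] w) \<noteq> 0"
      using gdist_eq_0D[OF w l] lmul_fixed[OF w aw] by (metis list.distinct(1))
    ultimately show "2 \<le> gdist (Td d) w (fst (aut_of d [a, b] (\<lambda>_. id)) w)"
      unfolding fst_g[OF w] by presburger
  next
    fix m
    have zw: "zigzag a b m \<in> words {..<d}" using ab by (simp add: zigzag_in_words)
    have "lmul [a, b] (zigzag a b m) = zigzag a b (Suc (Suc m))"
    proof (induction m)
      case (Suc m)
      have "lmul [a, b] (zigzag a b (Suc m)) = nbr (zigzag a b (Suc (Suc m))) (if even m then a else b)"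
        using Suc by (simp add: lmul_snoc)
      also have "\<dots> = zigzag a b (Suc (Suc (Suc m)))"
        using nbr_zigzag[OF ab(3), of "Suc (Suc m)"] by simp
      finally show ?case .
    qed simp
    also have "\<dots> = nbr (nbr (zigzag a b m) (if even m then a else b)) (if even m then b else a)"
      using nbr_zigzag[OF ab(3), of m] nbr_zigzag[OF ab(3), of "Suc m"] by (cases "even m") auto
    finally show "gdist (Td d) (zigzag a b m) (fst (aut_of d [a, b] (\<lambda>_. id)) (zigzag a b m)) = 2"
      using fst_g[OF zw] gdist_nbr_nbr[OF zw] ab by simp
  qed simp
qed

lemma lmul_letter:
  assumes "w \<in> words K" "a \<in> K"
  shows "lmul [a] w = (if w \<noteq> [] \<and> hd w = a then tl w else a # w)"
proof (cases "w \<noteq> [] \<and> hd w = a")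
  case True
  then obtain w' where w: "w = a # w'" by (metis list.collapse)
  then have "w' \<in> words K" using assms by (auto simp: words_def distinct_adj_Cons)
  then have "lmul [] w' = w'" by (rule lmul_Nil1)
  then show ?thesis using w nbr_snoc_same[of "[]" a] by (simp add: lmul_def)
next
  case False
  then have "a # w \<in> words K" using assms by (cases w) (auto simp: words_def)
  then have "lmul [] (a # w) = a # w" by (rule lmul_Nil1)
  then show ?thesis using False by (auto simp: lmul_def nbr_def)
qed

text \<open>The word \<open>a \<cdot> w\<close> arises from \<open>w\<close> by a change at the front, its neighbours by a change at the
end. For reduced words the two coincide only at the ends of the inverted edge.\<close>
lemma inversion_letter:
  assumes a: "a < d"
  shows "inversion (Td d) (aut_of d [a] (\<lambda>_. id))"
proof -
  let ?g = "aut_of d [a] (\<lambda>_. id)"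
  have p: "portrait d (\<lambda>_. id)" by (rule portrait_const) simp
  have aw: "[a] \<in> words {..<d}" using a by (simp add: words_def)
  have fst_g: "fst ?g w = lmul [a] w" if "w \<in> words {..<d}" for w
    using fst_aut_of[OF aw p that] build_id[OF that] by simp
  have ge: "1 \<le> gdist (Td d) w (fst ?g w)" if w: "w \<in> words {..<d}" for w
  proof -
    have "odd (gdist (Td d) w (fst ?g w))"
      using gdist_parity[OF w lmul_in_words[OF w aw]] fst_g[OF w] build_id[OF w, of "[a]"]
        build_parity[OF w, of "[a]" "\<lambda>_. id"] by simp
    then show ?thesis by (simp add: odd_pos Suc_leI)
  qed
  have "fst ?g [] = nbr [] a" using fst_g[of "[]"] by (simp add: nbr_def)
  then have tl: "translation_length (Td d) ?g = 1"
    using gdist_nbr[of "[]" d a] a by (intro translation_length_eqI[of "[]"] ge) auto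
  have "min_displacement_set (Td d) ?g \<subseteq> {[], [a]}"
  proof
    fix w assume "w \<in> min_displacement_set (Td d) ?g"
    then have w: "w \<in> words {..<d}" "gdist (Td d) w (lmul [a] w) = 1"
      using tl fst_g by (auto simp: min_displacement_set_def)
    then obtain c where c: "lmul [a] w = nbr w c"
      using gdist_eq_1D[OF w(1) lmul_in_words[OF w(1) aw]] by metis
    show "w \<in> {[], [a]}"
    proof (cases "w \<noteq> [] \<and> hd w = a")
      case True
      then obtain w' where w': "w = a # w'" by (metis list.collapse)
      then have "lmul [a] w = w'" using lmul_letter[OF w(1)] a by simp
      then have eq: "w' = nbr (a # w') c" using c w' by simp
      show ?thesis
      proof (cases w')
        case Nil
        then show ?thesis using w' by simp
      next
        case (Cons b w'')
        then have "a \<noteq> b" using w(1) w' by (simp add: words_def)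
        have "hd (nbr (a # w') c) = a" using Cons by (simp add: nbr_def)
        then show ?thesis using eq Cons \<open>a \<noteq> b\<close> by simp
      qed
    next
      case False
      then have "a # w = nbr w c" using lmul_letter[OF w(1)] a c by auto
      moreover have "length (butlast w) < length (a # w)" by simp
      then have "a # w \<noteq> butlast w" by (metis less_irrefl)
      ultimately have "a # w = w @ [c]" by (simp add: nbr_def split: if_splits)
      then have "w = []" using False by (metis hd_append2 list.sel(1))
      then show ?thesis by simp
    qed
  qed
  then have "finite (min_displacement_set (Td d) ?g)" by (rule finite_subset) simp
  moreover have "([], [a]) \<in> edges (Td d)" using a by (auto simp: edges_Td nbr_def)
  moreover have "snd ?g ([], [a]) = bar (Td d) ([], [a])"
  proof -
    have "lmul [a] [a] = []" using lmul_letter[OF aw, of a] a by simp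
    then show ?thesis
      using AutG_snd[OF aut_of_in_AutG[OF aw p]] fst_g[OF aw] fst_g[of "[]"] \<open>([], [a]) \<in> edges (Td d)\<close>
      by (simp add: Td_simps(4))
  qed
  ultimately show ?thesis using tl by (auto simp: inversion_def)
qed

section \<open>Normal subgroups of symmetric groups\<close>

lemma ex_outside:
  assumes "length xs < card S"
  obtains c where "c \<in> S" "c \<notin> set xs"
proof -
  have "\<not> S \<subseteq> set xs" using assms card_mono[of "set xs" S] card_length[of xs] by auto
  then show thesis using that by blast
qed

lemma ex_permutes_map:
  assumes "length xs = length ys" "distinct xs" "distinct ys" "set xs \<subseteq> S" "set ys \<subseteq> S"
  shows "\<exists>t. t permutes S \<and> map t xs = ys"
  using assms
proof (induction xs ys rule: list_induct2)
  case Nil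
  then show ?case using permutes_id[of S] by (metis list.map(1))
next
  case (Cons x xs y ys)
  then obtain t where t: "t permutes S" "map t xs = ys" by auto
  have "t x \<in> S" using t(1) Cons.prems permutes_in_image by fastforce
  then have p: "Transposition.transpose (t x) y \<circ> t permutes S"
    using Cons.prems by (intro permutes_compose[OF t(1)] permutes_swap_id) auto
  have "(Transposition.transpose (t x) y \<circ> t) z = t z" if z: "z \<in> set xs" for z
  proof -
    have "t z \<in> set ys" using t(2) z by auto
    then have "t z \<noteq> y" using Cons.prems by auto
    moreover have "t z \<noteq> t x" using permutes_inj[OF t(1)] z Cons.prems by (auto dest: injD)
    ultimately show ?thesis by simp
  qed
  then have "map (Transposition.transpose (t x) y \<circ> t) (x # xs) = y # ys" using t(2) by auto
  with p have "Transposition.transpose (t x) y \<circ> t permutes S \<and>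
      map (Transposition.transpose (t x) y \<circ> t) (x # xs) = y # ys" by (rule conjI)
  then show ?case by (rule exI[of "\<lambda>t. t permutes S \<and> map t (x # xs) = y # ys"])
qed

lemma conj_transpose:
  assumes "t permutes S"
  shows "t \<circ> Transposition.transpose x y \<circ> inv_into UNIV t = Transposition.transpose (t x) (t y)"
proof -
  have "bij t" using permutes_bij[OF assms] .
  then have "Transposition.transpose (t x) (t y) \<circ> t = t \<circ> Transposition.transpose x y"
    by (simp add: transpose_comp_eq bij_is_inj)
  then have "Transposition.transpose (t x) (t y) \<circ> (t \<circ> inv_into UNIV t)
      = t \<circ> Transposition.transpose x y \<circ> inv_into UNIV t" by (simp add: comp_assoc[symmetric])
  then show ?thesis using permutes_inv_o(1)[OF assms] by simp
qed

text \<open>Commutators of a non-trivial element \<open>s\<close> with transpositions give a product of two disjoint transpositions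
or a 3-cycle in \<open>N\<close>. Products of two 3-cycles provide the former from the latter, and conjugation
then all products of two disjoint transpositions. With five points available, one of the two
transpositions can be used to move a point while the other one stays clear of the points that matter.\<close>
lemma normal_Sym_2_transitive:
  assumes card: "5 \<le> card S" and N: "normal_perms N {s. s permutes S}" and nontriv: "s \<in> N" "s \<noteq> id"
    and ab: "a \<in> S" "b \<in> S" "a \<noteq> b" "a' \<in> S" "b' \<in> S" "a' \<noteq> b'"
  shows "\<exists>r \<in> N. r a = a' \<and> r b = b'"
proof -
  let ?T = "\<lambda>x y. Transposition.transpose x y"
  have perm: "r permutes S" if "r \<in> N" for r using N that by (auto simp: normal_perms_def)
  have comp: "r \<circ> q \<in> N" if "r \<in> N" "q \<in> N" for r q using N that by (auto simp: normal_perms_def)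
  have conj: "t \<circ> r \<circ> inv_into UNIV t \<in> N" if "r \<in> N" "t permutes S" for r t
    using N that by (auto simp: normal_perms_def)
  have inv: "inv_into UNIV r \<in> N" if "r \<in> N" for r using N that by (auto simp: normal_perms_def)
  have commutator: "?T (s x) (s y) \<circ> ?T x y \<in> N" if "x \<in> S" "y \<in> S" for x y
  proof -
    have "?T x y \<circ> inv_into UNIV s \<circ> ?T x y \<in> N"
      using conj[OF inv[OF nontriv(1)] permutes_swap_id[OF that]] by simp
    then have "s \<circ> (?T x y \<circ> inv_into UNIV s \<circ> ?T x y) \<in> N" by (rule comp[OF nontriv(1)])
    moreover have "s \<circ> (?T x y \<circ> inv_into UNIV s \<circ> ?T x y)
        = (s \<circ> ?T x y \<circ> inv_into UNIV s) \<circ> ?T x y" by (simp add: comp_assoc)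
    ultimately show ?thesis using conj_transpose[OF perm[OF nontriv(1)]] by simp
  qed
  have conj2: "?T (t x) (t y) \<circ> ?T (t u) (t v) \<in> N"
    if "?T x y \<circ> ?T u v \<in> N" "t permutes S" for t x y u v
  proof -
    have "t \<circ> (?T x y \<circ> ?T u v) \<circ> inv_into UNIV t
        = (t \<circ> ?T x y \<circ> inv_into UNIV t) \<circ> (t \<circ> ?T u v \<circ> inv_into UNIV t)"
      using permutes_inv_o(2)[OF that(2)] by (simp add: fun_eq_iff)
    then show ?thesis using conj[OF that] conj_transpose[OF that(2)] by simp
  qed
  have double: "?T x y \<circ> ?T u v \<in> N" if d: "distinct [x, y, u, v]" "{x, y, u, v} \<subseteq> S" for x y u v
  proof -
    obtain p where p: "s p \<noteq> p" using nontriv(2) by (auto simp: fun_eq_iff)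
    have sS: "s z \<in> S \<longleftrightarrow> z \<in> S" for z using permutes_in_image[OF perm[OF nontriv(1)]] .
    have pS: "p \<in> S" using p permutes_not_in[OF perm[OF nontriv(1)]] by blast
    have s_inj: "s y = s z \<longleftrightarrow> y = z" for y z using permutes_inj[OF perm[OF nontriv(1)]] by (auto dest: injD)
    \<comment> \<open>As \<open>s c \<noteq> p\<close>, the commutator of \<open>s\<close> with \<open>(p c)\<close> is a double transposition unless \<open>s\<close> fixes \<open>c\<close>.\<close>
    obtain c where c: "c \<in> S" "c \<notin> set [p, s p, inv_into UNIV s p]"
      by (rule ex_outside[of "[p, s p, inv_into UNIV s p]" S]) (use card in auto)
    then have sc: "s c \<noteq> p" using permutes_inverses(2)[OF perm[OF nontriv(1)], of c] by auto
    have key: "?T (s p) (s c) \<circ> ?T p c \<in> N" using commutator pS c by blast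
    show ?thesis
    proof (cases "s c = c")
      case False
      have "distinct [s p, s c, p, c]" using False c sc p s_inj by auto
      then obtain t where t: "t permutes S" "map t [s p, s c, p, c] = [x, y, u, v]"
        using ex_permutes_map[of "[s p, s c, p, c]" "[x, y, u, v]" S] d c pS sS by auto
      then show ?thesis using conj2[OF key t(1)] by simp
    next
      case True
      \<comment> \<open>Then the commutator is a 3-cycle, and all 3-cycles are conjugate.\<close>
      have three: "?T f e \<circ> ?T g e \<in> N" if efg: "distinct [f, e, g]" "{f, e, g} \<subseteq> S" for e f g
      proof -
        have "distinct [s p, c, p]" using c p by auto
        then obtain t where t: "t permutes S" "map t [s p, c, p] = [f, e, g]"
          using ex_permutes_map[of "[s p, c, p]" "[f, e, g]" S] efg c pS sS by auto
        then show ?thesis using conj2[OF key t(1)] True by simp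
      qed
      \<comment> \<open>Inserting \<open>(u y) (y u) = id\<close> between two disjoint transpositions makes a product of two 3-cycles of them.\<close>
      have "(?T x y \<circ> ?T u y) \<circ> (?T y u \<circ> ?T v u) \<in> N"
        by (rule comp; rule three) (use d in auto)
      moreover have "(?T x y \<circ> ?T u y) \<circ> (?T y u \<circ> ?T v u) = ?T x y \<circ> ?T u v"
        by (simp add: fun_eq_iff transpose_commute)
      ultimately show ?thesis by simp
    qed
  qed
  have move: "\<exists>r \<in> N. r x = y \<and> r z = z" if "x \<in> S" "y \<in> S" "z \<in> S" "x \<noteq> z" "y \<noteq> z" for x y z
  proof (cases "x = y")
    case True
    then show ?thesis using N by (auto simp: normal_perms_def intro: bexI[of _ id])
  next
    case False
    obtain u where u: "u \<in> S" "u \<notin> set [x, y, z]"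
      by (rule ex_outside[of "[x, y, z]" S]) (use card in auto)
    obtain v where v: "v \<in> S" "v \<notin> set [x, y, z, u]"
      by (rule ex_outside[of "[x, y, z, u]" S]) (use card in auto)
    have "?T x y \<circ> ?T u v \<in> N" by (rule double) (use False u v that in auto)
    moreover have "(?T x y \<circ> ?T u v) x = y" "(?T x y \<circ> ?T u v) z = z" using u v that by auto
    ultimately show ?thesis by blast
  qed
  obtain w where w: "w \<in> S" "w \<notin> set [a, a']"
    by (rule ex_outside[of "[a, a']" S]) (use card in auto)
  obtain r where r: "r \<in> N" "r a = a'" using move[of a a' w] w ab by auto
  have "r b \<in> S" using permutes_in_image[OF perm[OF r(1)]] ab by simp
  moreover have "r b \<noteq> a'" using permutes_inj[OF perm[OF r(1)]] r(2) ab by (auto dest: injD)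
  ultimately obtain q where q: "q \<in> N" "q (r b) = b'" "q a' = a'" using move[of "r b" b' a'] ab by auto
  then show ?thesis using comp[OF q(1) r(1)] r by (intro bexI[of _ "q \<circ> r"]) auto
qed

section \<open>Intransitive examples\<close>

lemma permutations_group_Sym: "permutations_group S {s. s permutes S}"
  by (auto simp: permutations_group_def permutes_compose permutes_inv)

lemma permutations_group_image:
  assumes G: "permutations_group S G" and id: "h id = id"
    and comp: "\<And>s t. s \<in> G \<Longrightarrow> t \<in> G \<Longrightarrow> h (s \<circ> t) = h s \<circ> h t"
    and out: "\<And>s c. s \<in> G \<Longrightarrow> c \<notin> T \<Longrightarrow> h s c = c"
  shows "permutations_group T (h ` G)"
proof -
  have inv: "inv_into UNIV s \<in> G" "h s \<circ> h (inv_into UNIV s) = id" "h (inv_into UNIV s) \<circ> h s = id"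
    if s: "s \<in> G" for s
  proof -
    have p: "s permutes S" and i: "inv_into UNIV s \<in> G" using G s by (auto simp: permutations_group_def)
    show "inv_into UNIV s \<in> G" by (rule i)
    show "h s \<circ> h (inv_into UNIV s) = id" "h (inv_into UNIV s) \<circ> h s = id"
      using comp[OF s i] comp[OF i s] permutes_inv_o[OF p] id by simp_all
  qed
  have "h s permutes T" if s: "s \<in> G" for s
  proof -
    have "bij (h s)" using o_bij[OF inv(3)[OF s] inv(2)[OF s]] .
    then show ?thesis using out[OF s] by (auto simp: permutes_def bij_iff)
  qed
  moreover have "inv_into UNIV (h s) = h (inv_into UNIV s)" if "s \<in> G" for s
    using inv_unique_comp[OF inv(2,3)[OF that]] .
  ultimately show ?thesis
    using G inv(1) id comp[symmetric] unfolding permutations_group_def by (auto intro: image_eqI[of _ h id])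
qed

lemma permutations_group_involution:
  assumes "f permutes S" "f \<circ> f = id"
  shows "permutations_group S {id, f}"
proof -
  have "inv_into UNIV f = f" using inv_unique_comp[OF assms(2) assms(2)] .
  then show ?thesis using assms by (auto simp: permutations_group_def)
qed

text \<open>The labelling for both intransitive examples: three labelled colours, the others are contracted.\<close>
definition low :: "nat \<Rightarrow> nat option" where
  "low c = (if c < 3 then Some c else None)"

lemma label_action_low:
  assumes d: "3 \<le> d" and Z: "permutations_group {..<d} Z"
    and Z_low: "\<And>z c. z \<in> Z \<Longrightarrow> c < 3 \<Longrightarrow> z c = c"
  shows "label_action d low {a. a permutes {..<3}} Z"
proof
  show "permutations_group {..<d} {a. a permutes {..<3 :: nat}}"
    using permutations_group_Sym[of "{..<3 :: nat}"] permutes_subset[of _ "{..<3}" "{..<d}"] d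
    by (auto simp: permutations_group_def)
  show "permutations_group {..<d} Z" by (rule Z)
  have zp: "z permutes {..<d}" if "z \<in> Z" for z using Z that by (simp add: permutations_group_def)
  have z_high: "3 \<le> z c" if "z \<in> Z" "3 \<le> c" for z c
  proof (rule ccontr)
    assume "\<not> 3 \<le> z c"
    then have "z (z c) = z c" using Z_low that by simp
    then have "z c = c" using permutes_inj[OF zp[OF that(1)]] by (auto dest: injD)
    then show False using that \<open>\<not> 3 \<le> z c\<close> by simp
  qed
  show "low (z c) = low c" if "z \<in> Z" for z c
    using Z_low[OF that, of c] z_high[OF that, of c] by (cases "c < 3") (simp_all add: low_def)
  fix a :: "nat \<Rightarrow> nat"
  assume "a \<in> {a. a permutes {..<3}}"
  then have a: "a permutes {..<3}" by simp
  have a_low: "a c < 3 \<longleftrightarrow> c < 3" for c using permutes_in_image[OF a, of c] by simp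
  have a_high: "a c = c" if "3 \<le> c" for c using permutes_not_in[OF a] that by simp
  show "a \<circ> z = z \<circ> a" if "z \<in> Z" for z
  proof
    fix c
    show "(a \<circ> z) c = (z \<circ> a) c"
      using Z_low[OF that, of c] Z_low[OF that, of "a c"] z_high[OF that, of c] a_low[of c] a_high[of c] a_high[of "z c"]
      by (cases "c < 3") simp_all
  qed
  show "low (a c) = low (a c')" if "low c = low c'" for c c'
    using that a_low[of c] a_low[of c'] by (auto simp: low_def split: if_splits)
  show "low (a c) = None" if "low c = None" for c
    using that a_low[of c] by (simp add: low_def split: if_splits)
qed

lemma low_group:
  assumes "label_action d low {a. a permutes {..<3}} Z" "4 \<le> d"
    and Z_low: "\<And>z c. z \<in> Z \<Longrightarrow> c < 3 \<Longrightarrow> z c = c"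
  shows "closed_nondiscrete_cg_subgroup (Td d) (label_action.H d low {a. a permutes {..<3}} Z)"
    and "locally_acts perm_intransitive (Td d) (label_action.H d low {a. a permutes {..<3}} Z)"
proof -
  interpret label_action d low "{a. a permutes {..<3}}" Z by (rule assms(1))
  show "closed_nondiscrete_cg_subgroup (Td d) H"
  proof (rule H_closed_nondiscrete_cg)
    show "Transposition.transpose 0 1 \<in> {a. a permutes {..<3 :: nat}}" by (auto intro: permutes_swap_id)
    show "Transposition.transpose 0 (1 :: nat) \<noteq> id" by (simp add: transpose_eq_id_iff)
    show "2 \<in> labels" "0 \<in> labels" using label_in_labels[of 2 2] label_in_labels[of 0 0] assms(2)
      by (simp_all add: low_def)
    show "Transposition.transpose 0 1 c = c" if "low c = Some 2" for c
      using that by (auto simp: low_def split: if_splits)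
  qed simp
  have "f 0 < 3" if "f \<in> F" for f
  proof -
    obtain a z where f: "f = a \<circ> z" "a permutes {..<3 :: nat}" "z \<in> Z" using \<open>f \<in> F\<close> by (auto simp: F_def)
    then have "f 0 = a 0" using Z_low[of z 0] by simp
    then show ?thesis using permutes_in_image[OF f(2), of 0] by simp
  qed
  then have "\<not> (\<exists>f \<in> F. f 0 = 3)" by (metis less_irrefl)
  moreover have "0 \<in> {..<d}" "3 \<in> {..<d}" using assms(2) by auto
  ultimately have "\<not> transitive_perms {..<d} F" unfolding transitive_perms_def by blast
  then show "locally_acts perm_intransitive (Td d) H" by (simp add: locally_transitive_iff)
qed

lemma ex_quasi_central_inversion:
  "\<exists>H. closed_nondiscrete_cg_subgroup (Td 4) H \<and> locally_acts perm_intransitive (Td 4) H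
    \<and> (\<exists>g. quasi_central (Td 4) H g \<and> inversion (Td 4) g)"
proof -
  have Z: "permutations_group {..<4} {id :: nat \<Rightarrow> nat}" by (simp add: permutations_group_def)
  have la: "label_action 4 low {a. a permutes {..<3}} {id}" by (rule label_action_low) (auto simp: Z)
  interpret label_action 4 low "{a. a permutes {..<3}}" "{id}" by (rule la)
  have "quasi_central (Td 4) H (aut_of 4 [3] (\<lambda>_. id))"
    by (rule quasi_central_aut_of) (auto simp: words_def proj_def label_step_def low_def)
  moreover have "inversion (Td 4) (aut_of 4 [3] (\<lambda>_. id))" by (rule inversion_letter) simp
  moreover have "closed_nondiscrete_cg_subgroup (Td 4) H" by (rule low_group(1)[OF la]) auto
  moreover have "locally_acts perm_intransitive (Td 4) H" by (rule low_group(2)[OF la]) auto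
  ultimately show ?thesis by blast
qed

lemma ex_quasi_central_hyperbolic_1:
  "\<exists>H. closed_nondiscrete_cg_subgroup (Td 5) H \<and> locally_acts perm_intransitive (Td 5) H
    \<and> (\<exists>g. quasi_central (Td 5) H g \<and> hyperbolic_of_length (Td 5) 1 g)"
proof -
  let ?\<tau> = "Transposition.transpose 3 (4 :: nat)"
  have \<tau>: "?\<tau> permutes {..<5}" by (rule permutes_swap_id) auto
  have Z: "permutations_group {..<5} {id, ?\<tau>}" by (rule permutations_group_involution[OF \<tau>]) simp
  have low: "z c = c" if "z \<in> {id, ?\<tau>}" "c < 3" for z c using that by auto
  have la: "label_action 5 low {a. a permutes {..<3}} {id, ?\<tau>}"
    by (rule label_action_low) (use Z low in auto)
  interpret label_action 5 low "{a. a permutes {..<3}}" "{id, ?\<tau>}" by (rule la)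
  have "quasi_central (Td 5) H (aut_of 5 [3] (\<lambda>_. ?\<tau>))"
    by (rule quasi_central_aut_of) (auto simp: words_def proj_def label_step_def low_def)
  moreover have "hyperbolic_of_length (Td 5) 1 (aut_of 5 [3] (\<lambda>_. ?\<tau>))"
    by (rule hyperbolic_length_1[OF \<tau>, where b = 4]) auto
  moreover have "closed_nondiscrete_cg_subgroup (Td 5) H" by (rule low_group(1)[OF la]) (use low in auto)
  moreover have "locally_acts perm_intransitive (Td 5) H" by (rule low_group(2)[OF la]) (use low in auto)
  ultimately show ?thesis by blast
qed

section \<open>A transitive example\<close>

text \<open>The permutation of the colours \<open>0, \<dots>, d - 1\<close> that corresponds under the enumeration \<open>dec\<close> to the permutation
\<open>\<phi>\<close> of a set with \<open>d\<close> elements.\<close>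
definition recolour :: "nat \<Rightarrow> (nat \<Rightarrow> 'c) \<Rightarrow> ('c \<Rightarrow> 'c) \<Rightarrow> nat \<Rightarrow> nat" where
  "recolour d dec \<phi> c = (if c < d then inv_into {..<d} dec (\<phi> (dec c)) else c)"

context
  fixes d :: nat and dec :: "nat \<Rightarrow> 'c" and \<Omega> :: "'c set"
  assumes dec: "bij_betw dec {..<d} \<Omega>"
begin

lemma dec_in: "c < d \<Longrightarrow> dec c \<in> \<Omega>"
  using dec by (auto simp: bij_betw_def)

lemma dec_eq_iff: "c < d \<Longrightarrow> c' < d \<Longrightarrow> dec c = dec c' \<longleftrightarrow> c = c'"
  using dec by (auto simp: bij_betw_def dest: inj_onD)

lemma dec_ex: "x \<in> \<Omega> \<Longrightarrow> \<exists>c < d. dec c = x"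
  using dec by (auto simp: bij_betw_def)

lemma dec_recolour:
  assumes "\<phi> \<in> \<Omega> \<rightarrow> \<Omega>" "c < d"
  shows "dec (recolour d dec \<phi> c) = \<phi> (dec c)" "recolour d dec \<phi> c < d"
proof -
  have "\<phi> (dec c) \<in> dec ` {..<d}" using assms dec_in[OF assms(2)] dec by (auto simp: bij_betw_def)
  then show "dec (recolour d dec \<phi> c) = \<phi> (dec c)" "recolour d dec \<phi> c < d"
    using f_inv_into_f[of "\<phi> (dec c)" dec "{..<d}"] inv_into_into[of "\<phi> (dec c)" dec "{..<d}"] assms(2)
    by (simp_all add: recolour_def)
qed

lemma recolour_comp:
  assumes "\<phi> \<in> \<Omega> \<rightarrow> \<Omega>" "\<psi> \<in> \<Omega> \<rightarrow> \<Omega>"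
  shows "recolour d dec (\<phi> \<circ> \<psi>) = recolour d dec \<phi> \<circ> recolour d dec \<psi>"
proof
  fix c
  show "recolour d dec (\<phi> \<circ> \<psi>) c = (recolour d dec \<phi> \<circ> recolour d dec \<psi>) c"
  proof (cases "c < d")
    case True
    have "\<phi> \<circ> \<psi> \<in> \<Omega> \<rightarrow> \<Omega>" using assms by auto
    then show ?thesis
      using True dec_recolour assms by (subst dec_eq_iff[symmetric]) simp_all
  qed (simp add: recolour_def)
qed

lemma recolour_id: "recolour d dec id = id"
  by (rule ext) (auto simp: recolour_def inv_into_f_f[OF bij_betw_imp_inj_on[OF dec]])

lemma recolour_apply_iff:
  assumes "\<phi> \<in> \<Omega> \<rightarrow> \<Omega>" "c < d" "c' < d"
  shows "recolour d dec \<phi> c = c' \<longleftrightarrow> \<phi> (dec c) = dec c'"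
  using dec_recolour[OF assms(1,2)] assms(3) dec_eq_iff by metis

lemma recolour_group:
  assumes "permutations_group S G" "r id = id" "\<And>s t. r (s \<circ> t) = r s \<circ> r t" "\<And>s. s \<in> G \<Longrightarrow> r s \<in> \<Omega> \<rightarrow> \<Omega>"
  shows "permutations_group {..<d} ((\<lambda>s. recolour d dec (r s)) ` G)"
proof (rule permutations_group_image[OF assms(1)])
  show "recolour d dec (r id) = id" by (simp add: assms(2) recolour_id)
  show "recolour d dec (r (s \<circ> t)) = recolour d dec (r s) \<circ> recolour d dec (r t)" if "s \<in> G" "t \<in> G" for s t
    using recolour_comp[OF assms(4)[OF that(1)] assms(4)[OF that(2)]] by (simp add: assms(3))
qed (simp add: recolour_def)

end

lemma edge_fixating_root:
  assumes p: "portrait d \<sigma>" and c: "c < d" "\<sigma> [] c = c"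
  shows "edge_fixating (Td d) (aut_of d [] \<sigma>)"
proof -
  have e: "([], nbr [] c) \<in> edges (Td d)" using c by (auto simp: edges_Td)
  have w: "nbr [] c \<in> words {..<d}" using c by (simp add: nbr_in_words)
  have "fst (aut_of d [] \<sigma>) (nbr [] c) = nbr [] c"
    using AutG_nbr[OF aut_of_in_AutG[OF Nil_in_words p] Nil_in_words c(1)] fst_aut_of[OF Nil_in_words p]
      loc_aut_of[OF Nil_in_words p] c by simp
  then have "snd (aut_of d [] \<sigma>) ([], nbr [] c) = ([], nbr [] c)"
    using AutG_snd[OF aut_of_in_AutG[OF Nil_in_words p]] e fst_aut_of[OF Nil_in_words p] by simp
  then show ?thesis using e by (auto simp: edge_fixating_def)
qed

text \<open>Since \<open>Z\<close> acts on the columns as the symmetric group on three points, its point stabilizers are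
non-trivial, as is needed for an edge-fixating element with constant portrait in \<open>Z\<close>.\<close>
lemma ex_quasi_central_edge_fixating:
  "\<exists>H. closed_nondiscrete_cg_subgroup (Td 9) H \<and> locally_acts perm_transitive (Td 9) H
    \<and> (\<exists>g. quasi_central (Td 9) H g \<and> g \<noteq> \<one>\<^bsub>AutG (Td 9)\<^esub> \<and> edge_fixating (Td 9) g)"
proof -
  let ?S = "{..<3 :: nat}"
  let ?\<Omega> = "?S \<times> ?S" and ?G = "{s. s permutes {..<3 :: nat}}"
  have "\<exists>dec. bij_betw dec {..<9 :: nat} ?\<Omega>"
    using ex_bij_betw_nat_finite[of ?\<Omega>] by (simp add: atLeast0LessThan)
  then obtain dec where dec: "bij_betw dec {..<9 :: nat} ?\<Omega>" by (rule exE)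
  define row col where "row s = recolour 9 dec (map_prod s id)"
    and "col t = recolour 9 dec (map_prod id t)" for s t :: "nat \<Rightarrow> nat"
  have row_\<Omega>: "map_prod s id \<in> ?\<Omega> \<rightarrow> ?\<Omega>" and col_\<Omega>: "map_prod id s \<in> ?\<Omega> \<rightarrow> ?\<Omega>" if "s \<in> ?G" for s
  proof -
    have "s a < 3 \<longleftrightarrow> a < 3" for a using permutes_in_image[of s ?S a] that by simp
    then show "map_prod s id \<in> ?\<Omega> \<rightarrow> ?\<Omega>" "map_prod id s \<in> ?\<Omega> \<rightarrow> ?\<Omega>"
      by (simp_all add: Pi_iff mem_Times_iff)
  qed
  define \<pi> where "\<pi> c = Some (fst (dec c))" for c
  have dec_row: "dec (row s c) = map_prod s id (dec c)" "row s c < 9" if "s \<in> ?G" "c < 9" for s c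
    using dec_recolour[OF dec row_\<Omega>[OF that(1)] that(2)] by (simp_all add: row_def)
  have dec_col: "dec (col s c) = map_prod id s (dec c)" "col s c < 9" if "s \<in> ?G" "c < 9" for s c
    using dec_recolour[OF dec col_\<Omega>[OF that(1)] that(2)] by (simp_all add: col_def)
  interpret label_action 9 \<pi> "row ` ?G" "col ` ?G"
  proof
    show "permutations_group {..<9} (row ` ?G)" "permutations_group {..<9} (col ` ?G)"
      unfolding row_def col_def
      by (rule recolour_group[OF dec permutations_group_Sym];
          use row_\<Omega> col_\<Omega> in \<open>simp add: map_prod.id map_prod.comp fun_eq_iff\<close>)+
    show "a \<circ> z = z \<circ> a" if az: "a \<in> row ` ?G" "z \<in> col ` ?G" for a z
    proof -
      obtain s t where "a = row s" "s \<in> ?G" "z = col t" "t \<in> ?G" using az by blast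
      then show ?thesis
        using recolour_comp[OF dec row_\<Omega>[of s] col_\<Omega>[of t]] recolour_comp[OF dec col_\<Omega>[of t] row_\<Omega>[of s]]
        by (simp add: row_def col_def map_prod.comp)
    qed
    show "\<pi> (a c) = \<pi> (a c')" if "a \<in> row ` ?G" "c < 9" "c' < 9" "\<pi> c = \<pi> c'" for a c c'
      using that by (auto simp: \<pi>_def dec_row)
    show "\<pi> (z c) = \<pi> c" if "z \<in> col ` ?G" "c < 9" for z c
      using that by (auto simp: \<pi>_def dec_col)
  qed (simp add: \<pi>_def)
  let ?t = "Transposition.transpose 0 (1 :: nat)"
  have t: "?t \<in> ?G" by (auto intro: permutes_swap_id)
  obtain c00 c02 c20 where c: "c00 < 9" "dec c00 = (0, 0)" "c02 < 9" "dec c02 = (0, 2)" "c20 < 9" "dec c20 = (2, 0)"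
    using dec_ex[OF dec, of "(0, 0)"] dec_ex[OF dec, of "(0, 2)"] dec_ex[OF dec, of "(2, 0)"] by auto
  have "closed_nondiscrete_cg_subgroup (Td 9) H"
  proof (rule H_closed_nondiscrete_cg)
    show "row ?t \<in> row ` ?G" using t by blast
    have "dec (row ?t c00) \<noteq> dec c00" using dec_row[OF t c(1)] c(2) by simp
    then show "row ?t \<noteq> id" by auto
    show "2 \<in> labels" "0 \<in> labels" using c by (auto simp: labels_def \<pi>_def)
    show "row ?t c = c" if "c < 9" "\<pi> c = Some 2" for c
      using that recolour_apply_iff[OF dec row_\<Omega>[OF t] that(1) that(1)]
      by (cases "dec c") (simp add: row_def \<pi>_def)
  qed simp
  moreover have "locally_acts perm_transitive (Td 9) H"
    unfolding locally_transitive_iff transitive_perms_def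
  proof (intro ballI)
    fix c c' :: nat assume cc: "c \<in> {..<9}" "c' \<in> {..<9}"
    obtain a b a' b' where ab: "dec c = (a, b)" "dec c' = (a', b')" by fastforce
    then have S: "a \<in> ?S" "b \<in> ?S" "a' \<in> ?S" "b' \<in> ?S" using dec_in[OF dec] cc by (metis SigmaD1 SigmaD2 lessThan_iff)+
    let ?s = "Transposition.transpose a a'" and ?u = "Transposition.transpose b b'"
    have su: "?s \<in> ?G" "?u \<in> ?G" using S by (auto intro: permutes_swap_id)
    have "dec ((row ?s \<circ> col ?u) c) = dec c'"
      using dec_row[OF su(1)] dec_col[OF su(2)] cc ab by simp
    then have "(row ?s \<circ> col ?u) c = c'"
      using dec_eq_iff[OF dec, of "(row ?s \<circ> col ?u) c" c'] dec_row(2)[OF su(1)] dec_col(2)[OF su(2)] cc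
      by simp
    moreover have "row ?s \<circ> col ?u \<in> F" unfolding F_def using su by blast
    ultimately show "\<exists>f \<in> F. f c = c'" by blast
  qed
  moreover have "quasi_central (Td 9) H (aut_of 9 [] (\<lambda>_. col ?t))"
    by (rule quasi_central_aut_of) (use t in auto)
  moreover have "aut_of 9 [] (\<lambda>_. col ?t) \<noteq> \<one>\<^bsub>AutG (Td 9)\<^esub>"
  proof
    have p: "portrait 9 (\<lambda>_. col ?t)" using t by (intro portrait_const Z_permutes) blast
    assume "aut_of 9 [] (\<lambda>_. col ?t) = \<one>\<^bsub>AutG (Td 9)\<^esub>"
    then have "col ?t = id" using loc_aut_of[OF Nil_in_words p Nil_in_words] loc_one[OF Nil_in_words] by simp
    moreover have "dec (col ?t c00) \<noteq> dec c00" using dec_col[OF t c(1)] c(2) by simp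
    ultimately show False by simp
  qed
  moreover have "edge_fixating (Td 9) (aut_of 9 [] (\<lambda>_. col ?t))"
  proof -
    have p: "portrait 9 (\<lambda>_. col ?t)" using t by (intro portrait_const Z_permutes) blast
    have fixed: "col ?t c02 = c02"
      using recolour_apply_iff[OF dec col_\<Omega>[OF t] c(3) c(3)] c(4) by (simp add: col_def)
    show ?thesis
      by (rule edge_fixating_root[OF p c(3)]) (rule fixed)
  qed
  ultimately show ?thesis by blast
qed

section \<open>Quasiprimitive and semiprimitive examples\<close>

definition ordered_pairs :: "nat \<Rightarrow> (nat \<times> nat) set" where
  "ordered_pairs n = {(a, b). a < n \<and> b < n \<and> a \<noteq> b}"

lemma ex_ordered_pairs_enum: "\<exists>dec. bij_betw dec {..<20 :: nat} (ordered_pairs 5)"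
proof -
  have eq: "ordered_pairs 5 = Sigma {..<5} (\<lambda>a. {..<5} - {a})" by (auto simp: ordered_pairs_def)
  have "card (ordered_pairs 5) = 20" unfolding eq by (subst card_SigmaI) auto
  moreover have "finite (ordered_pairs 5)" unfolding eq by simp
  ultimately show ?thesis
    using ex_bij_betw_nat_finite[of "ordered_pairs 5"] by (simp add: atLeast0LessThan)
qed

locale pair_colours =
  fixes dec :: "nat \<Rightarrow> nat \<times> nat"
  assumes dec: "bij_betw dec {..<20} (ordered_pairs 5)"
begin

definition diag :: "(nat \<Rightarrow> nat) \<Rightarrow> nat \<Rightarrow> nat" where
  "diag s = recolour 20 dec (map_prod s s)"

definition flip :: "nat \<Rightarrow> nat" where
  "flip = recolour 20 dec prod.swap"

definition underlying :: "nat \<Rightarrow> nat set option" where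
  "underlying c = Some {fst (dec c), snd (dec c)}"

abbreviation Sym5 :: "(nat \<Rightarrow> nat) set" where
  "Sym5 \<equiv> {s. s permutes {..<5}}"

lemma diag_pairs: "s \<in> Sym5 \<Longrightarrow> map_prod s s \<in> ordered_pairs 5 \<rightarrow> ordered_pairs 5"
proof -
  assume "s \<in> Sym5"
  then have "s a < 5 \<longleftrightarrow> a < 5" "s a = s b \<longleftrightarrow> a = b" for a b
    using permutes_in_image[of s "{..<5}" a] inj_eq[OF permutes_inj[of s "{..<5}"], of a b] by simp_all
  then show ?thesis by (auto simp: ordered_pairs_def)
qed

lemma swap_pairs: "prod.swap \<in> ordered_pairs 5 \<rightarrow> ordered_pairs 5"
  by (auto simp: ordered_pairs_def)

lemma dec_diag: "s \<in> Sym5 \<Longrightarrow> c < 20 \<Longrightarrow> dec (diag s c) = map_prod s s (dec c)"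
  using dec_recolour[OF dec diag_pairs] by (simp add: diag_def)

lemma dec_flip: "c < 20 \<Longrightarrow> dec (flip c) = prod.swap (dec c)" and flip_less: "c < 20 \<Longrightarrow> flip c < 20"
  using dec_recolour[OF dec swap_pairs] by (simp_all add: flip_def)

lemma diag_comp: "s \<in> Sym5 \<Longrightarrow> t \<in> Sym5 \<Longrightarrow> diag (s \<circ> t) = diag s \<circ> diag t"
  using recolour_comp[OF dec diag_pairs diag_pairs, of s t] by (simp add: diag_def map_prod.comp)

lemma diag_id: "diag id = id"
  by (simp add: diag_def map_prod.id recolour_id[OF dec])

lemma diag_inv: "s \<in> Sym5 \<Longrightarrow> inv_into UNIV (diag s) = diag (inv_into UNIV s)"
proof -
  assume s: "s \<in> Sym5"
  then have i: "inv_into UNIV s \<in> Sym5" by (simp add: permutes_inv)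
  show ?thesis
    using diag_comp[OF s i] diag_comp[OF i s] permutes_inv_o[of s "{..<5}"] s
    by (intro inv_unique_comp) (simp_all add: diag_id)
qed

lemma diag_group: "permutations_group {..<20} (diag ` Sym5)"
  unfolding diag_def
  by (rule recolour_group[OF dec permutations_group_Sym])
    (use diag_pairs in \<open>simp_all add: map_prod.id map_prod.comp\<close>)

lemma flip_flip: "flip \<circ> flip = id"
  using recolour_comp[OF dec swap_pairs swap_pairs] recolour_id[OF dec]
  by (simp add: flip_def comp_def id_def)

lemma flip_permutes: "flip permutes {..<20}"
proof -
  have "bij flip" using o_bij[OF flip_flip flip_flip] .
  moreover have "flip c = c" if "c \<notin> {..<20}" for c using that by (simp add: flip_def recolour_def)
  ultimately show ?thesis by (auto simp: permutes_def bij_iff)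
qed

lemma flip_no_fixed_colour: "c < 20 \<Longrightarrow> flip c \<noteq> c"
proof
  assume c: "c < 20" "flip c = c"
  then have "prod.swap (dec c) = dec c" using dec_flip[OF c(1)] by simp
  from arg_cong[OF this, of fst] have "snd (dec c) = fst (dec c)" by simp
  then show False using dec_in[OF dec c(1)] by (simp add: ordered_pairs_def case_prod_beta)
qed

lemma diag_flip: "s \<in> Sym5 \<Longrightarrow> diag s \<circ> flip = flip \<circ> diag s"
proof -
  assume s: "s \<in> Sym5"
  have "map_prod s s \<circ> prod.swap = prod.swap \<circ> map_prod s s" by (auto simp: fun_eq_iff)
  then show ?thesis
    using recolour_comp[OF dec diag_pairs[OF s] swap_pairs] recolour_comp[OF dec swap_pairs diag_pairs[OF s]]
    by (simp add: diag_def flip_def)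
qed

lemma label_action_pairs:
  assumes "Z \<subseteq> {id, flip}" "id \<in> Z"
  shows "label_action 20 underlying (diag ` Sym5) Z"
proof
  show "permutations_group {..<20} (diag ` Sym5)" by (rule diag_group)
  have "Z = {id} \<or> Z = {id, flip}" using assms by blast
  then show "permutations_group {..<20} Z"
    using permutations_group_involution[OF flip_permutes flip_flip] by (auto simp: permutations_group_def)
  show "a \<circ> z = z \<circ> a" if az: "a \<in> diag ` Sym5" "z \<in> Z" for a z
  proof -
    obtain s where s: "a = diag s" "s \<in> Sym5" using az by blast
    have "z = id \<or> z = flip" using az assms by blast
    then show ?thesis using diag_flip[OF s(2)] s(1) by auto
  qed
  show "underlying (z c) = underlying c" if "z \<in> Z" "c < 20" for z c
  proof -
    have "z = id \<or> z = flip" using that assms by blast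
    then show ?thesis using dec_flip[OF that(2)] by (auto simp: underlying_def)
  qed
  show "underlying (a c) = underlying (a c')"
    if acc: "a \<in> diag ` Sym5" "c < 20" "c' < 20" "underlying c = underlying c'" for a c c'
  proof -
    obtain s where s: "a = diag s" "s \<in> Sym5" using acc by blast
    have "underlying (diag s c) = map_option ((`) s) (underlying c)" if "c < 20" for c
      using dec_diag[OF s(2) that] by (simp add: underlying_def)
    then show ?thesis using acc s(1) by simp
  qed
qed (simp add: underlying_def)

lemma transitive_diag:
  assumes "\<And>a b a' b'. (a, b) \<in> ordered_pairs 5 \<Longrightarrow> (a', b') \<in> ordered_pairs 5 \<Longrightarrow>
    \<exists>s \<in> Sym5. diag s \<in> M \<and> s a = a' \<and> s b = b'"
  shows "transitive_perms {..<20} M"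
  unfolding transitive_perms_def
proof (intro ballI)
  fix c c' :: nat assume c: "c \<in> {..<20}" "c' \<in> {..<20}"
  obtain a b a' b' where ab: "dec c = (a, b)" "dec c' = (a', b')" by fastforce
  then have "(a, b) \<in> ordered_pairs 5" "(a', b') \<in> ordered_pairs 5"
    using dec_in[OF dec, of c] dec_in[OF dec, of c'] c by simp_all
  then obtain s where s: "s \<in> Sym5" "diag s \<in> M" "s a = a'" "s b = b'" using assms by blast
  have "diag s c = c'"
    using recolour_apply_iff[OF dec diag_pairs[OF s(1)], of c c'] c ab s by (simp add: diag_def)
  then show "\<exists>f \<in> M. f c = c'" using s(2) by blast
qed

lemma transitive_all:
  assumes "id \<in> Z"
  shows "transitive_perms {..<20} {a \<circ> z | a z. a \<in> diag ` Sym5 \<and> z \<in> Z}"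
proof (rule transitive_diag)
  fix a b a' b' assume ab: "(a, b) \<in> ordered_pairs 5" "(a', b') \<in> ordered_pairs 5"
  then have "\<exists>s. s permutes {..<5} \<and> map s [a, b] = [a', b']"
    by (intro ex_permutes_map) (auto simp: ordered_pairs_def)
  then obtain s where s: "s \<in> Sym5" "s a = a'" "s b = b'" by auto
  have "diag s \<circ> id \<in> {a \<circ> z | a z. a \<in> diag ` Sym5 \<and> z \<in> Z}" using s(1) assms by blast
  then show "\<exists>s \<in> Sym5. diag s \<in> {a \<circ> z | a z. a \<in> diag ` Sym5 \<and> z \<in> Z} \<and> s a = a' \<and> s b = b'"
    using s by auto
qed

text \<open>If \<open>M\<close> contains \<open>diag s \<circ> z\<close> with \<open>s \<noteq> id\<close>, then its commutator with some \<open>diag t\<close> is of the form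
\<open>diag r\<close>, where the central factor \<open>z\<close> has cancelled, and \<open>r \<noteq> id\<close> if \<open>t\<close> is chosen not to commute with \<open>s\<close>.
So \<open>M\<close> meets the symmetric group in a non-trivial normal subgroup.\<close>
lemma normal_pairs:
  assumes Zsub: "Z \<subseteq> {id, flip}" and idZ: "id \<in> Z"
    and M: "normal_perms M {a \<circ> z | a z. a \<in> diag ` Sym5 \<and> z \<in> Z}" and nontriv: "\<not> M \<subseteq> Z"
  shows "transitive_perms {..<20} M"
proof -
  let ?F = "{a \<circ> z | a z. a \<in> diag ` Sym5 \<and> z \<in> Z}"
  interpret label_action 20 underlying "diag ` Sym5" Z by (rule label_action_pairs[OF Zsub idZ])
  have diag_F: "diag s \<in> ?F" if "s \<in> Sym5" for s
  proof -
    have "diag s \<circ> id \<in> ?F" using that idZ by blast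
    then show ?thesis by simp
  qed
  have conj: "f \<circ> m \<circ> inv_into UNIV f \<in> M" if "f \<in> ?F" "m \<in> M" for f m
    using M that unfolding normal_perms_def by blast
  have M_comp: "f \<circ> g \<in> M" if "f \<in> M" "g \<in> M" for f g using M that unfolding normal_perms_def by blast
  have M_inv: "inv_into UNIV f \<in> M" if "f \<in> M" for f using M that unfolding normal_perms_def by blast
  obtain m where m: "m \<in> M" "m \<notin> Z" using nontriv by blast
  then have "m \<in> ?F" using M unfolding normal_perms_def by blast
  then obtain s z where s: "m = diag s \<circ> z" "s \<in> Sym5" "z \<in> Z" by blast
  have "s \<noteq> id" using m(2) s diag_id by auto
  then obtain p where p: "s p \<noteq> p" by (auto simp: fun_eq_iff)
  have p5: "p \<in> {..<5}" "s p \<in> {..<5}"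
    using p permutes_not_in[of s "{..<5}" p] permutes_in_image[of s "{..<5}" p] s(2) by auto
  obtain c where c: "c \<in> {..<5}" "c \<notin> set [p, s p]"
    by (rule ex_outside[of "[p, s p]" "{..<5 :: nat}"]) auto
  \<comment> \<open>\<open>s \<circ> t\<close> maps \<open>p\<close> to \<open>s p\<close>, and \<open>t \<circ> s\<close> maps it to \<open>c\<close>.\<close>
  define t where "t = Transposition.transpose (s p) c"
  have t: "t \<in> Sym5" using p5 c by (simp add: t_def permutes_swap_id)
  have i: "inv_into UNIV s \<in> Sym5" using s(2) by (simp add: permutes_inv)
  define r where "r = s \<circ> (t \<circ> (inv_into UNIV s \<circ> t))"
  have sub: "inv_into UNIV s \<circ> t \<in> Sym5" "t \<circ> (inv_into UNIV s \<circ> t) \<in> Sym5" "r \<in> Sym5"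
    using s(2) t i by (simp_all add: r_def permutes_compose)
  have "diag r = m \<circ> (diag t \<circ> inv_into UNIV m \<circ> inv_into UNIV (diag t))"
  proof -
    have "inv_into UNIV m = inv_into UNIV z \<circ> diag (inv_into UNIV s)"
      unfolding s(1) using inv_exchange[OF imageI[OF s(2)] s(3)] diag_inv[OF s(2)]
        commute[OF imageI[OF i] Z_inv[OF s(3)]] by simp
    moreover have "inv_into UNIV (diag t) = diag t" using diag_inv[OF t] by (simp add: t_def)
    ultimately have "m \<circ> (diag t \<circ> inv_into UNIV m \<circ> inv_into UNIV (diag t))
        = diag s \<circ> (z \<circ> diag t) \<circ> inv_into UNIV z \<circ> diag (inv_into UNIV s) \<circ> diag t"
      by (simp add: s(1) comp_assoc)
    also have "z \<circ> diag t = diag t \<circ> z" using commute[OF imageI[OF t] s(3)] by simp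
    also have "diag s \<circ> (diag t \<circ> z) \<circ> inv_into UNIV z \<circ> diag (inv_into UNIV s) \<circ> diag t
        = diag s \<circ> diag t \<circ> (z \<circ> inv_into UNIV z) \<circ> diag (inv_into UNIV s) \<circ> diag t"
      by (simp add: comp_assoc)
    also have "z \<circ> inv_into UNIV z = id" by (rule permutes_inv_o[OF Z_permutes[OF s(3)]])
    also have "diag s \<circ> diag t \<circ> id \<circ> diag (inv_into UNIV s) \<circ> diag t = diag r"
      using diag_comp[OF s(2) sub(2)] diag_comp[OF t sub(1)] diag_comp[OF i t]
      by (simp add: r_def comp_assoc)
    finally show ?thesis by (rule sym)
  qed
  then have r_M: "diag r \<in> M" using M_comp[OF m(1) conj[OF diag_F[OF t] M_inv[OF m(1)]]] by simp
  have "r \<noteq> id"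
  proof
    assume "r = id"
    then have "r (t (s p)) = t (s p)" by simp
    moreover have "r (t (s p)) = s (t p)"
      using permutes_inverses(2)[of s "{..<5}" p] s(2) by (simp add: r_def t_def)
    moreover have "t p = p" "t (s p) = c" using p c by (auto simp: t_def)
    ultimately show False using c by auto
  qed
  let ?N = "{s \<in> Sym5. diag s \<in> M}"
  have "normal_perms ?N Sym5"
    unfolding normal_perms_def
  proof (intro conjI ballI)
    show "id \<in> ?N" using M diag_id by (simp add: normal_perms_def permutes_id)
  next
    fix f g assume "f \<in> ?N" "g \<in> ?N"
    then show "f \<circ> g \<in> ?N" using M_comp diag_comp[of f g] by (simp add: permutes_compose)
  next
    fix f assume "f \<in> ?N"
    then show "inv_into UNIV f \<in> ?N" using M_inv[of "diag f"] diag_inv[of f] by (simp add: permutes_inv)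
  next
    fix f g assume f: "f \<in> Sym5" and g: "g \<in> ?N"
    then have g5: "g \<in> Sym5" and fi: "inv_into UNIV f \<in> Sym5" and fg: "f \<circ> g \<in> Sym5"
      by (simp_all add: permutes_inv permutes_compose)
    have "diag (f \<circ> g \<circ> inv_into UNIV f) = diag f \<circ> diag g \<circ> inv_into UNIV (diag f)"
      using diag_comp[OF fg fi] diag_comp[OF f g5] diag_inv[OF f] by simp
    then show "f \<circ> g \<circ> inv_into UNIV f \<in> ?N"
      using conj[OF diag_F[OF f]] g fg fi by (simp add: permutes_compose)
  qed blast
  note N = this
  show ?thesis
  proof (rule transitive_diag)
    fix a b a' b' assume ab: "(a, b) \<in> ordered_pairs 5" "(a', b') \<in> ordered_pairs 5"
    have "\<exists>q \<in> ?N. q a = a' \<and> q b = b'"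
      by (rule normal_Sym_2_transitive[OF _ N _ \<open>r \<noteq> id\<close>])
        (use ab r_M sub(3) in \<open>auto simp: ordered_pairs_def\<close>)
    then show "\<exists>s \<in> Sym5. diag s \<in> M \<and> s a = a' \<and> s b = b'" by blast
  qed
qed

lemma pairs_closed_nondiscrete_cg:
  assumes Zsub: "Z \<subseteq> {id, flip}" and idZ: "id \<in> Z"
  shows "closed_nondiscrete_cg_subgroup (Td 20) (label_action.H 20 underlying (diag ` Sym5) Z)"
proof -
  interpret label_action 20 underlying "diag ` Sym5" Z by (rule label_action_pairs[OF Zsub idZ])
  let ?t = "Transposition.transpose 0 (1 :: nat)"
  have t: "?t \<in> Sym5" by (auto intro: permutes_swap_id)
  obtain c23 c02 c01 where c: "c23 < 20" "dec c23 = (2, 3)" "c02 < 20" "dec c02 = (0, 2)" "c01 < 20" "dec c01 = (0, 1)"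
    using dec_ex[OF dec, of "(2, 3)"] dec_ex[OF dec, of "(0, 2)"] dec_ex[OF dec, of "(0, 1)"]
    by (auto simp: ordered_pairs_def)
  show ?thesis
  proof (rule H_closed_nondiscrete_cg)
    show "diag ?t \<in> diag ` Sym5" using t by blast
    have "dec (diag ?t c02) \<noteq> dec c02" using dec_diag[OF t c(3)] c(4) by simp
    then show "diag ?t \<noteq> id" by auto
    show "{2, 3} \<in> labels" by (rule label_in_labels[OF c(1)]) (simp add: underlying_def c(2))
    show "{0, 1} \<in> labels" by (rule label_in_labels[OF c(5)]) (simp add: underlying_def c(6))
    show "{2, 3} \<noteq> {0, 1 :: nat}" by (simp add: doubleton_eq_iff)
    show "diag ?t c = c" if cc: "c < 20" "underlying c = Some {2, 3}" for c
    proof -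
      have "fst (dec c) \<in> {2, 3}" "snd (dec c) \<in> {2, 3}" using cc(2) by (auto simp: underlying_def)
      then have "map_prod ?t ?t (dec c) = dec c" by (cases "dec c") auto
      then show ?thesis
        using recolour_apply_iff[OF dec diag_pairs[OF t] cc(1) cc(1)] by (simp add: diag_def)
    qed
  qed
qed

end

lemma ex_quasi_central_elliptic:
  "\<exists>H. closed_nondiscrete_cg_subgroup (Td 20) H \<and> locally_acts perm_semiprimitive (Td 20) H
    \<and> (\<exists>g. quasi_central (Td 20) H g \<and> g \<noteq> \<one>\<^bsub>AutG (Td 20)\<^esub> \<and> elliptic (Td 20) g)"
proof -
  obtain dec where "bij_betw dec {..<20 :: nat} (ordered_pairs 5)" using ex_ordered_pairs_enum by (rule exE)
  then interpret pair_colours dec by unfold_locales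
  let ?Z = "{id, flip}"
  have Zsub: "?Z \<subseteq> {id, flip}" and idZ: "id \<in> ?Z" by auto
  interpret label_action 20 underlying "diag ` Sym5" ?Z by (rule label_action_pairs[OF Zsub idZ])
  have F: "F = {a \<circ> z | a z. a \<in> diag ` Sym5 \<and> z \<in> ?Z}" by (simp add: F_def)
  let ?g = "aut_of 20 [] (\<lambda>_. flip)"
  have p: "portrait 20 (\<lambda>_. flip)" by (rule portrait_const[OF flip_permutes])
  have "locally_acts perm_semiprimitive (Td 20) H"
  proof (rule locally_semiprimitiveI)
    show "transitive_perms {..<20} F" unfolding F by (rule transitive_all[OF idZ])
    fix M assume M: "normal_perms M F"
    show "transitive_perms {..<20} M \<or> (\<forall>f \<in> M. \<forall>c < 20. f c = c \<longrightarrow> f = id)"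
    proof (cases "M \<subseteq> ?Z")
      case True
      then show ?thesis using flip_no_fixed_colour by blast
    next
      case False
      then show ?thesis using normal_pairs[OF Zsub idZ M[unfolded F]] by blast
    qed
  qed
  moreover have "closed_nondiscrete_cg_subgroup (Td 20) H" by (rule pairs_closed_nondiscrete_cg[OF Zsub idZ])
  moreover have "quasi_central (Td 20) H ?g" by (rule quasi_central_aut_of) auto
  moreover have "?g \<noteq> \<one>\<^bsub>AutG (Td 20)\<^esub>"
  proof
    assume "?g = \<one>\<^bsub>AutG (Td 20)\<^esub>"
    then have "flip = id" using loc_aut_of[OF Nil_in_words p Nil_in_words] loc_one[OF Nil_in_words] by simp
    then show False using flip_no_fixed_colour[of 0] by simp
  qed
  moreover have "elliptic (Td 20) ?g"
  proof -
    have "walk (Td 20) [] [] []" by simp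
    then have "gdist (Td 20) [] [] = 0" using gdist_le by fastforce
    then have "translation_length (Td 20) ?g = 0"
      using fst_aut_of[OF Nil_in_words p Nil_in_words]
      by (intro translation_length_eqI[of "[]"]) simp_all
    then show ?thesis by (simp add: elliptic_def)
  qed
  ultimately show ?thesis by blast
qed

lemma ex_quasi_central_hyperbolic_2:
  "\<exists>H. closed_nondiscrete_cg_subgroup (Td 20) H \<and> locally_acts perm_quasiprimitive (Td 20) H
    \<and> (\<exists>g. quasi_central (Td 20) H g \<and> hyperbolic_of_length (Td 20) 2 g)"
proof -
  obtain dec where "bij_betw dec {..<20 :: nat} (ordered_pairs 5)" using ex_ordered_pairs_enum by (rule exE)
  then interpret pair_colours dec by unfold_locales
  let ?Z = "{id :: nat \<Rightarrow> nat}"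
  have Zsub: "?Z \<subseteq> {id, flip}" and idZ: "id \<in> ?Z" by auto
  interpret label_action 20 underlying "diag ` Sym5" ?Z by (rule label_action_pairs[OF Zsub idZ])
  have F: "F = {a \<circ> z | a z. a \<in> diag ` Sym5 \<and> z \<in> ?Z}" by (simp add: F_def)
  let ?g = "aut_of 20 [0, flip 0] (\<lambda>_. id)"
  have f: "flip 0 < 20" "flip 0 \<noteq> 0" using flip_less[of 0] flip_no_fixed_colour[of 0] by simp_all
  have "locally_acts perm_quasiprimitive (Td 20) H"
  proof (rule locally_quasiprimitiveI)
    show "transitive_perms {..<20} F" unfolding F by (rule transitive_all[OF idZ])
    fix M assume M: "normal_perms M F" "M \<noteq> {id}"
    then have "\<not> M \<subseteq> ?Z" unfolding normal_perms_def by blast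
    then show "transitive_perms {..<20} M" using normal_pairs[OF Zsub idZ M(1)[unfolded F]] by blast
  qed
  moreover have "closed_nondiscrete_cg_subgroup (Td 20) H" by (rule pairs_closed_nondiscrete_cg[OF Zsub idZ])
  moreover have "quasi_central (Td 20) H ?g"
  proof (rule quasi_central_aut_of)
    show "[0, flip 0] \<in> words {..<20}" using f by (auto simp: words_def)
    have "underlying (flip 0) = underlying 0" using dec_flip[of 0] by (auto simp: underlying_def)
    then show "proj [0, flip 0] = []" by (simp add: proj_def label_step_def underlying_def nbr_def)
  qed simp
  moreover have "hyperbolic_of_length (Td 20) 2 ?g" by (rule hyperbolic_length_2) (use f in auto)
  ultimately show ?thesis by blast
qed

theorem theorem4p2:
  shows
    "(\<exists>d \<ge> 3. \<exists>H. closed_nondiscrete_cg_subgroup (Td d) H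
        \<and> locally_acts perm_intransitive (Td d) H
        \<and> (\<exists>g. quasi_central (Td d) H g \<and> inversion (Td d) g))
   \<and> (\<exists>d \<ge> 3. \<exists>H. closed_nondiscrete_cg_subgroup (Td d) H
        \<and> locally_acts perm_transitive (Td d) H
        \<and> (\<exists>g. quasi_central (Td d) H g \<and> g \<noteq> \<one>\<^bsub>AutG (Td d)\<^esub> \<and> edge_fixating (Td d) g))
   \<and> (\<exists>d \<ge> 3. \<exists>H. closed_nondiscrete_cg_subgroup (Td d) H
        \<and> locally_acts perm_semiprimitive (Td d) H
        \<and> (\<exists>g. quasi_central (Td d) H g \<and> g \<noteq> \<one>\<^bsub>AutG (Td d)\<^esub> \<and> elliptic (Td d) g))
   \<and> (\<exists>d \<ge> 3. \<exists>H. closed_nondiscrete_cg_subgroup (Td d) H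
        \<and> locally_acts perm_intransitive (Td d) H
        \<and> (\<exists>g. quasi_central (Td d) H g \<and> hyperbolic_of_length (Td d) 1 g))
   \<and> (\<exists>d \<ge> 3. \<exists>H. closed_nondiscrete_cg_subgroup (Td d) H
        \<and> locally_acts perm_quasiprimitive (Td d) H
        \<and> (\<exists>g. quasi_central (Td d) H g \<and> hyperbolic_of_length (Td d) 2 g))"
proof (intro conjI)
  show "\<exists>d \<ge> 3. \<exists>H. closed_nondiscrete_cg_subgroup (Td d) H
      \<and> locally_acts perm_intransitive (Td d) H
      \<and> (\<exists>g. quasi_central (Td d) H g \<and> inversion (Td d) g)"
    using ex_quasi_central_inversion by (intro exI[of _ 4]) simp
  show "\<exists>d \<ge> 3. \<exists>H. closed_nondiscrete_cg_subgroup (Td d) H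
      \<and> locally_acts perm_transitive (Td d) H
      \<and> (\<exists>g. quasi_central (Td d) H g \<and> g \<noteq> \<one>\<^bsub>AutG (Td d)\<^esub> \<and> edge_fixating (Td d) g)"
    using ex_quasi_central_edge_fixating by (intro exI[of _ 9] conjI) simp_all
  show "\<exists>d \<ge> 3. \<exists>H. closed_nondiscrete_cg_subgroup (Td d) H
      \<and> locally_acts perm_semiprimitive (Td d) H
      \<and> (\<exists>g. quasi_central (Td d) H g \<and> g \<noteq> \<one>\<^bsub>AutG (Td d)\<^esub> \<and> elliptic (Td d) g)"
    using ex_quasi_central_elliptic by (intro exI[of _ 20] conjI) simp_all
  show "\<exists>d \<ge> 3. \<exists>H. closed_nondiscrete_cg_subgroup (Td d) H
      \<and> locally_acts perm_intransitive (Td d) H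
      \<and> (\<exists>g. quasi_central (Td d) H g \<and> hyperbolic_of_length (Td d) 1 g)"
    using ex_quasi_central_hyperbolic_1 by (intro exI[of _ 5] conjI) simp_all
  show "\<exists>d \<ge> 3. \<exists>H. closed_nondiscrete_cg_subgroup (Td d) H
      \<and> locally_acts perm_quasiprimitive (Td d) H
      \<and> (\<exists>g. quasi_central (Td d) H g \<and> hyperbolic_of_length (Td d) 2 g)"
    using ex_quasi_central_hyperbolic_2 by (intro exI[of _ 20] conjI) simp_all
qed

end
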